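(* Let $k$ be a positive integer, $\lambda$ a strict partition with $\lambda_1<k$, and $a\le b$ positive integers. Then $$G^C_{w(\lambda,k)\cdot w(a,b,k)}=GQ^{(\beta)}_\lambda\cdot GQ^{(\beta)}_{\tau(a,b)}.$$
   Context: $w(\lambda,k)\in W_k$ denotes the Grassmannian signed permutation of $\lambda$: the unique $w\in W_k$ with $w(1)<w(2)<\dots<w(k)$ whose negative values among $w(1),\dots,w(k)$ are exactly $-\lambda_1<-\lambda_2<\cdots$. For positive integers $a,b,k$ put $\ell=a+k$, $n=a+b+k$, and let $w(a,b,k)\in S_n\subset W_n$ have one-line notation $1\,2\cdots k\ \ \ell{+}1\ \ \ell{+}2\cdots n\ \ k{+}1\ \ k{+}2\cdots\ell$. The product is taken in $W_n$ (with $W_k\subset W_n$ naturally). For $a\le b$, $\tau(a,b)=(a+b-1,\,a+b-3,\,\dots,\,b-a+1)$. **Signed permutations.** $W_n$ is the group of bijections $w$ of $\{-n,\dots,-1,1,\dots,n\}$ with $w(-i)=-w(i)$, written in one-line notation $w(1)\cdots w(n)$; Coxeter generators $s_0=(-1\ 1)$, $s_i=(-i{-}1\ \,{-}i)(i\ \,i{+}1)$ for $1\le i\le n-1$; $S_n\subset W_n$ consists of those $w$ with $w(i)>0$ for $i>0$. **$G^C_w$.** Let $u_0,\dots,u_{n-1}$ be noncommuting variables (commuting with $\beta$ and $x_1,x_2,\dots$) with $u_i^2=\beta u_i$, $u_1u_0u_1u_0=u_0u_1u_0u_1$, $u_iu_{i+1}u_i=u_{i+1}u_iu_{i+1}$ ($i>0$),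 $u_iu_j=u_ju_i$ ($|i-j|>1$). For $w\in W_n$ with reduced word $(a_1,\dots,a_m)$ put $u_w=u_{a_1}\cdots u_{a_m}$. $G^C_w$ is the coefficient of $u_w$ in $$\prod_{i\ge1}(1+x_iu_{n-1})\cdots(1+x_iu_1)(1+x_iu_0)(1+x_iu_0)(1+x_iu_1)\cdots(1+x_iu_{n-1}),$$ the product taken in order $i=1,2,\dots$ from left to right. **$GQ$.** A strict partition is $\lambda=(\lambda_1>\dots>\lambda_r>0)$, with shifted diagram $D_\lambda=\{(i,j):1\le i\le r,\ i\le j\le\lambda_i+i-1\}$. Order $\mathbb{Z}\setminus\{0\}$ by $\bar1\prec1\prec\bar2\prec2\prec\cdots$, where $\bar a=-a$. A shifted set-valued semistandard tableau of shape $\lambda$ is a filling $T$ of $D_\lambda$ by finite nonempty subsets of $\mathbb{Z}\setminus\{0\}$ with $\max T_{ij}\preceq\min T_{i+1,j}$, equality allowed only for negative values, and $\max T_{ij}\preceq\min T_{i,j+1}$, equality allowed only for positive values ($\max,\min$ with respect to $\prec$). With $|T|=\sum|T_{ij}|$ and $x^T=\prod_{(i,j)}\prod_{s\in T_{ij}}x_{|s|}$, set $GQ^{(\beta)}_\lambda=\sum_T\beta^{|T|-|\lambda|}x^T$. *)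

theory Defs
  imports
    "HOL-Library.Poly_Mapping"
    "HOL-Computational_Algebra.Polynomial"
    "HOL-Combinatorics.Permutations"
begin

section \<open>Formal power series in countably many commuting variables\<close>

text \<open>
  A series assigns a coefficient to every monomial. The monomial \<open>m\<close> stands for the product
  of all \<open>x\<^sub>i ^ m(i)\<close>. The coefficient ring need not be commutative; the variables commute
  with the coefficients. The variables below are \<open>x\<^sub>1, x\<^sub>2, \<dots>\<close>; the index \<open>0\<close> is never used.
\<close>

type_synonym monomial = "nat \<Rightarrow>\<^sub>0 nat"

typedef 'a mps = "UNIV :: (monomial \<Rightarrow> 'a) set"
  morphisms mps_coeff Abs_mps ..

setup_lifting type_definition_mps

lemma mps_eqI: "(\<And>m. mps_coeff f m = mps_coeff g m) \<Longrightarrow> f = g"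
  by transfer auto

lemma finite_monomial_splits: "finite {(p, q). p + q = (m :: monomial)}"
proof -
  let ?K = "Poly_Mapping.keys m"
  let ?B = "{p :: monomial. \<forall>i. Poly_Mapping.lookup p i \<le> Poly_Mapping.lookup m i}"
  let ?D = "{f :: nat \<Rightarrow> nat. \<forall>i. (i \<in> ?K \<longrightarrow> f i \<in> {..Max (Poly_Mapping.lookup m ` ?K)}) \<and> (i \<notin> ?K \<longrightarrow> f i = 0)}"
  have "finite ?D"
    by (rule finite_set_of_finite_funs) auto
  moreover have "Poly_Mapping.lookup ` ?B \<subseteq> ?D"
  proof clarify
    fix p :: monomial and i
    assume le: "\<forall>i. Poly_Mapping.lookup p i \<le> Poly_Mapping.lookup m i"
    show "(i \<in> ?K \<longrightarrow> Poly_Mapping.lookup p i \<in> {..Max (Poly_Mapping.lookup m ` ?K)}) \<and> (i \<notin> ?K \<longrightarrow> Poly_Mapping.lookup p i = 0)"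
    proof (intro conjI impI)
      assume "i \<in> ?K"
      then have "Poly_Mapping.lookup m i \<le> Max (Poly_Mapping.lookup m ` ?K)" by (intro Max_ge) auto
      then show "Poly_Mapping.lookup p i \<in> {..Max (Poly_Mapping.lookup m ` ?K)}"
        using le le_trans by blast
    next
      assume "i \<notin> ?K"
      then have "Poly_Mapping.lookup m i = 0" by (simp add: in_keys_iff)
      then show "Poly_Mapping.lookup p i = 0" using le by (metis le_zero_eq)
    qed
  qed
  ultimately have "finite (Poly_Mapping.lookup ` ?B)" using finite_subset by blast
  moreover have "inj_on Poly_Mapping.lookup ?B"
    by (auto simp: inj_on_def lookup_inject)
  ultimately have fin: "finite ?B" using finite_imageD by blast
  have "{(p, q). p + q = m} \<subseteq> ?B \<times> ?B"
    by (auto simp: lookup_add)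
  then show ?thesis
    using fin finite_subset by blast
qed

instantiation mps :: (semiring_1) semiring_1
begin

lift_definition zero_mps :: "'a mps" is "\<lambda>_. 0" .
lift_definition one_mps :: "'a mps" is "\<lambda>m. if m = 0 then 1 else 0" .
lift_definition plus_mps :: "'a mps \<Rightarrow> 'a mps \<Rightarrow> 'a mps" is "\<lambda>f g m. f m + g m" .
lift_definition times_mps :: "'a mps \<Rightarrow> 'a mps \<Rightarrow> 'a mps" is
  "\<lambda>f g m. \<Sum>(p, q) | p + q = m. f p * g q" .

instance
proof
  fix a b c :: "'a mps"
  show "a * b * c = a * (b * c)"
  proof (rule mps_eqI)
    fix m :: monomial
    let ?a = "mps_coeff a" and ?b = "mps_coeff b" and ?c = "mps_coeff c"
    have "mps_coeff (a * b * c) m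
        = (\<Sum>(s, r)\<in>{(s, r). s + r = m}. \<Sum>(p, q)\<in>{(p, q). p + q = s}. ?a p * ?b q * ?c r)"
      by (simp add: times_mps.rep_eq sum_distrib_right case_prod_unfold)
    also have "\<dots> = (\<Sum>((s, r), (p, q))\<in>(SIGMA z:{(s, r). s + r = m}. {(p, q). p + q = fst z}).
        ?a p * ?b q * ?c r)"
      by (subst sum.Sigma[symmetric])
        (auto simp: finite_monomial_splits case_prod_unfold finite_monomial_splits[unfolded case_prod_unfold])
    also have "\<dots> = (\<Sum>((p, t), (q, r))\<in>(SIGMA z:{(p, t). p + t = m}. {(q, r). q + r = snd z}).
        ?a p * ?b q * ?c r)"
      by (rule sum.reindex_bij_witness
          [where i = "\<lambda>((p, t), (q, r)). ((p + q, r), (p, q))"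
            and j = "\<lambda>((s, r), (p, q)). ((p, q + r), (q, r))"])
        (auto simp: add.assoc)
    also have "\<dots> = (\<Sum>(p, t)\<in>{(p, t). p + t = m}. \<Sum>(q, r)\<in>{(q, r). q + r = t}. ?a p * ?b q * ?c r)"
      by (subst sum.Sigma[symmetric])
        (auto simp: finite_monomial_splits case_prod_unfold finite_monomial_splits[unfolded case_prod_unfold])
    also have "\<dots> = mps_coeff (a * (b * c)) m"
      by (simp add: times_mps.rep_eq sum_distrib_left case_prod_unfold mult.assoc)
    finally show "mps_coeff (a * b * c) m = mps_coeff (a * (b * c)) m" .
  qed
  show "1 * a = a"
  proof (rule mps_eqI)
    fix m :: monomial
    have "mps_coeff (1 * a) m = (\<Sum>(p, q)\<in>{(0 :: monomial, m)}. (if p = 0 then 1 else 0) * mps_coeff a q)"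
      unfolding times_mps.rep_eq one_mps.rep_eq
      by (rule sum.mono_neutral_right) (auto simp: finite_monomial_splits split: if_splits)
    then show "mps_coeff (1 * a) m = mps_coeff a m" by simp
  qed
  show "a * 1 = a"
  proof (rule mps_eqI)
    fix m :: monomial
    have "mps_coeff (a * 1) m = (\<Sum>(p, q)\<in>{(m, 0 :: monomial)}. mps_coeff a p * (if q = 0 then 1 else 0))"
      unfolding times_mps.rep_eq one_mps.rep_eq
      by (rule sum.mono_neutral_right) (auto simp: finite_monomial_splits split: if_splits)
    then show "mps_coeff (a * 1) m = mps_coeff a m" by simp
  qed
  show "(a + b) * c = a * c + b * c"
    by (rule mps_eqI)
      (simp add: times_mps.rep_eq plus_mps.rep_eq distrib_right sum.distrib case_prod_unfold)
  show "a * (b + c) = a * b + a * c"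
    by (rule mps_eqI)
      (simp add: times_mps.rep_eq plus_mps.rep_eq distrib_left sum.distrib case_prod_unfold)
  show "0 * a = 0"
    by (rule mps_eqI) (simp add: times_mps.rep_eq zero_mps.rep_eq)
  show "a * 0 = 0"
    by (rule mps_eqI) (simp add: times_mps.rep_eq zero_mps.rep_eq)
  show "a + b + c = a + (b + c)"
    by (rule mps_eqI) (simp add: plus_mps.rep_eq add.assoc)
  show "a + b = b + a"
    by (rule mps_eqI) (simp add: plus_mps.rep_eq add.commute)
  show "0 + a = a"
    by (rule mps_eqI) (simp add: plus_mps.rep_eq zero_mps.rep_eq)
  show "(0 :: 'a mps) \<noteq> 1"
  proof
    assume "(0 :: 'a mps) = 1"
    then have "mps_coeff (0 :: 'a mps) 0 = mps_coeff 1 0" by simp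
    then show False by (simp add: zero_mps.rep_eq one_mps.rep_eq)
  qed
qed

end

lift_definition mps_const :: "'a :: zero \<Rightarrow> 'a mps" is
  "\<lambda>c m. if m = 0 then c else 0" .

lift_definition mps_var :: "nat \<Rightarrow> 'a :: zero_neq_one mps" is
  "\<lambda>i m. if m = Poly_Mapping.single i 1 then 1 else 0" .

text \<open>
  The infinite product \<open>F 1 * F 2 * \<dots>\<close>, ordered from left to right: every coefficient is the
  eventual value of the corresponding coefficient of the finite partial products.
\<close>

lift_definition mps_infprod :: "(nat \<Rightarrow> 'a :: semiring_1 mps) \<Rightarrow> 'a mps" is
  "\<lambda>F m. THE c. \<forall>\<^sub>F N in sequentially. mps_coeff (prod_list (map F [1..<Suc N])) m = c" .


section \<open>Signed permutations\<close>

text \<open>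
  Elements of \<open>W\<^sub>n\<close> are extended by the identity to all integers, so that
  \<open>W\<^sub>k \<subseteq> W\<^sub>n\<close> for \<open>k \<le> n\<close> and the group operation is \<open>(\<circ>)\<close>.
\<close>

definition signed_perms :: "nat \<Rightarrow> (int \<Rightarrow> int) set" where
  "signed_perms n = {w. w permutes ({- int n..int n} - {0}) \<and> (\<forall>i. w (- i) = - w i)}"

definition cox_gen :: "nat \<Rightarrow> int \<Rightarrow> int" where
  "cox_gen i = (if i = 0 then transpose (- 1) 1
     else transpose (- int i - 1) (- int i) \<circ> transpose (int i) (int i + 1))"

definition word_perm :: "nat list \<Rightarrow> int \<Rightarrow> int" where
  "word_perm as = foldr (\<circ>) (map cox_gen as) id"

definition reduced_word :: "nat \<Rightarrow> (int \<Rightarrow> int) \<Rightarrow> nat list \<Rightarrow> bool" where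
  "reduced_word n w as \<longleftrightarrow> set as \<subseteq> {..<n} \<and> word_perm as = w \<and>
     (\<forall>bs. set bs \<subseteq> {..<n} \<and> word_perm bs = w \<longrightarrow> length as \<le> length bs)"

definition of_one_line :: "int list \<Rightarrow> int \<Rightarrow> int" where
  "of_one_line xs i =
     (if 1 \<le> i \<and> i \<le> int (length xs) then xs ! nat (i - 1)
      else if - int (length xs) \<le> i \<and> i \<le> - 1 then - (xs ! nat (- i - 1))
      else i)"

definition strict_partition :: "nat list \<Rightarrow> bool" where
  "strict_partition la \<longleftrightarrow> sorted_wrt (>) la \<and> 0 \<notin> set la"

definition grassmannian :: "nat list \<Rightarrow> nat \<Rightarrow> int \<Rightarrow> int" where
  "grassmannian la k = (THE w. w \<in> signed_perms k \<and> strict_mono_on {1..int k} w \<and>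
     w ` {1..int k} \<inter> {..<0} = (\<lambda>p. - int p) ` set la)"

definition block_perm :: "nat \<Rightarrow> nat \<Rightarrow> nat \<Rightarrow> int \<Rightarrow> int" where
  "block_perm a b k = (let l = int (a + k); n = int (a + b + k) in
     of_one_line ([1..int k] @ [l + 1..n] @ [int k + 1..l]))"


section \<open>The algebra generated by the \<open>u\<^sub>i\<close>\<close>

datatype word = Word (letters: "nat list")

instantiation word :: monoid_add
begin

definition zero_word :: word where "zero_word = Word []"
definition plus_word :: "word \<Rightarrow> word \<Rightarrow> word" where
  "plus_word v w = Word (letters v @ letters w)"

instance
  by standard (auto simp: zero_word_def plus_word_def)

end

text \<open>
  The coefficient ring is \<open>\<int>[\<beta>]\<close>, rendered as \<open>int poly\<close>. Since addition of words is
  concatenation, \<open>word \<Rightarrow>\<^sub>0 int poly\<close> is the free associative \<open>\<int>[\<beta>]\<close>-algebra on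
  \<open>u\<^sub>0, u\<^sub>1, \<dots>\<close>.
\<close>

type_synonym free_alg = "word \<Rightarrow>\<^sub>0 int poly"

definition beta :: "int poly" where
  "beta = [:0, 1:]"

definition scalar :: "int poly \<Rightarrow> free_alg" where
  "scalar c = Poly_Mapping.single 0 c"

definition u_gen :: "nat \<Rightarrow> free_alg" where
  "u_gen i = Poly_Mapping.single (Word [i]) 1"

definition free_alg_on :: "nat \<Rightarrow> free_alg set" where
  "free_alg_on n = {f. \<forall>v \<in> Poly_Mapping.keys f. set (letters v) \<subseteq> {..<n}}"

definition relators :: "nat \<Rightarrow> free_alg set" where
  "relators n =
     {u_gen i * u_gen i - scalar beta * u_gen i | i. i < n}
   \<union> (if 1 < n then {u_gen 1 * u_gen 0 * u_gen 1 * u_gen 0 - u_gen 0 * u_gen 1 * u_gen 0 * u_gen 1} else {})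
   \<union> {u_gen i * u_gen (i + 1) * u_gen i - u_gen (i + 1) * u_gen i * u_gen (i + 1) | i. 0 < i \<and> i + 1 < n}
   \<union> {u_gen i * u_gen j - u_gen j * u_gen i | i j. i < n \<and> j < n \<and> \<bar>int i - int j\<bar> > 1}"

text \<open>The two-sided ideal of \<open>free_alg_on n\<close> generated by the relators.\<close>

inductive_set rel_ideal :: "nat \<Rightarrow> free_alg set" for n where
  zero: "0 \<in> rel_ideal n"
| gen: "\<lbrakk>r \<in> relators n; f \<in> free_alg_on n; g \<in> free_alg_on n\<rbrakk> \<Longrightarrow> f * r * g \<in> rel_ideal n"
| add: "\<lbrakk>f \<in> rel_ideal n; g \<in> rel_ideal n\<rbrakk> \<Longrightarrow> f + g \<in> rel_ideal n"

definition u_perm :: "nat \<Rightarrow> (int \<Rightarrow> int) \<Rightarrow> free_alg" where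
  "u_perm n w = prod_list (map u_gen (SOME as. reduced_word n w as))"

text \<open>
  Modulo the ideal, every element of \<open>free_alg_on n\<close> is a unique \<open>\<int>[\<beta>]\<close>-linear combination
  of the \<open>u\<^sub>v\<close> with \<open>v \<in> W\<^sub>n\<close>, and \<open>u\<^sub>v\<close> does not depend on the chosen reduced word.
\<close>

definition u_coeff :: "nat \<Rightarrow> (int \<Rightarrow> int) \<Rightarrow> free_alg \<Rightarrow> int poly" where
  "u_coeff n w f = (THE c. \<exists>h. h w = c \<and>
     f - (\<Sum>v \<in> signed_perms n. scalar (h v) * u_perm n v) \<in> rel_ideal n)"

definition GC_factor :: "nat \<Rightarrow> nat \<Rightarrow> free_alg mps" where
  "GC_factor n i =
     prod_list (map (\<lambda>j. 1 + mps_var i * mps_const (u_gen j)) (rev [0..<n] @ [0..<n]))"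

lift_definition GC :: "nat \<Rightarrow> (int \<Rightarrow> int) \<Rightarrow> int poly mps" is
  "\<lambda>n w m. u_coeff n w (mps_coeff (mps_infprod (GC_factor n)) m)" .


section \<open>Shifted set-valued tableaux\<close>

definition shifted_diagram :: "nat list \<Rightarrow> (nat \<times> nat) set" where
  "shifted_diagram la = {(i, j). 1 \<le> i \<and> i \<le> length la \<and> i \<le> j \<and> j \<le> la ! (i - 1) + i - 1}"

text \<open>Position in the order \<open>-1 \<prec> 1 \<prec> -2 \<prec> 2 \<prec> \<dots>\<close> on the nonzero integers.\<close>

definition prec_rank :: "int \<Rightarrow> int" where
  "prec_rank s = (if s > 0 then 2 * s else - 2 * s - 1)"

definition prec_max :: "int set \<Rightarrow> int" where
  "prec_max S = arg_max_on prec_rank S"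

definition prec_min :: "int set \<Rightarrow> int" where
  "prec_min S = arg_min_on prec_rank S"

text \<open>Fillings are set to \<open>{}\<close> outside the diagram, so that distinct functions are distinct tableaux.\<close>

definition shifted_svt :: "nat list \<Rightarrow> (nat \<times> nat \<Rightarrow> int set) set" where
  "shifted_svt la = {T.
     (\<forall>c. c \<notin> shifted_diagram la \<longrightarrow> T c = {}) \<and>
     (\<forall>c \<in> shifted_diagram la. finite (T c) \<and> T c \<noteq> {} \<and> 0 \<notin> T c) \<and>
     (\<forall>i j. (i, j) \<in> shifted_diagram la \<and> (i + 1, j) \<in> shifted_diagram la \<longrightarrow>
        (let x = prec_max (T (i, j)); y = prec_min (T (i + 1, j))
         in prec_rank x < prec_rank y \<or> (x = y \<and> x < 0))) \<and>
     (\<forall>i j. (i, j) \<in> shifted_diagram la \<and> (i, j + 1) \<in> shifted_diagram la \<longrightarrow>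
        (let x = prec_max (T (i, j)); y = prec_min (T (i, j + 1))
         in prec_rank x < prec_rank y \<or> (x = y \<and> x > 0)))}"

definition svt_size :: "nat list \<Rightarrow> (nat \<times> nat \<Rightarrow> int set) \<Rightarrow> nat" where
  "svt_size la T = (\<Sum>c \<in> shifted_diagram la. card (T c))"

definition svt_weight :: "nat list \<Rightarrow> (nat \<times> nat \<Rightarrow> int set) \<Rightarrow> monomial" where
  "svt_weight la T =
     (\<Sum>c \<in> shifted_diagram la. \<Sum>s \<in> T c. Poly_Mapping.single (nat \<bar>s\<bar>) 1)"

text \<open>
  Only finitely many tableaux of a given shape have a given weight, so the coefficients below
  are honest finite sums; the size is at least \<open>sum_list la\<close>.
\<close>

lift_definition GQ :: "nat list \<Rightarrow> int poly mps" is
  "\<lambda>la m. \<Sum>T | T \<in> shifted_svt la \<and> svt_weight la T = m. beta ^ (svt_size la T - sum_list la)" .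

definition trapezoid :: "nat \<Rightarrow> nat \<Rightarrow> nat list" where
  "trapezoid a b = map (\<lambda>i. a + b - 1 - 2 * i) [0..<a]"

end

theory Submission
  imports Defs "HOL-Computational_Algebra.Computational_Algebra" "Jordan_Normal_Form.Determinant"
begin

text \<open>
  Both sides are compared after specialising \<open>\<beta>\<close> and finitely many variables to positive reals.
  The coefficient of \<open>u\<^sub>w\<close> is a matrix coefficient of a representation on pairs of strict
  partitions \<open>(p, q)\<close>: the \<open>u\<^sub>i\<close> with \<open>i < k\<close> act on \<open>p\<close> and those with \<open>i > k\<close> on \<open>q\<close> by
  \<open>\<psi>(p) \<mapsto> \<beta> \<psi>(p) + \<psi>(p with one part lowered)\<close>, while \<open>u\<^sub>k\<close> acts as zero; this suffices because
  \<open>w(\<lambda>,k) w(a,b,k)\<close> lies in the parabolic subgroup without \<open>s\<^sub>k\<close>. Hence \<open>G\<^sup>C\<^sub>w\<close> is a product of a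
  type C factor and a type A factor, each generated by adjoining the variables one at a time.

  The type C factor equals \<open>GQ\<^sub>\<lambda>\<close>, since raising the bounds on the entries of a tableau diagonal by
  diagonal obeys the same recursion. It also has an explicit formula as a sum over the alphabet;
  the type A factor is a determinant of residue sums. For the shapes \<open>\<tau>(a,b)\<close> and
  \<open>a \<times> b\<close> respectively both formulas collapse to the same sum over the \<open>a\<close>-element subsets of the alphabet.
\<close>

text \<open>Both explicit formulas are symmetric in the alphabet and change in a closed way only
  under a whole factor of the product, whereas the representation acts one \<open>u_i\<close> at a
  time. Parameters attached to the sites \<open>1, 2, ...\<close> bridge this gap: for
  \<open>j > 0\<close> a single \<open>1 + t u_j\<close> is the exchange of the parameters at
  \<open>j\<close> and \<open>j + 1\<close> when their difference in the group law
  \<open>x + y + \<beta> x y\<close> is \<open>t\<close>, so a whole factor is a round trip of one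
  parameter. The two trips differ in where the parameter changes between \<open>t\<close> and its
  inverse: at \<open>u_0\<close> in type C, at the far end, where no part sees it, in type A.

  The point \<open>- 1 / \<beta>\<close> is absorbing for this group law. It is the extra
  interpolation node in type C and the pole left over in type A, and it governs the parts equal to
  1, which no parameter reaches.

  Denominators \<open>z - y\<close> require distinct values and denominators
  \<open>1 + \<beta> z\<close> exclude this point; hence the positive reals. The coefficient of
  \<open>u_w\<close> is pinned down by a functional that vanishes on the relations, is 1 at
  \<open>u_w\<close> and 0 at every other \<open>u_v\<close>.\<close>

section \<open>Lagrange interpolation\<close>

lemma lagrange_leading_coeff:
  fixes A :: "real set" and p :: "real poly"
  assumes "finite A" "degree p < card A"
  shows "(\<Sum>a\<in>A. poly p a / (\<Prod>b\<in>A - {a}. a - b)) = coeff p (card A - 1)"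
proof -
  define l where "l a = Polynomial.smult (poly p a / (\<Prod>b\<in>A - {a}. a - b)) (\<Prod>b\<in>A - {a}. [:-b, 1:])" for a
  have degb: "degree (\<Prod>b\<in>B. [:-b, 1:]) = card B" if "finite B" for B :: "real set"
    using that by (subst degree_prod_eq_sum_degree) auto
  have lcb: "coeff (\<Prod>b\<in>B. [:-b, 1:]) (card B) = 1" if "finite B" for B :: "real set"
    using lead_coeff_prod[of "\<lambda>b. [:-b, 1:]" B] degb[OF that] by simp
  have card1: "card (A - {a}) = card A - 1" if "a \<in> A" for a
    using that assms(1) by simp
  have dl: "degree (l a) \<le> card A - 1" if "a \<in> A" for a
    using degree_smult_le[of _ "\<Prod>b\<in>A - {a}. [:-b, 1:]"] degb[of "A - {a}"] card1[OF that] assms(1)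
    unfolding l_def by (metis finite_Diff)
  have pl: "poly (l a) c = (if c = a then poly p a else 0)" if "a \<in> A" "c \<in> A" for a c
  proof (cases "c = a")
    case True
    have "(\<Prod>b\<in>A - {a}. a - b) \<noteq> 0" using assms(1) by auto
    then show ?thesis using True by (simp add: l_def poly_prod)
  next
    case False
    then have "(\<Prod>b\<in>A - {a}. poly [:-b, 1:] c) = 0"
      using that assms(1) by (intro prod_zero) auto
    then show ?thesis using False by (simp add: l_def poly_prod)
  qed
  define q where "q = p - (\<Sum>a\<in>A. l a)"
  have "q = 0"
  proof (rule ccontr)
    assume "q \<noteq> 0"
    have "degree (\<Sum>a\<in>A. l a) \<le> card A - 1"
      by (rule degree_sum_le) (use assms dl in auto)
    then have dq: "degree q < card A"
      unfolding q_def using assms(2) degree_diff_le[of p "card A - 1" "\<Sum>a\<in>A. l a"] by linarith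
    have "A \<subseteq> {x. poly q x = 0}"
      using pl assms(1) by (auto simp: q_def poly_sum)
    then have "card A \<le> card {x. poly q x = 0}"
      using \<open>q \<noteq> 0\<close> poly_roots_finite card_mono by blast
    also have "\<dots> \<le> degree q" by (rule card_poly_roots_bound[OF \<open>q \<noteq> 0\<close>])
    finally show False using dq by simp
  qed
  then have "coeff p (card A - 1) = (\<Sum>a\<in>A. coeff (l a) (card A - 1))"
    by (simp add: q_def coeff_sum)
  also have "\<dots> = (\<Sum>a\<in>A. poly p a / (\<Prod>b\<in>A - {a}. a - b))"
  proof (rule sum.cong[OF refl])
    fix a assume a: "a \<in> A"
    show "coeff (l a) (card A - 1) = poly p a / (\<Prod>b\<in>A - {a}. a - b)"
      using lcb[of "A - {a}"] card1[OF a] assms(1) by (simp add: l_def)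
  qed
  finally show ?thesis by simp
qed

text \<open>The monomial of degree \<open>card A - 1\<close> has leading coefficient 1, and its
  value at a node provides one numerator \<open>v k\<close> for each of the other nodes.\<close>

lemma lagrange_sum_one:
  fixes v :: "'a \<Rightarrow> real"
  assumes "finite A" "A \<noteq> {}" "inj_on v A"
  shows "(\<Sum>k\<in>A. \<Prod>l\<in>A - {k}. v k / (v k - v l)) = 1"
proof -
  have c: "card (v ` A) = card A" using assms by (simp add: card_image)
  have "(\<Sum>a\<in>v ` A. poly (monom 1 (card A - 1)) a / (\<Prod>b\<in>v ` A - {a}. a - b)) = 1"
    using lagrange_leading_coeff[of "v ` A" "monom 1 (card A - 1)"] assms c
    by (simp add: degree_monom_eq card_gt_0_iff)
  also have "(\<Sum>a\<in>v ` A. poly (monom 1 (card A - 1)) a / (\<Prod>b\<in>v ` A - {a}. a - b))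
    = (\<Sum>k\<in>A. v k ^ (card A - 1) / (\<Prod>b\<in>v ` A - {v k}. v k - b))"
    using assms by (subst sum.reindex) (auto simp: poly_monom)
  also have "\<dots> = (\<Sum>k\<in>A. \<Prod>l\<in>A - {k}. v k / (v k - v l))"
  proof (rule sum.cong[OF refl])
    fix k assume k: "k \<in> A"
    have "v ` A - {v k} = v ` (A - {k})" using k assms(3) by (auto dest: inj_onD)
    then have "(\<Prod>b\<in>v ` A - {v k}. v k - b) = (\<Prod>l\<in>A - {k}. v k - v l)"
      using assms(3) by (simp add: prod.reindex inj_on_diff)
    then show "v k ^ (card A - 1) / (\<Prod>b\<in>v ` A - {v k}. v k - b) = (\<Prod>l\<in>A - {k}. v k / (v k - v l))"
      using k assms(1) by (simp add: prod_dividef)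
  qed
  finally show ?thesis by simp
qed

section \<open>The type C factor\<close>

definition removable :: "nat \<Rightarrow> nat list \<Rightarrow> bool" where
  "removable j ps \<longleftrightarrow> Suc j \<in> set ps \<and> j \<notin> set ps"

text \<open>For \<open>j = 0\<close> the part 1 disappears instead of becoming a part 0, so the
  result is again a strict partition.\<close>

definition lower :: "nat \<Rightarrow> nat list \<Rightarrow> nat list" where
  "lower j ps = (if j = 0 then filter (\<lambda>p. p \<noteq> 1) ps
     else map (\<lambda>p. if p = Suc j then j else p) ps)"

definition parts_le :: "nat \<Rightarrow> nat list \<Rightarrow> bool" where
  "parts_le n ps \<longleftrightarrow> strict_partition ps \<and> set ps \<subseteq> {..n}"

lemma parts_le_Cons: "parts_le n (p # ps) \<longleftrightarrow> 0 < p \<and> p \<le> n \<and> (\<forall>q\<in>set ps. q < p) \<and> parts_le n ps"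
  by (auto simp: parts_le_def strict_partition_def)

lemma parts_le_Nil [simp]: "parts_le n []"
  by (simp add: parts_le_def strict_partition_def)

lemma lower_Cons:
  "lower j (p # ps) = (if p = Suc j then (if j = 0 then lower j ps else j # lower j ps) else p # lower j ps)"
  by (auto simp: lower_def)

lemma lower_Nil [simp]: "lower j [] = []"
  by (simp add: lower_def)

lemma lower_unchanged: "Suc j \<notin> set ps \<Longrightarrow> lower j ps = ps"
  by (induction ps) (auto simp: lower_Cons)

lemma set_lower:
  "set (lower j ps) \<subseteq> insert j (set ps - {Suc j})" "0 < j \<Longrightarrow> Suc j \<in> set ps \<Longrightarrow> set (lower j ps) = insert j (set ps - {Suc j})"
  "set (lower 0 ps) = set ps - {1}"
  by (auto simp: lower_def)

lemma parts_le_lower: "parts_le n ps \<Longrightarrow> j \<notin> set ps \<Longrightarrow> parts_le n (lower j ps)"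
proof (induction ps)
  case (Cons p ps)
  have ih: "parts_le n (lower j ps)" using Cons by (auto simp: parts_le_Cons)
  have s: "set (lower j ps) \<subseteq> insert j (set ps - {Suc j})" by (rule set_lower)
  show ?case
  proof (cases "p = Suc j")
    case True
    then have "\<forall>q\<in>set ps. q < j" using Cons.prems by (auto simp: parts_le_Cons less_Suc_eq)
    moreover from this have "lower j ps = ps" by (intro lower_unchanged) auto
    ultimately show ?thesis using True Cons.prems by (auto simp: lower_Cons parts_le_Cons)
  next
    case False
    have "\<forall>q\<in>set (lower j ps). q < p"
    proof (cases "Suc j \<in> set ps")
      case True
      then show ?thesis using Cons.prems s by (fastforce simp: parts_le_Cons)
    next
      case False
      then show ?thesis using Cons.prems by (auto simp: parts_le_Cons lower_unchanged)
    qed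
    then show ?thesis using False ih Cons.prems by (auto simp: lower_Cons parts_le_Cons)
  qed
qed simp

section \<open>The operators of one variable and the group law\<close>

locale beta_real =
  fixes \<beta> :: real
  assumes beta_pos: "\<beta> > 0"
begin

text \<open>The addition for which \<open>1 + \<beta> x\<close> is multiplicative;
  \<open>ominus t\<close> is the inverse of \<open>t\<close> whenever \<open>1 + \<beta> t\<close>
  is nonzero.\<close>

definition oplus :: "real \<Rightarrow> real \<Rightarrow> real" (infixl "\<boxplus>" 65) where
  "x \<boxplus> y = x + y + \<beta> * x * y"

definition ominus :: "real \<Rightarrow> real" where
  "ominus t = - t / (1 + \<beta> * t)"

text \<open>This is \<open>(z \<boxplus> y) / (z \<boxplus> ominus y)\<close>, cleared of the inner
  denominator.\<close>

definition ratio :: "real \<Rightarrow> real \<Rightarrow> real" where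
  "ratio z y = (z \<boxplus> y) * (1 + \<beta> * y) / (z - y)"

definition opr :: "nat \<Rightarrow> (nat list \<Rightarrow> real) \<Rightarrow> nat list \<Rightarrow> real" where
  "opr j \<psi> ps = (if removable j ps then \<beta> * \<psi> ps + \<psi> (lower j ps) else 0)"

definition hop :: "real \<Rightarrow> nat \<Rightarrow> (nat list \<Rightarrow> real) \<Rightarrow> nat list \<Rightarrow> real" where
  "hop t j \<psi> ps = \<psi> ps + t * opr j \<psi> ps"

definition pos_alphabet :: "real set \<Rightarrow> bool" where
  "pos_alphabet X \<longleftrightarrow> finite X \<and> (\<forall>x\<in>X. x > 0)"

lemma one_plus_pos: "t > 0 \<Longrightarrow> 1 + \<beta> * t > 0"
  using beta_pos by (simp add: add_pos_pos)

lemma oplus_commute: "x \<boxplus> y = y \<boxplus> x"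
  by (simp add: oplus_def)

lemma oplus_pos: "x > 0 \<Longrightarrow> y > 0 \<Longrightarrow> x \<boxplus> y > 0"
  using beta_pos by (simp add: oplus_def add_pos_pos)

lemma oplus_zero [simp]: "x \<boxplus> 0 = x"
  by (simp add: oplus_def)

lemma oplus_ominus: "t > 0 \<Longrightarrow> z \<boxplus> ominus t = (z - t) / (1 + \<beta> * t)"
  using one_plus_pos[of t] by (simp add: oplus_def ominus_def divide_simps) (simp add: algebra_simps)

text \<open>Lagrange interpolation of the polynomial \<open>p\<close> of degree
  \<open>card X\<close> with values
  \<open>\<Prod>y\<in>X. (z \<boxplus> y) * (1 + \<beta> * y)\<close> at the nodes \<open>X\<close>
  and \<open>- 1 / \<beta>\<close>. The extra node satisfies
  \<open>(- 1 / \<beta>) \<boxplus> y = - 1 / \<beta>\<close>, and its term is the 1 on the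
  left.\<close>

lemma sum_oplus_self:
  assumes X: "pos_alphabet X"
  shows "1 + \<beta> * (\<Sum>z\<in>X. (z \<boxplus> z) * (\<Prod>y\<in>X - {z}. ratio z y)) = (\<Prod>y\<in>X. (1 + \<beta> * y)\<^sup>2)"
proof -
  have fin: "finite X" and pos: "\<And>x. x \<in> X \<Longrightarrow> x > 0" using X by (auto simp: pos_alphabet_def)
  let ?n = "- 1 / \<beta>"
  have nn: "?n < 0" using beta_pos by simp
  have nX: "?n \<notin> X" using pos nn by force
  define p where "p = (\<Prod>y\<in>X. [:y * (1 + \<beta> * y), (1 + \<beta> * y)\<^sup>2:])"
  have nz: "1 + \<beta> * y \<noteq> 0" if "y \<in> X" for y using one_plus_pos[OF pos[OF that]] by simp
  have "degree p = (\<Sum>y\<in>X. degree [:y * (1 + \<beta> * y), (1 + \<beta> * y)\<^sup>2:])"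
    unfolding p_def using nz by (intro degree_prod_eq_sum_degree) auto
  also have "\<dots> = card X" using nz by simp
  finally have dq: "degree p = card X" .
  have poly_p: "poly p z = (\<Prod>y\<in>X. (z \<boxplus> y) * (1 + \<beta> * y))" for z
    unfolding p_def poly_prod by (rule prod.cong) (auto simp: oplus_def algebra_simps power2_eq_square)
  have lc: "coeff p (card X) = (\<Prod>y\<in>X. (1 + \<beta> * y)\<^sup>2)"
  proof -
    have "coeff p (degree p) = (\<Prod>y\<in>X. lead_coeff [:y * (1 + \<beta> * y), (1 + \<beta> * y)\<^sup>2:])"
      unfolding p_def by (rule lead_coeff_prod)
    also have "\<dots> = (\<Prod>y\<in>X. (1 + \<beta> * y)\<^sup>2)"
      by (rule prod.cong) (use nz in auto)
    finally show ?thesis using dq by simp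
  qed
  have "poly p ?n / (\<Prod>b\<in>insert ?n X - {?n}. ?n - b)
      + (\<Sum>a\<in>X. poly p a / (\<Prod>b\<in>insert ?n X - {a}. a - b)) = (\<Prod>y\<in>X. (1 + \<beta> * y)\<^sup>2)"
    using lagrange_leading_coeff[of "insert ?n X" p] dq lc fin nX by simp
  moreover have "poly p ?n / (\<Prod>b\<in>insert ?n X - {?n}. ?n - b) = 1"
  proof -
    have "insert ?n X - {?n} = X" using nX by simp
    moreover have "poly p ?n = (\<Prod>b\<in>X. ?n - b)"
      unfolding poly_p by (rule prod.cong) (use beta_pos in \<open>auto simp: oplus_def field_simps\<close>)
    moreover have "(\<Prod>b\<in>X. ?n - b) \<noteq> 0" using fin nX by auto
    ultimately show ?thesis by simp
  qed
  moreover have "poly p z / (\<Prod>b\<in>insert ?n X - {z}. z - b) = \<beta> * ((z \<boxplus> z) * (\<Prod>y\<in>X - {z}. ratio z y))"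
    if z: "z \<in> X" for z
  proof -
    have "insert ?n X - {z} = insert ?n (X - {z})" using nX z by auto
    then have "(\<Prod>b\<in>insert ?n X - {z}. z - b) = (z - ?n) * (\<Prod>b\<in>X - {z}. z - b)"
      using fin nX by simp
    moreover have "poly p z = (z \<boxplus> z) * (1 + \<beta> * z) * (\<Prod>y\<in>X - {z}. (z \<boxplus> y) * (1 + \<beta> * y))"
      unfolding poly_p using fin z by (simp add: prod.remove)
    moreover have "(\<Prod>y\<in>X - {z}. ratio z y) = (\<Prod>y\<in>X - {z}. (z \<boxplus> y) * (1 + \<beta> * y)) / (\<Prod>b\<in>X - {z}. z - b)"
      by (simp add: ratio_def prod_dividef)
    moreover have "z - ?n = (1 + \<beta> * z) / \<beta>" using beta_pos by (simp add: field_simps)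
    moreover have "u * v * q / (v / \<beta> * d) = \<beta> * (u * (q / d))" if "v \<noteq> 0" for u v q d :: real
      using that beta_pos by (cases "d = 0") (auto simp: field_simps)
    ultimately show ?thesis using nz[OF z] by simp
  qed
  ultimately show ?thesis by (simp only: sum_distrib_left cong: sum.cong)
qed

section \<open>Sums over the alphabet with parameters at the sites\<close>

text \<open>A part \<open>p\<close> sees the parameters at the sites \<open>1, ..., p - 1\<close>
  only; a parameter at site \<open>n\<close> is therefore invisible to all parts up to
  \<open>n\<close>.\<close>

definition wave :: "(nat \<Rightarrow> real) \<Rightarrow> nat \<Rightarrow> real \<Rightarrow> real" where
  "wave b p z = (\<Prod>l\<in>{1..<p}. z \<boxplus> b l)"

text \<open>A multiparameter deformation of the symmetrisation formula for \<open>GQ\<close>, which is the case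
  \<open>b = 0\<close>; the parameters transport a new variable through the sites \<open>1, 2, \<dots>\<close> of the partition.\<close>

fun FC :: "(nat \<Rightarrow> real) \<Rightarrow> nat list \<Rightarrow> real set \<Rightarrow> real" where
  "FC b [] X = 1"
| "FC b (p # ps) X =
     (\<Sum>z\<in>X. (z \<boxplus> z) * wave b p z * (\<Prod>y\<in>X - {z}. ratio z y) * FC b ps (X - {z}))"

lemma wave_Suc: "0 < j \<Longrightarrow> wave b (Suc j) z = wave b j z * (z \<boxplus> b j)"
  by (simp add: wave_def atLeastLessThanSuc)

lemma wave_one [simp]: "wave b (Suc 0) z = 1"
  by (simp add: wave_def)

lemma wave_cong: "(\<And>l. 0 < l \<Longrightarrow> l < p \<Longrightarrow> b l = b' l) \<Longrightarrow> wave b p z = wave b' p z"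
  unfolding wave_def by (rule prod.cong) auto

lemma FC_cong: "(\<And>p z. p \<in> set ps \<Longrightarrow> wave b p z = wave b' p z) \<Longrightarrow> FC b ps X = FC b' ps X"
  by (induction ps arbitrary: X) auto

text \<open>The second clause says that \<open>b (Suc j)\<close> is \<open>b j \<boxplus> c\<close>:
  the exchanged parameters differ by \<open>c\<close> in the group law.\<close>

definition swapped :: "nat \<Rightarrow> real \<Rightarrow> (nat \<Rightarrow> real) \<Rightarrow> (nat \<Rightarrow> real) \<Rightarrow> bool" where
  "swapped j c b b' \<longleftrightarrow> b' = b(j := b (Suc j), Suc j := b j) \<and> b' j = b j * (1 + \<beta> * c) + c"

text \<open>Parts up to \<open>j\<close> see neither of the two parameters and parts above
  \<open>j + 1\<close> see both. Only \<open>j + 1\<close> sees exactly one of them, and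
  \<open>z \<boxplus> (b j \<boxplus> c)\<close> is affine in
  \<open>z \<boxplus> b j\<close>.\<close>

lemma wave_swapped:
  assumes "swapped j c b b'" "0 < j"
  shows "p \<noteq> Suc j \<Longrightarrow> wave b' p z = wave b p z"
    and "wave b' (Suc j) z = (1 + \<beta> * c) * wave b (Suc j) z + c * wave b j z"
proof -
  have low: "wave b' p z = wave b p z" if "p \<le> j" for p
    using assms that by (intro wave_cong) (auto simp: swapped_def)
  show "wave b' p z = wave b p z" if "p \<noteq> Suc j"
  proof (cases "p \<le> j")
    case False
    then have "p \<ge> Suc (Suc j)" using that by simp
    then show ?thesis
    proof (induction p rule: dec_induct)
      case base
      have "b' j = b (Suc j)" "b' (Suc j) = b j" using assms by (auto simp: swapped_def)
      then show ?case using assms(2) low[of j] by (simp add: wave_Suc)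
    next
      case (step q)
      then show ?case using assms by (simp add: wave_Suc swapped_def)
    qed
  qed (use low in simp)
  show "wave b' (Suc j) z = (1 + \<beta> * c) * wave b (Suc j) z + c * wave b j z"
  proof -
    have "z \<boxplus> b' j = (1 + \<beta> * c) * (z \<boxplus> b j) + c"
      using conjunct2[OF assms(1)[unfolded swapped_def]] by (simp add: oplus_def algebra_simps)
    then show ?thesis using assms(2) low[of j] by (simp add: wave_Suc algebra_simps)
  qed
qed

text \<open>For adjacent parts \<open>j + 1, j\<close> the double sum may be symmetrised in its two variables, and
  the symmetrised summand no longer involves \<open>b j\<close>.\<close>

lemma FC_swapped_adjacent:
  assumes X: "finite X" and sw: "swapped j c b b'" and j: "0 < j"
    and ps: "\<And>X. FC b' ps X = FC b ps X"
  shows "FC b' (Suc j # j # ps) X = FC b (Suc j # j # ps) X"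
proof -
  define P where "P = (SIGMA z:X. X - {z})"
  define G where "G z y = (z \<boxplus> z) * (y \<boxplus> y) * wave b j z * wave b j y * (z \<boxplus> y)
      * (\<Prod>u\<in>X - {z, y}. ratio z u * ratio y u) * FC b ps (X - {z, y})" for z y
  have G_sym: "G z y = G y z" for z y
    by (simp add: G_def oplus_commute[of z y] insert_commute mult.commute mult.left_commute)
  have expand: "FC d (Suc j # j # ps) X = (\<Sum>(z, y)\<in>P. (z \<boxplus> d j) * ((1 + \<beta> * y) / (z - y)) * G z y)"
    if d: "wave d (Suc j) = (\<lambda>z. wave b j z * (z \<boxplus> d j))" "wave d j = wave b j" "\<And>X. FC d ps X = FC b ps X" for d
  proof -
    have "FC d (Suc j # j # ps) X = (\<Sum>z\<in>X. \<Sum>y\<in>X - {z}. (z \<boxplus> d j) * ((1 + \<beta> * y) / (z - y)) * G z y)"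
    proof (simp add: sum_distrib_left, intro sum.cong refl)
      fix z y assume z: "z \<in> X" and y: "y \<in> X - {z}"
      have "(\<Prod>u\<in>X - {z}. ratio z u) = ratio z y * (\<Prod>u\<in>X - {z, y}. ratio z u)"
        using X y by (subst prod.remove[of _ y]) (auto simp: insert_Diff_if Diff_insert2[symmetric] insert_commute)
      moreover have "ratio z y = (z \<boxplus> y) * ((1 + \<beta> * y) / (z - y))" by (simp add: ratio_def)
      moreover have "X - {z} - {y} = X - {z, y}" by auto
      ultimately show "(z \<boxplus> z) * wave d (Suc j) z * prod (ratio z) (X - {z})
          * ((y \<boxplus> y) * wave d j y * prod (ratio y) (X - {z} - {y}) * FC d ps (X - {z} - {y}))
        = (z \<boxplus> d j) * (1 + \<beta> * y) * G z y / (z - y)"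
        by (simp add: d G_def prod.distrib)
    qed
    also have "\<dots> = (\<Sum>(z, y)\<in>P. (z \<boxplus> d j) * ((1 + \<beta> * y) / (z - y)) * G z y)"
      unfolding P_def by (subst sum.Sigma) (use X in auto)
    finally show ?thesis .
  qed
  \<comment> \<open>\<open>G\<close> is the part of the summand that is symmetric in
    \<open>z\<close> and \<open>y\<close>. The remaining kernel and its mirror image add up to 1,
    whatever the value of \<open>e\<close>.\<close>
  have sym: "2 * (\<Sum>(z, y)\<in>P. (z \<boxplus> e) * ((1 + \<beta> * y) / (z - y)) * G z y) = (\<Sum>(z, y)\<in>P. G z y)" for e
  proof -
    have "(\<Sum>(z, y)\<in>P. (z \<boxplus> e) * ((1 + \<beta> * y) / (z - y)) * G z y)
      = (\<Sum>(z, y)\<in>P. (y \<boxplus> e) * ((1 + \<beta> * z) / (y - z)) * G z y)"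
      by (rule sum.reindex_bij_witness[where i = "\<lambda>(z, y). (y, z)" and j = "\<lambda>(z, y). (y, z)"])
        (auto simp: P_def G_sym)
    then have "2 * (\<Sum>(z, y)\<in>P. (z \<boxplus> e) * ((1 + \<beta> * y) / (z - y)) * G z y)
      = (\<Sum>(z, y)\<in>P. (z \<boxplus> e) * ((1 + \<beta> * y) / (z - y)) * G z y + (y \<boxplus> e) * ((1 + \<beta> * z) / (y - z)) * G z y)"
      by (simp add: sum.distrib case_prod_unfold)
    also have "\<dots> = (\<Sum>(z, y)\<in>P. G z y)"
    proof (rule sum.cong[OF refl], clarify)
      fix z y assume "(z, y) \<in> P"
      then have "z \<noteq> y" by (auto simp: P_def)
      then have "(z \<boxplus> e) * ((1 + \<beta> * y) / (z - y)) + (y \<boxplus> e) * ((1 + \<beta> * z) / (y - z)) = 1"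
      proof -
        have "(1 + \<beta> * z) / (y - z) = - ((1 + \<beta> * z) / (z - y))"
          by (metis minus_diff_eq minus_divide_right)
        moreover have "(z \<boxplus> e) * (1 + \<beta> * y) - (y \<boxplus> e) * (1 + \<beta> * z) = z - y"
          by (simp add: oplus_def algebra_simps)
        ultimately show ?thesis
          using \<open>z \<noteq> y\<close> by (simp add: diff_divide_distrib[symmetric])
      qed
      then show "(z \<boxplus> e) * ((1 + \<beta> * y) / (z - y)) * G z y + (y \<boxplus> e) * ((1 + \<beta> * z) / (y - z)) * G z y = G z y"
        by (metis distrib_right mult_1)
    qed
    finally show ?thesis .
  qed
  have w: "wave b' j = wave b j" by (rule ext) (use wave_swapped(1)[OF sw j] in simp)
  have "FC b' (Suc j # j # ps) X = (\<Sum>(z, y)\<in>P. (z \<boxplus> b' j) * ((1 + \<beta> * y) / (z - y)) * G z y)"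
    by (rule expand) (auto simp: w wave_Suc[OF j] ps)
  moreover have "FC b (Suc j # j # ps) X = (\<Sum>(z, y)\<in>P. (z \<boxplus> b j) * ((1 + \<beta> * y) / (z - y)) * G z y)"
    by (rule expand) (auto simp: wave_Suc[OF j])
  ultimately show ?thesis using sym[of "b j"] sym[of "b' j"] by linarith
qed

text \<open>Induction along the list up to \<open>j + 1\<close>, the only part whose
  \<open>wave\<close> changes. If \<open>j\<close> is present it comes next; then the sum does not
  change, and neither does the hop, since \<open>j + 1\<close> cannot be lowered. Otherwise the
  affine change of \<open>wave\<close> is the hop itself.\<close>

lemma FC_swapped:
  assumes sw: "swapped j c b b'" and j: "0 < j"
  shows "finite X \<Longrightarrow> parts_le n ps \<Longrightarrow> FC b' ps X = hop c j (\<lambda>qs. FC b qs X) ps"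
proof (induction ps arbitrary: X)
  case Nil
  then show ?case by (simp add: hop_def opr_def removable_def)
next
  case (Cons p ps)
  have ps: "parts_le n ps" and lt: "\<And>q. q \<in> set ps \<Longrightarrow> q < p" using Cons.prems by (auto simp: parts_le_Cons)
  have IH: "FC b' ps (X - {z}) = hop c j (\<lambda>qs. FC b qs (X - {z})) ps" for z
    using Cons.IH[OF _ ps] Cons.prems(1) by simp
  show ?case
  proof (cases "p = Suc j")
    case True
    have same: "FC b' qs Y = FC b qs Y" if "Suc j \<notin> set qs" for qs Y
      using that by (intro FC_cong wave_swapped(1)[OF sw j]) auto
    have nj: "Suc j \<notin> set ps" using lt True by auto
    show ?thesis
    proof (cases "j \<in> set ps")
      case True
      then obtain qs where "ps = j # qs"
        using lt ps \<open>p = Suc j\<close>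
        by (cases ps) (fastforce simp: parts_le_Cons)+
      then show ?thesis
        using FC_swapped_adjacent[OF _ sw j, of X qs] same[of qs] nj Cons.prems(1) \<open>p = Suc j\<close>
        by (simp add: hop_def opr_def removable_def)
    next
      case False
      then have r: "removable j (p # ps)" "lower j (p # ps) = j # ps"
        using True nj j by (auto simp: removable_def lower_Cons lower_unchanged)
      show ?thesis
        using True j r by (simp add: hop_def opr_def same[OF nj] wave_swapped(2)[OF sw j]
          sum.distrib[symmetric] sum_distrib_left algebra_simps)
    qed
  next
    case False
    have r: "removable j (p # ps) \<longleftrightarrow> removable j ps \<and> p \<noteq> j" "lower j (p # ps) = p # lower j ps"
      using False by (auto simp: removable_def lower_Cons)
    have "p \<noteq> j" if "removable j ps" using that lt by (fastforce simp: removable_def)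
    then show ?thesis
      using r False by (auto simp: IH hop_def opr_def wave_swapped(1)[OF sw j]
          sum.distrib[symmetric] sum_distrib_left algebra_simps)
  qed
qed

text \<open>The variable \<open>t\<close> is a zero of \<open>z \<boxplus> ominus t\<close>, so only a part equal to \<open>1\<close> can select it.\<close>

lemma FC_reflect:
  assumes b: "b 1 = t" "b' = b(1 := ominus t)" and t: "t > 0"
  shows "pos_alphabet X \<Longrightarrow> t \<notin> X \<Longrightarrow> parts_le n ps \<Longrightarrow>
    FC b' ps (insert t X) = hop (t \<boxplus> t) 0 (\<lambda>qs. FC b qs X) ps"
proof (induction ps arbitrary: X)
  case Nil
  then show ?case by (simp add: hop_def opr_def removable_def)
next
  case (Cons p ps)
  have X: "pos_alphabet X" "finite X" "t \<notin> X" using Cons.prems by (auto simp: pos_alphabet_def)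
  have ps: "parts_le n ps" and lt: "\<And>q. q \<in> set ps \<Longrightarrow> q < p" and p: "0 < p"
    using Cons.prems by (auto simp: parts_le_Cons)
  have z_t: "(\<Prod>y\<in>insert t X - {z}. ratio z y) = ratio z t * (\<Prod>y\<in>X - {z}. ratio z y)" if "z \<in> X" for z
  proof -
    have "insert t X - {z} = insert t (X - {z})" using that X by auto
    then show ?thesis using X by simp
  qed
  show ?case
  proof (cases "p = 1")
    case True
    then have [simp]: "ps = []" using lt ps by (cases ps) (auto simp: parts_le_Cons)
    \<comment> \<open>For a single part 1 the quantity \<open>1 + \<beta> * S Y\<close> is
      multiplicative over the points of \<open>Y\<close>. A new point contributes
      \<open>(1 + \<beta> * t)^2 = 1 + \<beta> * (t \<boxplus> t)\<close>, which is the effect of a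
      hop by \<open>t \<boxplus> t\<close>.\<close>
    define S where "S Y = (\<Sum>z\<in>Y. (z \<boxplus> z) * (\<Prod>y\<in>Y - {z}. ratio z y))" for Y
    have "pos_alphabet (insert t X)" using X t by (auto simp: pos_alphabet_def)
    then have "1 + \<beta> * S (insert t X) = (1 + \<beta> * t)\<^sup>2 * (1 + \<beta> * S X)"
      using sum_oplus_self[of "insert t X"] sum_oplus_self[of X] X by (simp add: S_def)
    also have "\<dots> = 1 + \<beta> * (S X + (t \<boxplus> t) * (\<beta> * S X + 1))"
      by (simp add: oplus_def power2_eq_square algebra_simps)
    finally have "S (insert t X) = S X + (t \<boxplus> t) * (\<beta> * S X + 1)" using beta_pos by simp
    then show ?thesis
      using True by (simp add: hop_def opr_def removable_def lower_def S_def)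
  next
    case False
    then obtain m where m: "p = Suc (Suc m)" using p by (cases p; cases "p - 1") auto
    have w: "wave b' p z * (1 + \<beta> * t) = (if z = t then 0 else wave b p z * ((z - t) / (z \<boxplus> t)))"
      if "z > 0" for z
    proof -
      have "{1..<p} = insert 1 {2..<p}" using m by auto
      then have "wave b' p z = (z \<boxplus> ominus t) * (\<Prod>l\<in>{2..<p}. z \<boxplus> b l)"
        and "wave b p z = (z \<boxplus> t) * (\<Prod>l\<in>{2..<p}. z \<boxplus> b l)"
        using b by (auto simp: wave_def intro!: prod.cong)
      then show ?thesis
        using oplus_pos[OF that t] one_plus_pos[OF t] t by (auto simp: oplus_ominus)
    qed
    \<comment> \<open>The factor \<open>z \<boxplus> ominus t\<close> that replaces
      \<open>z \<boxplus> t\<close> cancels \<open>ratio z t\<close>, the one factor that the larger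
      alphabet adds.\<close>
    have wr: "wave b' p z * (\<Prod>y\<in>insert t X - {z}. ratio z y) = wave b p z * (\<Prod>y\<in>X - {z}. ratio z y)"
      if z: "z \<in> X" for z
    proof -
      have zpos: "z > 0" and zt: "z \<noteq> t" using z X by (auto simp: pos_alphabet_def)
      have "wave b' p z * ratio z t = wave b' p z * (1 + \<beta> * t) * ((z \<boxplus> t) / (z - t))"
        by (simp add: ratio_def)
      also have "\<dots> = wave b p z"
        using w[OF zpos] zt oplus_pos[OF zpos t] by simp
      finally show ?thesis by (simp add: z_t[OF z] mult.assoc[symmetric])
    qed
    have IH: "FC b' ps (insert t X - {z}) = hop (t \<boxplus> t) 0 (\<lambda>qs. FC b qs (X - {z})) ps" if "z \<in> X" for z
    proof -
      have "insert t X - {z} = insert t (X - {z})" using that X by auto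
      then show ?thesis using Cons.IH[of "X - {z}"] X ps by (simp add: pos_alphabet_def)
    qed
    have "wave b' p t = 0" using w[OF t] one_plus_pos[OF t] by simp
    then have "FC b' (p # ps) (insert t X)
      = (\<Sum>z\<in>X. (z \<boxplus> z) * (wave b' p z * (\<Prod>y\<in>insert t X - {z}. ratio z y)) * FC b' ps (insert t X - {z}))"
      using X by (simp add: mult.assoc)
    also have "\<dots> = (\<Sum>z\<in>X. (z \<boxplus> z) * (wave b p z * (\<Prod>y\<in>X - {z}. ratio z y))
        * hop (t \<boxplus> t) 0 (\<lambda>qs. FC b qs (X - {z})) ps)"
      by (rule sum.cong) (simp_all only: wr IH)
    also have "\<dots> = hop (t \<boxplus> t) 0 (\<lambda>qs. FC b qs X) (p # ps)"
    proof -
      have "removable 0 (p # ps) \<longleftrightarrow> removable 0 ps" "lower 0 (p # ps) = p # lower 0 ps"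
        using False p by (auto simp: removable_def lower_Cons)
      then show ?thesis
        by (auto simp: hop_def opr_def sum.distrib[symmetric] sum_distrib_left algebra_simps)
    qed
    finally show ?thesis .
  qed
qed

section \<open>Carrying a new variable through the sites\<close>

lemma hop_cong:
  assumes "\<And>qs. D qs \<Longrightarrow> \<psi> qs = \<phi> qs" "D ps" "j \<notin> set ps \<Longrightarrow> D (lower j ps)"
  shows "hop t j \<psi> ps = hop t j \<phi> ps"
  using assms by (auto simp: hop_def opr_def removable_def)

text \<open>A part that has just been lowered at site \<open>j\<close> cannot be lowered there
  again, so \<open>opr j\<close> squares to \<open>\<beta>\<close> times itself; operators
  \<open>1 + t * opr j\<close> then multiply by the group law.\<close>

lemma hop_hop_same: "hop s j (hop t j \<psi>) ps = hop (s \<boxplus> t) j \<psi> ps"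
proof -
  have "\<not> removable j (lower j ps)" if "removable j ps"
    using that set_lower(1)[of j ps] by (auto simp: removable_def)
  then show ?thesis by (auto simp: hop_def opr_def oplus_def algebra_simps)
qed

definition at_site :: "nat \<Rightarrow> real \<Rightarrow> nat \<Rightarrow> real" where
  "at_site j t = (\<lambda>l. if l = j then t else 0)"

text \<open>In both directions the exchanged parameters differ by \<open>t\<close>: going down,
  \<open>t\<close> passes a 0; going up, \<open>ominus t\<close> does.\<close>

lemma swapped_down: "swapped j t (at_site (Suc j) t) (at_site j t)"
  by (auto simp: swapped_def at_site_def)

lemma swapped_up: "t > 0 \<Longrightarrow> swapped j t (at_site j (ominus t)) (at_site (Suc j) (ominus t))"
  using one_plus_pos[of t] by (auto simp: swapped_def at_site_def ominus_def field_simps)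

text \<open>Stated for any family \<open>\<Phi>\<close> that obeys the exchange rule, because
  \<open>FC\<close> and \<open>EA\<close> are both transported in this way. As \<open>foldr\<close>
  applies the last site first, the parameter travels from site \<open>n\<close> down to site
  \<open>j\<close>.\<close>

lemma foldr_hop_descend:
  assumes ex: "\<And>j c b b' ps. swapped j c b b' \<Longrightarrow> 0 < j \<Longrightarrow> D ps \<Longrightarrow> \<Phi> b' ps = hop c j (\<Phi> b) ps"
    and cl: "\<And>j ps. D ps \<Longrightarrow> 0 < j \<Longrightarrow> j \<notin> set ps \<Longrightarrow> D (lower j ps)"
    and start: "\<And>ps. D ps \<Longrightarrow> \<psi> ps = \<Phi> (at_site n t) ps"
    and "D ps" "0 < j" "j \<le> n"
  shows "foldr (hop t) [j..<n] \<psi> ps = \<Phi> (at_site j t) ps"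
  using assms(6,4,5)
proof (induction j arbitrary: ps rule: inc_induct)
  case base
  then show ?case using start by simp
next
  case (step j)
  have "foldr (hop t) [j..<n] \<psi> ps = hop t j (foldr (hop t) [Suc j..<n] \<psi>) ps"
    using step.hyps by (simp add: upt_conv_Cons)
  also have "\<dots> = hop t j (\<Phi> (at_site (Suc j) t)) ps"
    by (rule hop_cong[of D]) (use step cl in auto)
  also have "\<dots> = \<Phi> (at_site j t) ps"
    using ex[OF swapped_down] step.prems by simp
  finally show ?case .
qed

lemma foldr_hop_ascend:
  assumes ex: "\<And>j c b b' ps. swapped j c b b' \<Longrightarrow> 0 < j \<Longrightarrow> D ps \<Longrightarrow> \<Phi> b' ps = hop c j (\<Phi> b) ps"
    and cl: "\<And>j ps. D ps \<Longrightarrow> 0 < j \<Longrightarrow> j \<notin> set ps \<Longrightarrow> D (lower j ps)"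
    and start: "\<And>ps. D ps \<Longrightarrow> \<psi> ps = \<Phi> (at_site 1 (ominus t)) ps"
    and t: "t > 0" and "D ps" "0 < j"
  shows "foldr (hop t) (rev [1..<j]) \<psi> ps = \<Phi> (at_site j (ominus t)) ps"
  using assms(5,6)
proof (induction j arbitrary: ps)
  case (Suc j)
  show ?case
  proof (cases "j = 0")
    case True
    then show ?thesis using Suc.prems start by simp
  next
    case False
    then have "foldr (hop t) (rev [1..<Suc j]) \<psi> ps = hop t j (foldr (hop t) (rev [1..<j]) \<psi>) ps"
      by simp
    also have "\<dots> = hop t j (\<Phi> (at_site j (ominus t))) ps"
      by (rule hop_cong[of D]) (use Suc False cl in auto)
    also have "\<dots> = \<Phi> (at_site (Suc j) (ominus t)) ps"
      using ex[OF swapped_up[OF t]] Suc.prems False by simp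
    finally show ?thesis .
  qed
qed simp

lemma FC_at_site_top: "parts_le n ps \<Longrightarrow> FC (at_site n s) ps X = FC (\<lambda>_. 0) ps X"
  by (intro FC_cong wave_cong) (auto simp: parts_le_def at_site_def)

text \<open>Read from the right, the word runs down to site 0 and back up. The parameter
  \<open>t\<close> starts at site \<open>n\<close>, unseen by all parts, and reaches site 1; the two
  hops at 0 reflect it to \<open>ominus t\<close> while \<open>t\<close> joins the alphabet; then it
  climbs to site \<open>n\<close> and is unseen again.\<close>

theorem FC_insert:
  assumes X: "pos_alphabet X" and t: "t > 0" "t \<notin> X" and n: "0 < n" and ps: "parts_le n ps"
  shows "FC (\<lambda>_. 0) ps (insert t X) = foldr (hop t) (rev [0..<n] @ [0..<n]) (\<lambda>qs. FC (\<lambda>_. 0) qs X) ps"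
proof -
  have fin: "finite X" using X by (simp add: pos_alphabet_def)
  let ?\<psi> = "\<lambda>qs. FC (\<lambda>_. 0) qs X"
  have mid: "hop t 0 (hop t 0 (foldr (hop t) [1..<n] ?\<psi>)) qs = FC (at_site 1 (ominus t)) qs (insert t X)"
    if qs: "parts_le n qs" for qs
  proof -
    have "hop t 0 (hop t 0 (foldr (hop t) [1..<n] ?\<psi>)) qs = hop (t \<boxplus> t) 0 (\<lambda>qs. FC (at_site 1 t) qs X) qs"
      unfolding hop_hop_same
      by (rule hop_cong[of "parts_le n", OF _ qs parts_le_lower[OF qs]],
          rule foldr_hop_descend[where D = "parts_le n" and \<Phi> = "\<lambda>b qs. FC b qs X"])
        (use FC_swapped fin parts_le_lower n in \<open>auto simp: FC_at_site_top\<close>)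
    also have "\<dots> = FC (at_site 1 (ominus t)) qs (insert t X)"
      by (rule FC_reflect[OF _ _ t(1) X t(2) qs, symmetric]) (auto simp: at_site_def)
    finally show ?thesis .
  qed
  have "rev [0..<n] @ [0..<n] = rev [1..<n] @ 0 # 0 # [1..<n]"
    using n by (simp add: upt_conv_Cons)
  then have "foldr (hop t) (rev [0..<n] @ [0..<n]) ?\<psi> ps
    = foldr (hop t) (rev [1..<n]) (hop t 0 (hop t 0 (foldr (hop t) [1..<n] ?\<psi>))) ps"
    by simp
  also have "\<dots> = FC (at_site n (ominus t)) ps (insert t X)"
    by (rule foldr_hop_ascend[where D = "parts_le n" and \<Phi> = "\<lambda>b qs. FC b qs (insert t X)"])
      (use FC_swapped fin parts_le_lower n ps t mid in auto)
  also have "\<dots> = FC (\<lambda>_. 0) ps (insert t X)"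
    by (rule FC_at_site_top[OF ps])
  finally show ?thesis by simp
qed

section \<open>Expansion over subsets and the trapezoid\<close>

text \<open>The choices in the nested sum are grouped by the set \<open>I\<close> of selected
  points. A point outside \<open>I\<close> stays in the alphabet to the end and contributes
  \<open>ratio i j\<close> for every selected \<open>i\<close>; the other factors form the sum over
  \<open>I\<close> alone.\<close>

lemma FC_subsets:
  assumes "finite X"
  shows "FC b ps X = (\<Sum>I | I \<subseteq> X \<and> card I = length ps. FC b ps I * (\<Prod>i\<in>I. \<Prod>j\<in>X - I. ratio i j))"
  using assms
proof (induction ps arbitrary: X)
  case Nil
  have "{I. I \<subseteq> X \<and> card I = 0} = {{}}"
    using Nil finite_subset by (auto simp: card_eq_0_iff)
  then show ?case by simp
next
  case (Cons p ps)
  define g where "g z I = (z \<boxplus> z) * wave b p z * (\<Prod>y\<in>I - {z}. ratio z y) * FC b ps (I - {z})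
    * (\<Prod>i\<in>I. \<Prod>j\<in>X - I. ratio i j)" for z I
  let ?S = "\<lambda>Y m. {I. I \<subseteq> Y \<and> card I = m}"
  have fS: "finite (?S Y m)" if "finite Y" for Y :: "real set" and m
    using that by (auto intro: finite_subset[of _ "Pow Y"])
  have "FC b (p # ps) X = (\<Sum>z\<in>X. \<Sum>J\<in>?S (X - {z}) (length ps). g z (insert z J))"
  proof (simp only: FC.simps, rule sum.cong[OF refl])
    fix z assume z: "z \<in> X"
    have "(z \<boxplus> z) * wave b p z * (\<Prod>y\<in>X - {z}. ratio z y) * (FC b ps J * (\<Prod>i\<in>J. \<Prod>j\<in>X - {z} - J. ratio i j))
        = g z (insert z J)" if J: "J \<subseteq> X - {z}" for J
    proof -
      have fJ: "finite J" "z \<notin> J" using J finite_subset[of J "X - {z}"] Cons.prems by auto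
      have "X - {z} = J \<union> (X - insert z J)" "J \<inter> (X - insert z J) = {}" using J z by auto
      then have "(\<Prod>y\<in>X - {z}. ratio z y) = (\<Prod>y\<in>J. ratio z y) * (\<Prod>y\<in>X - insert z J. ratio z y)"
        using fJ Cons.prems prod.union_disjoint[of J "X - insert z J" "ratio z"] by simp
      moreover have "X - {z} - J = X - insert z J" "insert z J - {z} = J" using fJ by auto
      ultimately show ?thesis using fJ by (simp add: g_def)
    qed
    then show "(z \<boxplus> z) * wave b p z * (\<Prod>y\<in>X - {z}. ratio z y) * FC b ps (X - {z})
        = (\<Sum>J\<in>?S (X - {z}) (length ps). g z (insert z J))"
      using Cons.IH[of "X - {z}"] Cons.prems by (simp add: sum_distrib_left)
  qed
  also have "\<dots> = (\<Sum>(z, J)\<in>(SIGMA z:X. ?S (X - {z}) (length ps)). g z (insert z J))"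
    by (rule sum.Sigma) (use Cons.prems fS in auto)
  also have "\<dots> = (\<Sum>(I, z)\<in>(SIGMA I:?S X (length (p # ps)). I). g z I)"
  proof (rule sum.reindex_bij_witness[where i = "\<lambda>(I, z). (z, I - {z})" and j = "\<lambda>(z, J). (insert z J, z)"], goal_cases)
    case (2 x)
    then obtain z J where x: "x = (z, J)" "z \<in> X" "J \<subseteq> X - {z}" "card J = length ps" by auto
    moreover have "finite J" using x(3) Cons.prems by (auto intro: finite_subset[of J "X - {z}"])
    moreover have "z \<notin> J" using x(3) by auto
    ultimately show ?case by auto
  qed (use Cons.prems in auto)
  also have "\<dots> = (\<Sum>I\<in>?S X (length (p # ps)). \<Sum>z\<in>I. g z I)"
    by (rule sum.Sigma[symmetric]) (use Cons.prems fS in \<open>auto intro: finite_subset[of _ X]\<close>)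
  also have "\<dots> = (\<Sum>I\<in>?S X (length (p # ps)). FC b (p # ps) I * (\<Prod>i\<in>I. \<Prod>j\<in>X - I. ratio i j))"
    by (simp add: g_def sum_distrib_right)
  finally show ?case .
qed

lemma trapezoid_Suc: "trapezoid (Suc a) (Suc b) = (a + b + 1) # trapezoid a b"
  unfolding trapezoid_def map_upt_Suc by simp

lemma prod_prod_oplus_remove:
  assumes "finite I" "z \<in> I"
  shows "(\<Prod>i\<in>I. \<Prod>j\<in>I. i \<boxplus> j)
    = (z \<boxplus> z) * (\<Prod>y\<in>I - {z}. (z \<boxplus> y)\<^sup>2) * (\<Prod>i\<in>I - {z}. \<Prod>j\<in>I - {z}. i \<boxplus> j)"
proof -
  have "(\<Prod>i\<in>I. \<Prod>j\<in>I. i \<boxplus> j) = (\<Prod>j\<in>I. z \<boxplus> j) * (\<Prod>i\<in>I - {z}. (i \<boxplus> z) * (\<Prod>j\<in>I - {z}. i \<boxplus> j))"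
    by (simp add: prod.remove[OF assms])
  moreover have "(\<Prod>i\<in>I - {z}. i \<boxplus> z) = (\<Prod>i\<in>I - {z}. z \<boxplus> i)"
    by (intro prod.cong refl oplus_commute)
  ultimately show ?thesis
    by (simp add: prod.remove[OF assms] prod.distrib power2_eq_square)
qed

text \<open>After division by the right-hand side this is the Lagrange identity for the nodes
  \<open>z\<^sup>2 / (1 + \<beta> z)\<close>.\<close>

lemma FC_trapezoid_top:
  assumes "pos_alphabet I" "card I = a" "a \<le> b"
  shows "FC (\<lambda>_. 0) (trapezoid a b) I = (\<Prod>i\<in>I. i ^ (b - a)) * (\<Prod>i\<in>I. \<Prod>j\<in>I. i \<boxplus> j)"
  using assms
proof (induction a arbitrary: b I)
  case 0
  then have "I = {}" by (simp add: pos_alphabet_def)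
  then show ?case by (simp add: trapezoid_def)
next
  case (Suc a)
  then obtain b' where b: "b = Suc b'" "a \<le> b'" by (cases b) auto
  have fin: "finite I" and pos: "\<And>x. x \<in> I \<Longrightarrow> x > 0" and ne: "I \<noteq> {}"
    using Suc.prems by (auto simp: pos_alphabet_def)
  define v where "v z = z\<^sup>2 / (1 + \<beta> * z)" for z
  define T where "T = (\<Prod>i\<in>I. i ^ (b' - a)) * (\<Prod>i\<in>I. \<Prod>j\<in>I. i \<boxplus> j)"
  have vd: "v z - v y = (z - y) * (z \<boxplus> y) / ((1 + \<beta> * z) * (1 + \<beta> * y))" if "z \<in> I" "y \<in> I" for z y
    using one_plus_pos[OF pos[OF that(1)]] one_plus_pos[OF pos[OF that(2)]]
    by (simp add: v_def oplus_def divide_simps) (simp add: algebra_simps power2_eq_square)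
  have "inj_on v I"
  proof (rule inj_onI)
    fix z y assume zy: "z \<in> I" "y \<in> I" and "v z = v y"
    then have "(z - y) * (z \<boxplus> y) / ((1 + \<beta> * z) * (1 + \<beta> * y)) = 0"
      unfolding vd[OF zy, symmetric] by simp
    then show "z = y"
      using oplus_pos[OF pos pos, OF zy] one_plus_pos[OF pos[OF zy(1)]] one_plus_pos[OF pos[OF zy(2)]] by auto
  qed
  then have one: "(\<Sum>z\<in>I. \<Prod>y\<in>I - {z}. v z / (v z - v y)) = 1"
    using lagrange_sum_one fin ne by blast
  have "FC (\<lambda>_. 0) (trapezoid (Suc a) b) I
    = (\<Sum>z\<in>I. (z \<boxplus> z) * z ^ (a + b') * (\<Prod>y\<in>I - {z}. ratio z y) * FC (\<lambda>_. 0) (trapezoid a b') (I - {z}))"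
    by (simp add: b trapezoid_Suc wave_def)
  also have "\<dots> = (\<Sum>z\<in>I. T * (\<Prod>y\<in>I - {z}. v z / (v z - v y)))"
  proof (rule sum.cong[OF refl])
    fix z assume z: "z \<in> I"
    have cz: "card (I - {z}) = a" using Suc.prems fin z by simp
    have IH: "FC (\<lambda>_. 0) (trapezoid a b') (I - {z})
      = (\<Prod>i\<in>I - {z}. i ^ (b' - a)) * (\<Prod>i\<in>I - {z}. \<Prod>j\<in>I - {z}. i \<boxplus> j)"
      by (rule Suc.IH) (use Suc.prems cz b in \<open>auto simp: pos_alphabet_def\<close>)
    \<comment> \<open>There is one square of \<open>z\<close> for each of the \<open>a\<close> other
      points, and it turns \<open>ratio z y\<close> into \<open>(z \<boxplus> y)^2\<close> times a
      Lagrange factor in the nodes \<open>v\<close>.\<close>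
    have "z ^ (a + b') = z ^ (b' - a) * (z\<^sup>2) ^ a"
      using b by (simp add: power_mult[symmetric] power_add[symmetric])
    moreover have "(z\<^sup>2) ^ a = (\<Prod>y\<in>I - {z}. z\<^sup>2)" using cz by simp
    moreover have "(\<Prod>y\<in>I - {z}. z\<^sup>2) * (\<Prod>y\<in>I - {z}. ratio z y)
        = (\<Prod>y\<in>I - {z}. (z \<boxplus> y)\<^sup>2) * (\<Prod>y\<in>I - {z}. v z / (v z - v y))"
      unfolding prod.distrib[symmetric]
    proof (rule prod.cong[OF refl])
      fix y assume y: "y \<in> I - {z}"
      have nz: "z \<boxplus> y > 0" "1 + \<beta> * z > 0" "1 + \<beta> * y > 0" "z - y \<noteq> 0"
        using oplus_pos[OF pos pos, of z y] one_plus_pos pos y z by auto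
      have gen: "s * (u * q / d) = u\<^sup>2 * (s / p / (d * u / (p * q)))"
        if "u \<noteq> 0" "p \<noteq> 0" "q \<noteq> 0" "d \<noteq> 0" for s u p q d :: real
        using that by (simp add: field_simps power2_eq_square)
      show "z\<^sup>2 * ratio z y = (z \<boxplus> y)\<^sup>2 * (v z / (v z - v y))"
        unfolding vd[OF z, of y, OF DiffD1[OF y]] unfolding v_def ratio_def
        by (rule gen) (use nz in auto)
    qed
    ultimately have "(z \<boxplus> z) * z ^ (a + b') * (\<Prod>y\<in>I - {z}. ratio z y)
      = (z \<boxplus> z) * z ^ (b' - a) * ((\<Prod>y\<in>I - {z}. (z \<boxplus> y)\<^sup>2) * (\<Prod>y\<in>I - {z}. v z / (v z - v y)))"
      by (simp add: mult.assoc)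
    then show "(z \<boxplus> z) * z ^ (a + b') * (\<Prod>y\<in>I - {z}. ratio z y) * FC (\<lambda>_. 0) (trapezoid a b') (I - {z})
      = T * (\<Prod>y\<in>I - {z}. v z / (v z - v y))"
      unfolding T_def IH prod_prod_oplus_remove[OF fin z] prod.remove[OF fin z, of "\<lambda>i. i ^ (b' - a)"]
      by (simp only: mult_ac)
  qed
  also have "\<dots> = T" using one by (simp add: sum_distrib_left[symmetric])
  finally show ?case by (simp add: T_def b)
qed

definition rect_sum :: "nat \<Rightarrow> nat \<Rightarrow> real set \<Rightarrow> real" where
  "rect_sum a b X = (\<Sum>I | I \<subseteq> X \<and> card I = a.
     (\<Prod>i\<in>I. i ^ (b - a)) * (\<Prod>i\<in>I. \<Prod>j\<in>I. i \<boxplus> j) * (\<Prod>i\<in>I. \<Prod>j\<in>X - I. ratio i j))"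

lemma FC_trapezoid:
  assumes "pos_alphabet X" "a \<le> b"
  shows "FC (\<lambda>_. 0) (trapezoid a b) X = rect_sum a b X"
proof -
  have "length (trapezoid a b) = a" by (simp add: trapezoid_def)
  moreover have "pos_alphabet I" if "I \<subseteq> X" for I
    using that assms(1) finite_subset by (auto simp: pos_alphabet_def)
  ultimately show ?thesis
    using assms FC_subsets[of X "\<lambda>_. 0" "trapezoid a b"] FC_trapezoid_top[of _ a b]
    unfolding rect_sum_def pos_alphabet_def
    by (auto intro!: sum.cong)
qed

end

section \<open>The type A factor\<close>

lemma strict_dec_distinct: "sorted_wrt (>) ps \<Longrightarrow> distinct ps"
  for ps :: "'a :: linorder list"
  using strict_sorted_iff[of "rev ps"] by (simp add: sorted_wrt_rev)

lemma strict_dec_eqI: "sorted_wrt (>) ps \<Longrightarrow> sorted_wrt (>) qs \<Longrightarrow> set ps = set qs \<Longrightarrow> ps = qs"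
  for ps qs :: "'a :: linorder list"
  using strict_sorted_equal[of "rev ps" "rev qs"] by (simp add: sorted_wrt_rev)

section \<open>Determinants of Vandermonde and Cauchy-Binet type\<close>

definition dt :: "nat \<Rightarrow> (nat \<Rightarrow> nat \<Rightarrow> real) \<Rightarrow> real" where
  "dt a g = det (mat a a (\<lambda>(i, j). g i j))"

lemma dt_leibniz: "dt a g = (\<Sum>p | p permutes {0..<a}. signof p * (\<Prod>i = 0..<a. g i (p i)))"
  unfolding dt_def
  by (subst det_def'[of _ a]) (auto intro!: sum.cong prod.cong simp: permutes_in_image)

lemma dt_cong: "(\<And>i j. i < a \<Longrightarrow> j < a \<Longrightarrow> g i j = h i j) \<Longrightarrow> dt a g = dt a h"
  unfolding dt_def by (intro arg_cong[of _ _ det] eq_matI) auto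

lemma dt_row_linear:
  assumes r: "r < a" and row: "\<And>j. j < a \<Longrightarrow> f r j = c * g r j + d * h r j"
    and oth: "\<And>i j. i < a \<Longrightarrow> j < a \<Longrightarrow> i \<noteq> r \<Longrightarrow> g i j = f i j \<and> h i j = f i j"
  shows "dt a f = c * dt a g + d * dt a h"
proof -
  have split: "(\<Prod>i = 0..<a. u i) = u r * (\<Prod>i\<in>{0..<a} - {r}. u i)" for u :: "nat \<Rightarrow> real"
    using r by (intro prod.remove) auto
  have "signof p * (\<Prod>i = 0..<a. f i (p i))
      = c * (signof p * (\<Prod>i = 0..<a. g i (p i))) + d * (signof p * (\<Prod>i = 0..<a. h i (p i)))"
    if p: "p permutes {0..<a}" for p
  proof -
    have pl: "p i < a" if "i < a" for i using permutes_in_image[OF p, of i] that by auto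
    have "(\<Prod>i\<in>{0..<a} - {r}. g i (p i)) = (\<Prod>i\<in>{0..<a} - {r}. f i (p i))"
      "(\<Prod>i\<in>{0..<a} - {r}. h i (p i)) = (\<Prod>i\<in>{0..<a} - {r}. f i (p i))"
      using oth pl by (auto intro!: prod.cong)
    then show ?thesis using row[OF pl[OF r]] by (simp add: split algebra_simps)
  qed
  then show ?thesis
    unfolding dt_leibniz by (simp add: sum_distrib_left sum.distrib[symmetric])
qed

lemma dt_row_scale: "dt a (\<lambda>i j. c i * g i j) = (\<Prod>i = 0..<a. c i) * dt a g"
  unfolding dt_leibniz by (simp add: prod.distrib sum_distrib_left mult_ac)

lemma dt_equal_rows:
  assumes "r < a" "s < a" "r \<noteq> s" "\<And>j. j < a \<Longrightarrow> g r j = g s j"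
  shows "dt a g = 0"
  unfolding dt_def
  by (rule det_identical_rows[of _ a r s]) (use assms in \<open>auto simp: row_def\<close>)

lemma dt_zero_row: "r < a \<Longrightarrow> (\<And>j. j < a \<Longrightarrow> g r j = 0) \<Longrightarrow> dt a g = 0"
  using dt_row_linear[of r a g 0 g 0 g] by simp

lemma prod_list_map_upt: "prod_list (map f [0..<n]) = (\<Prod>i = 0..<n. f i)"
  for f :: "nat \<Rightarrow> 'a :: comm_monoid_mult"
  by (induction n) (auto simp: atLeast0_lessThan_Suc mult.commute)

lemma dt_triangular:
  assumes "(\<forall>i j. i < j \<longrightarrow> j < a \<longrightarrow> g i j = 0) \<or> (\<forall>i j. j < i \<longrightarrow> i < a \<longrightarrow> g i j = 0)"
  shows "dt a g = (\<Prod>i = 0..<a. g i i)"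
proof -
  have d: "prod_list (diag_mat (mat a a (\<lambda>(i, j). g i j))) = (\<Prod>i = 0..<a. g i i)"
    by (simp add: diag_mat_def prod_list_map_upt cong: map_cong)
  show ?thesis
    using assms
  proof
    assume "\<forall>i j. i < j \<longrightarrow> j < a \<longrightarrow> g i j = 0"
    then show ?thesis unfolding dt_def d[symmetric] by (intro det_lower_triangular[of a]) auto
  next
    assume "\<forall>i j. j < i \<longrightarrow> i < a \<longrightarrow> g i j = 0"
    then show ?thesis unfolding dt_def d[symmetric]
      by (intro det_upper_triangular[of _ a]) (auto simp: upper_triangular_def)
  qed
qed

lemma dt_mult: "dt a (\<lambda>i j. \<Sum>k = 0..<a. g i k * h k j) = dt a g * dt a h"
proof -
  have "mat a a (\<lambda>(i, j). \<Sum>k = 0..<a. g i k * h k j) = mat a a (\<lambda>(i, j). g i j) * mat a a (\<lambda>(i, j). h i j)"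
    by (rule eq_matI) (auto simp: scalar_prod_def)
  then show ?thesis unfolding dt_def by (simp add: det_mult[of _ a])
qed

text \<open>The Newton basis is unitriangular over the monomials and turns the matrix triangular.\<close>

lemma dt_vandermonde: "dt a (\<lambda>k j. v k ^ j) = (\<Prod>k = 0..<a. \<Prod>l = 0..<k. v k - v l)"
proof -
  define P where "P j = (\<Prod>l = 0..<j. [:- v l, 1:])" for j
  have dP: "degree (P j) = j" for j
    unfolding P_def by (subst degree_prod_eq_sum_degree) auto
  have lP: "coeff (P j) j = 1" for j
    using lead_coeff_prod[of "\<lambda>l. [:- v l, 1:]" "{0..<j}"] dP[of j] unfolding P_def by simp
  have pP: "poly (P j) z = (\<Prod>l = 0..<j. z - v l)" for j z
    by (simp add: P_def poly_prod)
  have "dt a (\<lambda>k j. \<Sum>i = 0..<a. v k ^ i * coeff (P j) i) = dt a (\<lambda>k j. v k ^ j) * dt a (\<lambda>i j. coeff (P j) i)"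
    by (rule dt_mult)
  moreover have "dt a (\<lambda>i j. coeff (P j) i) = 1"
    by (subst dt_triangular) (auto simp: lP coeff_eq_0 dP)
  moreover have "dt a (\<lambda>k j. \<Sum>i = 0..<a. v k ^ i * coeff (P j) i) = dt a (\<lambda>k j. poly (P j) (v k))"
  proof (rule dt_cong)
    fix k j assume "k < a" "j < a"
    then have "poly (P j) (v k) = (\<Sum>i<a. coeff (P j) i * v k ^ i)"
      unfolding poly_altdef by (intro sum.mono_neutral_left) (auto simp: dP coeff_eq_0)
    then show "(\<Sum>i = 0..<a. v k ^ i * coeff (P j) i) = poly (P j) (v k)"
      by (simp add: mult.commute lessThan_atLeast0)
  qed
  moreover have "dt a (\<lambda>k j. poly (P j) (v k)) = (\<Prod>k = 0..<a. poly (P k) (v k))"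
    by (rule dt_triangular) (auto simp: pP)
  ultimately show ?thesis by (simp add: pP)
qed

text \<open>Each row is expanded over its own choice of a node. What remains is a Vandermonde
  determinant in the chosen nodes, which vanishes if a node is chosen twice.\<close>

lemma dt_sum_nodes:
  assumes X: "finite X"
  shows "dt a (\<lambda>i j. \<Sum>z\<in>X. g i z * z ^ j)
    = (\<Sum>f | f \<in> {0..<a} \<rightarrow>\<^sub>E X \<and> inj_on f {0..<a}. (\<Prod>i = 0..<a. g i (f i)) * dt a (\<lambda>i j. f i ^ j))"
proof -
  have "dt a (\<lambda>i j. \<Sum>z\<in>X. g i z * z ^ j)
      = (\<Sum>p | p permutes {0..<a}. \<Sum>f\<in>{0..<a} \<rightarrow>\<^sub>E X. signof p * (\<Prod>i = 0..<a. g i (f i) * f i ^ p i))"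
    unfolding dt_leibniz using X by (simp add: prod_sum_PiE sum_distrib_left)
  also have "\<dots> = (\<Sum>f\<in>{0..<a} \<rightarrow>\<^sub>E X. \<Sum>p | p permutes {0..<a}. signof p * (\<Prod>i = 0..<a. g i (f i) * f i ^ p i))"
    by (rule sum.swap)
  also have "\<dots> = (\<Sum>f\<in>{0..<a} \<rightarrow>\<^sub>E X. (\<Prod>i = 0..<a. g i (f i)) * dt a (\<lambda>i j. f i ^ j))"
    by (simp add: dt_row_scale[symmetric]) (simp add: dt_leibniz)
  also have "\<dots> = (\<Sum>f | f \<in> {0..<a} \<rightarrow>\<^sub>E X \<and> inj_on f {0..<a}. (\<Prod>i = 0..<a. g i (f i)) * dt a (\<lambda>i j. f i ^ j))"
  proof (rule sum.mono_neutral_right)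
    show "finite ({0..<a} \<rightarrow>\<^sub>E X)" using X by (simp add: finite_PiE)
    show "\<forall>f\<in>({0..<a} \<rightarrow>\<^sub>E X) - {f \<in> {0..<a} \<rightarrow>\<^sub>E X. inj_on f {0..<a}}.
        (\<Prod>i = 0..<a. g i (f i)) * dt a (\<lambda>i j. f i ^ j) = 0"
    proof
      fix f assume "f \<in> ({0..<a} \<rightarrow>\<^sub>E X) - {f \<in> {0..<a} \<rightarrow>\<^sub>E X. inj_on f {0..<a}}"
      then obtain r s where "r < a" "s < a" "r \<noteq> s" "f r = f s" by (auto simp: inj_on_def)
      then show "(\<Prod>i = 0..<a. g i (f i)) * dt a (\<lambda>i j. f i ^ j) = 0"
        using dt_equal_rows[of r a s] by simp
    qed
  qed auto
  finally show ?thesis .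
qed

text \<open>Cauchy-Binet: injective choices of nodes are grouped by their image, and
  \<open>dt_sum_nodes\<close> over that image reassembles the determinant.\<close>

lemma dt_sum_subsets:
  assumes X: "finite X"
  shows "dt a (\<lambda>i j. \<Sum>z\<in>X. g i z * z ^ j)
    = (\<Sum>I | I \<subseteq> X \<and> card I = a. dt a (\<lambda>i j. \<Sum>z\<in>I. g i z * z ^ j))"
proof -
  let ?G = "\<lambda>f. (\<Prod>i = 0..<a. g i (f i)) * dt a (\<lambda>i j. f i ^ j)"
  let ?F = "\<lambda>Y. {f. f \<in> {0..<a} \<rightarrow>\<^sub>E Y \<and> inj_on f {0..<a}}"
  let ?S = "{I. I \<subseteq> X \<and> card I = a}"
  have fin: "finite (?F X)" by (rule finite_subset[of _ "{0..<a} \<rightarrow>\<^sub>E X"]) (use X in \<open>auto simp: finite_PiE\<close>)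
  have "(\<Sum>f\<in>?F X. ?G f) = (\<Sum>I\<in>?S. \<Sum>f | f \<in> ?F X \<and> f ` {0..<a} = I. ?G f)"
    by (rule sum.group[symmetric, OF fin])
      (use X in \<open>auto simp: card_image intro: finite_subset[of _ "Pow X"]\<close>)
  also have "\<dots> = (\<Sum>I\<in>?S. \<Sum>f\<in>?F I. ?G f)"
  proof (intro sum.cong refl)
    fix I assume I: "I \<in> ?S"
    have "finite I" using I X finite_subset by blast
    then have "f ` {0..<a} = I" if "f \<in> ?F I" for f
      using that I by (intro card_subset_eq) (auto simp: card_image)
    then show "{f. f \<in> ?F X \<and> f ` {0..<a} = I} = ?F I"
      using I by (auto simp: PiE_iff)
  qed
  also have "\<dots> = (\<Sum>I\<in>?S. dt a (\<lambda>i j. \<Sum>z\<in>I. g i z * z ^ j))"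
    using X finite_subset by (intro sum.cong refl dt_sum_nodes[symmetric]) auto
  finally show ?thesis using dt_sum_nodes[OF X] by simp
qed

lemma prod_ordered_pairs:
  fixes g :: "nat \<Rightarrow> nat \<Rightarrow> real"
  shows "(\<Prod>k = 0..<a. \<Prod>l = 0..<k. g k l * g l k) = (\<Prod>k = 0..<a. \<Prod>l\<in>{0..<a} - {k}. g k l)"
proof (induction a)
  case (Suc a)
  have "(\<Prod>k = 0..<a. \<Prod>l\<in>{0..<Suc a} - {k}. g k l) = (\<Prod>k = 0..<a. g k a * (\<Prod>l\<in>{0..<a} - {k}. g k l))"
  proof (intro prod.cong refl)
    fix k assume "k \<in> {0..<a}"
    then have "{0..<Suc a} - {k} = insert a ({0..<a} - {k})" by auto
    then show "(\<Prod>l\<in>{0..<Suc a} - {k}. g k l) = g k a * (\<Prod>l\<in>{0..<a} - {k}. g k l)" by simp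
  qed
  moreover have "{0..<Suc a} - {a} = {0..<a}" by auto
  ultimately show ?case using Suc by (simp add: prod.distrib mult_ac)
qed simp

lemma dt_transpose: "dt a (\<lambda>i j. g j i) = dt a g"
proof -
  have "mat a a (\<lambda>(i, j). g j i) = transpose_mat (mat a a (\<lambda>(i, j). g i j))" by auto
  then show ?thesis unfolding dt_def by (simp add: det_transpose[of _ a])
qed

text \<open>The matrix is a product of Vandermonde matrices in the nodes
  \<open>1 / z + \<beta>\<close> and \<open>z\<close>, up to row factors. By
  \<open>(1/x - 1/y) (x - y) = ((x - y)/x) ((y - x)/y)\<close> each unordered pair yields one factor
  for each of its two orders.\<close>

lemma dt_square_nodes:
  assumes I: "finite I" "card I = a" and pos: "\<And>z. z \<in> I \<Longrightarrow> z > 0"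
  shows "dt a (\<lambda>i j. \<Sum>z\<in>I. d z * (1 / z + \<beta>) ^ i * z ^ j)
    = (\<Prod>z\<in>I. d z * (\<Prod>y\<in>I - {z}. (z - y) / z))"
proof -
  obtain e where e: "bij_betw e {0..<a} I" using ex_bij_betw_nat_finite[OF I(1)] I(2) by blast
  have epos: "e k > 0" if "k < a" for k using e that pos by (auto simp: bij_betw_def)
  have "dt a (\<lambda>i j. \<Sum>z\<in>I. d z * (1 / z + \<beta>) ^ i * z ^ j)
      = dt a (\<lambda>i j. \<Sum>k = 0..<a. (d (e k) * (1 / e k + \<beta>) ^ i) * e k ^ j)"
    by (rule dt_cong) (rule sum.reindex_bij_betw[OF e, symmetric])
  also have "\<dots> = dt a (\<lambda>k i. d (e k) * (1 / e k + \<beta>) ^ i) * dt a (\<lambda>k j. e k ^ j)"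
    unfolding dt_mult by (simp add: dt_transpose[of a "\<lambda>k i. d (e k) * (1 / e k + \<beta>) ^ i"])
  also have "\<dots> = (\<Prod>k = 0..<a. d (e k))
      * (\<Prod>k = 0..<a. \<Prod>l = 0..<k. ((1 / e k + \<beta>) - (1 / e l + \<beta>)) * (e k - e l))"
    by (simp add: dt_row_scale dt_vandermonde prod.distrib)
  also have "(\<Prod>k = 0..<a. \<Prod>l = 0..<k. ((1 / e k + \<beta>) - (1 / e l + \<beta>)) * (e k - e l))
      = (\<Prod>k = 0..<a. \<Prod>l = 0..<k. ((e k - e l) / e k) * ((e l - e k) / e l))"
  proof (intro prod.cong refl)
    fix k l assume "k \<in> {0..<a}" "l \<in> {0..<k}"
    then have "e k > 0" "e l > 0" using epos by auto
    then show "((1 / e k + \<beta>) - (1 / e l + \<beta>)) * (e k - e l) = ((e k - e l) / e k) * ((e l - e k) / e l)"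
      by (simp add: field_simps)
  qed
  also have "\<dots> = (\<Prod>k = 0..<a. \<Prod>l\<in>{0..<a} - {k}. (e k - e l) / e k)"
    by (rule prod_ordered_pairs)
  also have "(\<Prod>k = 0..<a. d (e k)) * \<dots> = (\<Prod>k = 0..<a. d (e k) * (\<Prod>y\<in>I - {e k}. (e k - y) / e k))"
  proof -
    have "(\<Prod>l\<in>{0..<a} - {k}. (e k - e l) / e k) = (\<Prod>y\<in>I - {e k}. (e k - y) / e k)" if "k < a" for k
    proof -
      have "bij_betw e ({0..<a} - {k}) (I - {e k})" using e that by (auto simp: bij_betw_def inj_on_def)
      then show ?thesis by (rule prod.reindex_bij_betw)
    qed
    then show ?thesis by (simp add: prod.distrib)
  qed
  also have "\<dots> = (\<Prod>z\<in>I. d z * (\<Prod>y\<in>I - {z}. (z - y) / z))"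
    by (rule prod.reindex_bij_betw[OF e])
  finally show ?thesis .
qed

section \<open>Residue sums\<close>

context beta_real
begin

text \<open>The sum of the residues of \<open>h(z) / (z\<^sup>m (1 + \<beta> z)\<^sup>c \<Prod>\<^sub>y (z - y))\<close>, \<open>y \<in> Z\<close>, at \<open>0\<close> and at the
  points of \<open>Z\<close>.\<close>

definition res_sum :: "nat \<Rightarrow> nat \<Rightarrow> real poly \<Rightarrow> real set \<Rightarrow> real" where
  "res_sum m c h Z =
     (if m = 0 then 0 else (fps_of_poly h * inverse (fps_of_poly [:1, \<beta>:]) ^ c
        * (\<Prod>y\<in>Z. inverse (fps_of_poly [:- y, 1:]))) $ (m - 1))
     + (\<Sum>z\<in>Z. poly h z / (z ^ m * (1 + \<beta> * z) ^ c * (\<Prod>y\<in>Z - {z}. z - y)))"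

lemma fps_cancel: "u * v = 1 \<Longrightarrow> (u * f) * (v * g) = f * g" for u v f g :: "real fps"
proof -
  assume "u * v = 1"
  moreover have "(u * f) * (v * g) = (u * v) * (f * g)" by (simp only: mult_ac)
  ultimately show ?thesis by simp
qed

lemma res_sum_add: "res_sum m c (g + h) Z = res_sum m c g Z + res_sum m c h Z"
  by (simp add: res_sum_def fps_of_poly_add algebra_simps add_divide_distrib sum.distrib)

lemma res_sum_smult: "res_sum m c (Polynomial.smult s h) Z = s * res_sum m c h Z"
  by (simp add: res_sum_def fps_of_poly_smult algebra_simps sum_distrib_left)

lemma res_sum_cancel_var:
  assumes "pos_alphabet Z"
  shows "res_sum (Suc m) c ([:0, 1:] * h) Z = res_sum m c h Z"
proof -
  have "(\<Sum>z\<in>Z. poly ([:0, 1:] * h) z / (z ^ Suc m * (1 + \<beta> * z) ^ c * (\<Prod>y\<in>Z - {z}. z - y)))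
      = (\<Sum>z\<in>Z. poly h z / (z ^ m * (1 + \<beta> * z) ^ c * (\<Prod>y\<in>Z - {z}. z - y)))"
    using assms by (intro sum.cong refl) (auto simp: pos_alphabet_def)
  moreover have "fps_of_poly ([:0, 1:] * h) = fps_X * fps_of_poly h"
    by (simp only: fps_of_poly_mult fps_of_poly_fps_X)
  moreover have "(fps_of_poly ([:0, 1:] * h) * u * v) $ m = (if m = 0 then 0 else (fps_of_poly h * u * v) $ (m - 1))"
    for u v unfolding calculation(2) mult.assoc by simp
  ultimately show ?thesis unfolding res_sum_def by (simp only: if_False nat.distinct diff_Suc_1)
qed

lemma res_sum_cancel_beta:
  assumes "pos_alphabet Z"
  shows "res_sum m (Suc c) ([:1, \<beta>:] * h) Z = res_sum m c h Z"
proof -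
  have "(\<Sum>z\<in>Z. poly ([:1, \<beta>:] * h) z / (z ^ m * (1 + \<beta> * z) ^ Suc c * (\<Prod>y\<in>Z - {z}. z - y)))
      = (\<Sum>z\<in>Z. poly h z / (z ^ m * (1 + \<beta> * z) ^ c * (\<Prod>y\<in>Z - {z}. z - y)))"
  proof (intro sum.cong refl)
    fix z assume "z \<in> Z"
    then have "1 + \<beta> * z \<noteq> 0" using assms one_plus_pos[of z] by (auto simp: pos_alphabet_def)
    then show "poly ([:1, \<beta>:] * h) z / (z ^ m * (1 + \<beta> * z) ^ Suc c * (\<Prod>y\<in>Z - {z}. z - y))
        = poly h z / (z ^ m * (1 + \<beta> * z) ^ c * (\<Prod>y\<in>Z - {z}. z - y))"
    proof -
      have "poly ([:1, \<beta>:] * h) z = (1 + \<beta> * z) * poly h z" by (simp add: algebra_simps)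
      moreover have "u * p / (w * (u * v) * d) = p / (w * v * d)" if "u \<noteq> 0" for u p w v d :: real
        using that by (simp add: mult.assoc mult.left_commute[of w u])
      ultimately show ?thesis
        using \<open>1 + \<beta> * z \<noteq> 0\<close> by (simp only: power_Suc)
    qed
  qed
  moreover have "fps_of_poly ([:1, \<beta>:] * h) * inverse (fps_of_poly [:1, \<beta>:]) ^ Suc c
      = fps_of_poly h * inverse (fps_of_poly [:1, \<beta>:]) ^ c"
  proof -
    have "fps_of_poly [:1, \<beta>:] * inverse (fps_of_poly [:1, \<beta>:]) = 1" by (rule inverse_mult_eq_1') simp
    then show ?thesis
      unfolding fps_of_poly_mult power_Suc by (rule fps_cancel)
  qed
  ultimately show ?thesis by (simp only: res_sum_def)
qed

text \<open>The zero of the numerator at \<open>t\<close> removes the residue there and cancels the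
  factor \<open>z - t\<close> at 0 and at the other points.\<close>

lemma res_sum_insert:
  assumes Z: "pos_alphabet Z" and t: "t > 0" "t \<notin> Z"
  shows "res_sum m c ([:- t, 1:] * h) (insert t Z) = res_sum m c h Z"
proof -
  have fin: "finite Z" using Z by (simp add: pos_alphabet_def)
  have A: "(\<Sum>z\<in>Z. poly ([:- t, 1:] * h) z / (z ^ m * (1 + \<beta> * z) ^ c * (\<Prod>y\<in>insert t Z - {z}. z - y)))
      = (\<Sum>z\<in>Z. poly h z / (z ^ m * (1 + \<beta> * z) ^ c * (\<Prod>y\<in>Z - {z}. z - y)))"
  proof (intro sum.cong refl)
    fix z assume z: "z \<in> Z"
    have "insert t Z - {z} = insert t (Z - {z})" using z t by auto
    then have "(\<Prod>y\<in>insert t Z - {z}. z - y) = (z - t) * (\<Prod>y\<in>Z - {z}. z - y)"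
      using fin t by simp
    moreover have "z - t \<noteq> 0" using z t by auto
    moreover have "poly ([:- t, 1:] * h) z = (z - t) * poly h z" by (simp add: algebra_simps)
    ultimately show "poly ([:- t, 1:] * h) z / (z ^ m * (1 + \<beta> * z) ^ c * (\<Prod>y\<in>insert t Z - {z}. z - y))
        = poly h z / (z ^ m * (1 + \<beta> * z) ^ c * (\<Prod>y\<in>Z - {z}. z - y))"
      by (simp add: mult.left_commute[of _ "z - t"])
  qed
  have B: "fps_of_poly ([:- t, 1:] * h) * s * (\<Prod>y\<in>insert t Z. inverse (fps_of_poly [:- y, 1:]))
      = fps_of_poly h * s * (\<Prod>y\<in>Z. inverse (fps_of_poly [:- y, 1:]))" for s
  proof -
    have "fps_of_poly [:- t, 1:] * inverse (fps_of_poly [:- t, 1:]) = 1"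
      by (rule inverse_mult_eq_1') (use t in simp)
    from fps_cancel[OF this, of "fps_of_poly h * s"] show ?thesis
      unfolding fps_of_poly_mult prod.insert[OF fin t(2)] by (simp only: mult.assoc)
  qed
  have "poly ([:- t, 1:] * h) t = 0" by simp
  then show ?thesis unfolding res_sum_def sum.insert[OF fin t(2)] A B by (simp only: div_0 add_0)
qed

lemma inverse_fps_linear_nth: "inverse (fps_of_poly [:1, \<beta>:]) $ m = (- \<beta>) ^ m"
proof -
  have "fps_of_poly [:1, \<beta>:] * Abs_fps (\<lambda>m. (- \<beta>) ^ m) = 1"
  proof (rule fps_ext)
    fix m
    show "(fps_of_poly [:1, \<beta>:] * Abs_fps (\<lambda>m. (- \<beta>) ^ m)) $ m = 1 $ m"
      unfolding fps_of_poly_linear' by (cases m) (auto simp: distrib_right mult.assoc)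
  qed
  then have "inverse (fps_of_poly [:1, \<beta>:]) = Abs_fps (\<lambda>m. (- \<beta>) ^ m)" by (rule fps_inverse_unique)
  then show ?thesis by simp
qed

text \<open>The residue theorem: the remaining pole is at \<open>- 1 / \<beta>\<close>, and the degree bound excludes a
  residue at infinity.\<close>

lemma res_sum_one:
  assumes Z: "pos_alphabet Z" and h: "h = 0 \<or> degree h < card Z + m"
  shows "res_sum m 1 h Z = - poly h (- 1 / \<beta>) / (\<beta> * (- 1 / \<beta>) ^ m * (\<Prod>y\<in>Z. - 1 / \<beta> - y))"
  using h
proof (induction m arbitrary: h)
  case 0
  have fin: "finite Z" and pos: "\<And>x. x \<in> Z \<Longrightarrow> x > 0" using Z by (auto simp: pos_alphabet_def)
  let ?n = "- 1 / \<beta>"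
  have "?n < 0" using beta_pos by simp
  then have nZ: "?n \<notin> Z" using pos by force
  \<comment> \<open>With \<open>- 1 / \<beta>\<close> as an additional node, the degree bound makes
    the coefficient read off by interpolation zero: all residues together cancel.\<close>
  have "degree h < card (insert ?n Z)" "coeff h (card Z) = 0"
    using 0 fin nZ by (auto simp: coeff_eq_0)
  then have "(\<Sum>a\<in>insert ?n Z. poly h a / (\<Prod>b\<in>insert ?n Z - {a}. a - b)) = 0"
    using lagrange_leading_coeff[of "insert ?n Z" h] fin nZ by simp
  then have "poly h ?n / (\<Prod>y\<in>Z. ?n - y) + (\<Sum>z\<in>Z. poly h z / (\<Prod>b\<in>insert ?n Z - {z}. z - b)) = 0"
    using fin nZ by simp
  moreover have "(\<Sum>z\<in>Z. poly h z / (\<Prod>b\<in>insert ?n Z - {z}. z - b))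
      = (\<Sum>z\<in>Z. \<beta> * (poly h z / ((1 + \<beta> * z) * (\<Prod>y\<in>Z - {z}. z - y))))"
  proof (intro sum.cong refl)
    fix z assume z: "z \<in> Z"
    have "insert ?n Z - {z} = insert ?n (Z - {z})" using nZ z by auto
    then have "(\<Prod>b\<in>insert ?n Z - {z}. z - b) = (z - ?n) * (\<Prod>b\<in>Z - {z}. z - b)"
      using fin nZ by simp
    also have "z - ?n = (1 + \<beta> * z) / \<beta>" using beta_pos by (simp add: field_simps)
    finally show "poly h z / (\<Prod>b\<in>insert ?n Z - {z}. z - b) = \<beta> * (poly h z / ((1 + \<beta> * z) * (\<Prod>y\<in>Z - {z}. z - y)))"
      by simp
  qed
  ultimately have "poly h ?n / (\<Prod>y\<in>Z. ?n - y) + \<beta> * res_sum 0 1 h Z = 0"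
    by (simp add: res_sum_def sum_distrib_left)
  then have "\<beta> * res_sum 0 1 h Z = - (poly h ?n / (\<Prod>y\<in>Z. ?n - y))" by linarith
  then have "res_sum 0 1 h Z = - (poly h ?n / (\<Prod>y\<in>Z. ?n - y)) / \<beta>"
    using beta_pos by (metis less_irrefl nonzero_mult_div_cancel_left)
  then show ?case by (simp add: mult.commute)
next
  case (Suc m)
  have fin: "finite Z" and pos: "\<And>x. x \<in> Z \<Longrightarrow> x > 0" using Z by (auto simp: pos_alphabet_def)
  let ?n = "- 1 / \<beta>"
  have n: "?n < 0" using beta_pos by simp
  define q where "q = (\<Prod>y\<in>Z. [:- y, 1:])"
  have q0: "poly q 0 \<noteq> 0" using fin pos by (force simp: q_def poly_prod)
  have dq: "degree q = card Z" unfolding q_def by (subst degree_prod_eq_sum_degree) auto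
  \<comment> \<open>A multiple of \<open>q\<close> is subtracted so that the rest vanishes at 0 and
    loses one order of its pole there. The part \<open>q\<close> itself has no residues on
    \<open>Z\<close>, since it cancels all factors \<open>z - y\<close>.\<close>
  define s where "s = poly h 0 / poly q 0"
  have "poly (h - Polynomial.smult s q) 0 = 0" using q0 by (simp add: s_def)
  then obtain g where g: "h - Polynomial.smult s q = [:0, 1:] * g"
    unfolding poly_eq_0_iff_dvd by (auto elim: dvdE)
  then have h: "h = Polynomial.smult s q + [:0, 1:] * g" by (simp add: algebra_simps)
  have "g = 0 \<or> degree g < card Z + m"
  proof (cases "g = 0")
    case False
    have "degree (h - Polynomial.smult s q) \<le> card Z + m"
      using Suc.prems dq by (intro degree_diff_le) (auto intro: order.trans[OF degree_smult_le])
    moreover have "degree ([:0, 1:] * g) = Suc (degree g)" using False by (simp add: degree_mult_eq)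
    ultimately show ?thesis using g by simp
  qed simp
  note IH = Suc.IH[OF this]
  have qn: "poly q ?n = (\<Prod>y\<in>Z. ?n - y)" unfolding q_def poly_prod by (rule prod.cong) auto
  have nz: "(\<Prod>y\<in>Z. ?n - y) \<noteq> 0" using fin n pos by force
  have "res_sum (Suc m) 1 q Z = (- \<beta>) ^ m"
  proof -
    have "poly q z = 0" if "z \<in> Z" for z using that fin by (force simp: q_def poly_prod)
    moreover have "fps_of_poly q * (\<Prod>y\<in>Z. inverse (fps_of_poly [:- y, 1:])) = 1"
      unfolding q_def fps_of_poly_prod prod.distrib[symmetric]
      by (intro prod.neutral ballI inverse_mult_eq_1') (use pos in force)
    from fps_cancel[OF this, of _ 1]
    have "(fps_of_poly q * u * (\<Prod>y\<in>Z. inverse (fps_of_poly [:- y, 1:]))) $ m = u $ m" for u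
      by (simp only: mult_1_right)
    ultimately show ?thesis
      unfolding res_sum_def power_one_right by (simp add: inverse_fps_linear_nth)
  qed
  also have "\<dots> = - 1 / (\<beta> * ?n ^ Suc m)"
  proof -
    have "?n ^ Suc m = inverse ((- \<beta>) ^ Suc m)"
      by (simp only: power_inverse[symmetric]) (simp add: inverse_eq_divide)
    then show ?thesis using beta_pos by (simp only: power_Suc) (simp add: field_simps)
  qed
  finally have rq: "res_sum (Suc m) 1 q Z = - 1 / (\<beta> * ?n ^ Suc m)" .
  have "res_sum (Suc m) 1 h Z = s * (- 1 / (\<beta> * ?n ^ Suc m)) - poly g ?n / (\<beta> * ?n ^ m * (\<Prod>y\<in>Z. ?n - y))"
    unfolding h res_sum_add res_sum_smult res_sum_cancel_var[OF Z] rq IH by simp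
  also have "\<dots> = - (s * (\<Prod>y\<in>Z. ?n - y) + ?n * poly g ?n) / (\<beta> * ?n ^ Suc m * (\<Prod>y\<in>Z. ?n - y))"
  proof -
    have "s * (- 1 / (\<beta> * (u * v))) - p / (\<beta> * v * d) = - (s * d + u * p) / (\<beta> * (u * v) * d)"
      if "u \<noteq> 0" "v \<noteq> 0" "d \<noteq> 0" for u v d p
      using that beta_pos by (simp add: field_simps)
    from this[of ?n "?n ^ m"] show ?thesis using n nz by simp
  qed
  also have "s * (\<Prod>y\<in>Z. ?n - y) + ?n * poly g ?n = poly h ?n"
    by (simp only: h qn poly_add poly_smult poly_mult) simp
  finally show ?case .
qed

section \<open>Determinants of residue sums\<close>

definition wave_poly :: "(nat \<Rightarrow> real) \<Rightarrow> nat \<Rightarrow> real poly" where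
  "wave_poly b p = (\<Prod>l\<in>{1..<p}. [:b l, 1 + \<beta> * b l:])"

lemma poly_wave_poly: "poly (wave_poly b p) z = wave b p z"
  unfolding wave_poly_def wave_def poly_prod by (rule prod.cong) (auto simp: oplus_def algebra_simps)

lemma wave_poly_eqI:
  assumes "\<And>z. wave b' p z = poly g z"
  shows "wave_poly b' p = g"
proof -
  have "poly (wave_poly b' p) = poly g" using assms poly_wave_poly by auto
  then show ?thesis by (simp only: poly_eq_poly_eq_iff)
qed

text \<open>A determinant of Jacobi-Trudi type. The row fixes the part and the exponent of
  \<open>1 + \<beta> z\<close>, the column fixes the order of the pole at 0. The exponent drops by
  one from each row to the next, which lets the rows of adjacent parts \<open>j + 1, j\<close> be
  compared.\<close>

definition EA :: "real poly \<Rightarrow> real set \<Rightarrow> (nat \<Rightarrow> real) \<Rightarrow> nat list \<Rightarrow> real" where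
  "EA N Z b ps = dt (length ps)
     (\<lambda>i j. res_sum (length ps - j) (length ps - i) (wave_poly b (ps ! i) * N) Z)"

lemma EA_cong:
  "(\<And>p. p \<in> set ps \<Longrightarrow> wave_poly b p = wave_poly b' p) \<Longrightarrow> EA N Z b ps = EA N Z b' ps"
  unfolding EA_def by (rule dt_cong) auto

text \<open>Only the row of the part \<open>j + 1\<close> changes. If \<open>j\<close> is absent,
  linearity in this row gives the hop. If \<open>j\<close> is present, it owns the next row, and
  \<open>d + (1 + \<beta> d) z = z + d (1 + \<beta> z)\<close> shows that the parameter
  \<open>d\<close> only adds a multiple of that row, because \<open>1 + \<beta> z\<close> lowers the
  exponent by one.\<close>

lemma EA_swapped:
  assumes Z: "pos_alphabet Z" and sw: "swapped j c b b'" and j: "0 < j" and ps: "parts_le n ps"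
  shows "EA N Z b' ps = hop c j (EA N Z b) ps"
proof (cases "Suc j \<in> set ps")
  case False
  have "EA N Z b' ps = EA N Z b ps"
    by (rule EA_cong, rule wave_poly_eqI, unfold poly_wave_poly, rule wave_swapped(1)[OF sw j]) (use False in auto)
  then show ?thesis using False by (simp add: hop_def opr_def removable_def)
next
  case True
  let ?a = "length ps"
  obtain i where i: "i < ?a" "ps ! i = Suc j" using True by (auto simp: in_set_conv_nth)
  have srt: "sorted_wrt (>) ps" using ps by (simp add: parts_le_def strict_partition_def)
  have mono: "ps ! k > ps ! l" if "k < l" "l < ?a" for k l using srt that sorted_wrt_nth_less by blast
  have other: "ps ! k \<noteq> Suc j" if "k < ?a" "k \<noteq> i" for k
    using mono[of k i] mono[of i k] i that by (metis less_irrefl linorder_neqE_nat)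
  have same: "wave_poly b' (ps ! k) = wave_poly b (ps ! k)" if "k < ?a" "k \<noteq> i" for k
    by (rule wave_poly_eqI) (use wave_swapped(1)[OF sw j other[OF that]] in \<open>simp add: poly_wave_poly\<close>)
  have w': "wave_poly b' (Suc j) = Polynomial.smult (1 + \<beta> * c) (wave_poly b (Suc j)) + Polynomial.smult c (wave_poly b j)"
    by (rule wave_poly_eqI) (use wave_swapped(2)[OF sw j] in \<open>simp add: poly_wave_poly\<close>)
  show ?thesis
  proof (cases "j \<in> set ps")
    case False
    have nth: "lower j ps ! k = (if k = i then j else ps ! k)" if "k < ?a" for k
      using that j other i by (auto simp: lower_def)
    have len: "length (lower j ps) = ?a" using j by (simp add: lower_def)
    have "EA N Z b' ps = (1 + \<beta> * c) * EA N Z b ps + c * EA N Z b (lower j ps)"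
      unfolding EA_def len
      by (rule dt_row_linear[OF i(1)])
        (use i same nth in \<open>auto simp: w' distrib_right res_sum_add res_sum_smult\<close>)
    then show ?thesis using True False by (simp add: hop_def opr_def removable_def algebra_simps)
  next
    case jin: True
    then obtain k where k: "k < ?a" "ps ! k = j" by (auto simp: in_set_conv_nth)
    have "k = Suc i"
    proof -
      have "i < k" using mono[of k i] i k by (metis lessI less_asym linorder_neqE_nat n_not_Suc_n)
      moreover have "\<not> Suc i < k" using mono[of i "Suc i"] mono[of "Suc i" k] i k by fastforce
      ultimately show ?thesis by simp
    qed
    define K where "K = dt ?a (\<lambda>r s. if r = i then res_sum (?a - s) (?a - i) ([:0, 1:] * wave_poly b j * N) Z
        else res_sum (?a - s) (?a - r) (wave_poly b (ps ! r) * N) Z)"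
    have red: "EA N Z d ps = K" if d: "\<And>k. k < ?a \<Longrightarrow> k \<noteq> i \<Longrightarrow> wave_poly d (ps ! k) = wave_poly b (ps ! k)"
      and dj: "wave_poly d (Suc j) = [:d j, 1 + \<beta> * d j:] * wave_poly b j" for d
    proof -
      define h where "h r s = (if r = i then res_sum (?a - s) (?a - Suc i) (wave_poly b j * N) Z
        else res_sum (?a - s) (?a - r) (wave_poly b (ps ! r) * N) Z)" for r s
      have "dt ?a h = 0"
        by (rule dt_equal_rows[of i _ "Suc i"]) (use i k \<open>k = Suc i\<close> in \<open>auto simp: h_def\<close>)
      moreover have "EA N Z d ps = 1 * K + d j * dt ?a h"
        unfolding EA_def K_def
      proof (rule dt_row_linear[OF i(1)])
        fix s assume "s < ?a"
        have "?a - i = Suc (?a - Suc i)" using i by simp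
        then have "res_sum (?a - s) (?a - Suc i) (wave_poly b j * N) Z
          = res_sum (?a - s) (?a - i) ([:1, \<beta>:] * (wave_poly b j * N)) Z"
          using res_sum_cancel_beta[OF Z] by metis
        moreover have "wave_poly d (Suc j) * N
            = [:0, 1:] * wave_poly b j * N + Polynomial.smult (d j) ([:1, \<beta>:] * (wave_poly b j * N))"
        proof -
          have "[:d j, 1 + \<beta> * d j:] = [:0, 1:] + Polynomial.smult (d j) [:1, \<beta>:]" by simp
          then show ?thesis unfolding dj by (simp only: distrib_right mult_smult_left mult.assoc)
        qed
        ultimately show "res_sum (?a - s) (?a - i) (wave_poly d (ps ! i) * N) Z
          = 1 * (if i = i then res_sum (?a - s) (?a - i) ([:0, 1:] * wave_poly b j * N) Z
              else res_sum (?a - s) (?a - i) (wave_poly b (ps ! i) * N) Z) + d j * h i s"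
          unfolding i(2) h_def by (simp only: res_sum_add res_sum_smult if_True mult_1 simp_thms)
      qed (use d in \<open>auto simp: h_def\<close>)
      ultimately show ?thesis by simp
    qed
    have "wave_poly d (Suc j) = [:d j, 1 + \<beta> * d j:] * wave_poly d j" for d
      using j unfolding wave_poly_def by (simp add: atLeastLessThanSuc mult.commute)
    moreover have "wave_poly b' j = wave_poly b j"
      by (rule wave_poly_eqI) (use wave_swapped(1)[OF sw j, of j] in \<open>simp add: poly_wave_poly\<close>)
    ultimately have "EA N Z b' ps = K" "EA N Z b ps = K" using red same by metis+
    then show ?thesis using jin by (simp add: hop_def opr_def removable_def)
  qed
qed

text \<open>The two conditions fix the residue sums with \<open>c = 1\<close>: the degree excludes a
  residue at infinity, and the value at \<open>- 1 / \<beta>\<close> normalises the residue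
  there.\<close>

definition admissible :: "real poly \<Rightarrow> real set \<Rightarrow> bool" where
  "admissible N Z \<longleftrightarrow> degree N \<le> card Z \<and> poly N (- 1 / \<beta>) = (\<Prod>y\<in>Z. - 1 / \<beta> - y)"

lemma res_sum_admissible:
  assumes Z: "pos_alphabet Z" and N: "admissible N Z" and m: "m > 0"
  shows "res_sum m 1 N Z = - 1 / (\<beta> * (- 1 / \<beta>) ^ m)"
proof -
  let ?n = "- 1 / \<beta>"
  have "?n < 0" using beta_pos by simp
  then have "(\<Prod>y\<in>Z. ?n - y) \<noteq> 0" using Z by (force simp: pos_alphabet_def)
  then show ?thesis
    using res_sum_one[OF Z, of N m] N m by (simp add: admissible_def)
qed

lemma admissible_mult:
  assumes N: "admissible N Z" and fin: "finite Z" and t: "t \<notin> Z"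
    and g: "degree g \<le> 1" "poly g (- 1 / \<beta>) = - 1 / \<beta> - t"
  shows "admissible (N * g) (insert t Z)"
proof -
  have "degree (N * g) \<le> degree N + degree g" by (rule degree_mult_le)
  then show ?thesis using assms by (auto simp: admissible_def)
qed

text \<open>Only the last part can be \<open>1\<close>, and its row consists of residue sums at exponent \<open>c = 1\<close>,
  which do not depend on the alphabet.\<close>

lemma EA_change:
  assumes Z: "pos_alphabet Z" "admissible N Z" and Z': "pos_alphabet Z'" "admissible N' Z'"
    and ps: "parts_le n ps"
    and eq: "\<And>p m c. p \<ge> 2 \<Longrightarrow> res_sum m c (wave_poly b p * N) Z = res_sum m c (wave_poly b' p * N') Z'"
  shows "EA N Z b ps = EA N' Z' b' ps"
  unfolding EA_def
proof (rule dt_cong)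
  fix i j assume i: "i < length ps" and j: "j < length ps"
  show "res_sum (length ps - j) (length ps - i) (wave_poly b (ps ! i) * N) Z
      = res_sum (length ps - j) (length ps - i) (wave_poly b' (ps ! i) * N') Z'"
  proof (cases "ps ! i \<ge> 2")
    case False
    have srt: "sorted_wrt (>) ps" and nz: "0 \<notin> set ps" using ps by (auto simp: parts_le_def strict_partition_def)
    have one: "ps ! i = Suc 0" using False nz i nth_mem[OF i] by (cases "ps ! i") auto
    have "Suc i = length ps"
    proof (rule ccontr)
      assume "Suc i \<noteq> length ps"
      then have "Suc i < length ps" using i by simp
      then have "ps ! Suc i < 1" "ps ! Suc i \<in> set ps"
        using sorted_wrt_nth_less[OF srt, of i "Suc i"] one nth_mem[of "Suc i" ps] by auto
      then show False using nz by auto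
    qed
    then have "length ps - i = 1" by simp
    then show ?thesis
      using res_sum_admissible[OF Z] res_sum_admissible[OF Z'] one j by (simp add: wave_poly_def)
  qed (use eq in simp)
qed

lemma wave_poly_zero: "wave_poly (\<lambda>_. 0) p = [:0, 1:] ^ (p - 1)"
  by (simp add: wave_poly_def)

lemma wave_poly_at_site_1:
  assumes "p \<ge> 2"
  shows "wave_poly (at_site 1 s) p = [:s, 1 + \<beta> * s:] * [:0, 1:] ^ (p - 2)"
proof -
  have "{1..<p} = insert 1 {2..<p}" using assms by auto
  moreover have "(\<Prod>l\<in>{2..<p}. [:at_site 1 s l, 1 + \<beta> * at_site 1 s l:]) = (\<Prod>l\<in>{2..<p}. [:0, 1:])"
    by (rule prod.cong) (auto simp: at_site_def)
  ultimately show ?thesis by (simp add: wave_poly_def at_site_def)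
qed

lemma power_minus_one_two: "2 \<le> p \<Longrightarrow> x ^ (p - 1) = x * x ^ (p - 2)"
  by (metis Suc_1 Suc_diff_Suc Suc_le_lessD One_nat_def power_Suc)

lemma mult_regroup: "u * v = x * w \<Longrightarrow> u * q * (N * v) = x * (w * q * N)"
  for u v x w q N :: "'a :: comm_monoid_mult"
proof -
  assume "u * v = x * w"
  moreover have "u * q * (N * v) = (u * v) * (q * N)" by (simp only: mult_ac)
  ultimately show ?thesis by (simp only: mult_ac)
qed

text \<open>The numerator factor \<open>(1 + \<beta> t) z\<close> and the parameter
  \<open>ominus t\<close> at site 1 combine to \<open>(z - t) z\<close>. The zero at
  \<open>t\<close> cancels the new pole, and \<open>z\<close> restores the power that the parameter
  displaced.\<close>

lemma EA_enter:
  assumes Z: "pos_alphabet Z" "admissible N Z" and t: "t > 0" "t \<notin> Z" and ps: "parts_le n ps"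
  shows "EA N Z (\<lambda>_. 0) ps = EA (N * [:0, 1 + \<beta> * t:]) (insert t Z) (at_site 1 (ominus t)) ps"
proof (rule EA_change[OF Z _ _ ps])
  have nz: "1 + \<beta> * t \<noteq> 0" using one_plus_pos[OF t(1)] by simp
  show Z': "pos_alphabet (insert t Z)" using Z t by (auto simp: pos_alphabet_def)
  show "admissible (N * [:0, 1 + \<beta> * t:]) (insert t Z)"
    by (rule admissible_mult[OF Z(2) _ t(2)]) (use Z beta_pos in \<open>auto simp: pos_alphabet_def field_simps\<close>)
  fix p m c :: nat assume p: "p \<ge> 2"
  have "wave_poly (at_site 1 (ominus t)) p * (N * [:0, 1 + \<beta> * t:]) = [:- t, 1:] * (wave_poly (\<lambda>_. 0) p * N)"
  proof -
    have "1 + \<beta> * ominus t = 1 / (1 + \<beta> * t)" using nz by (simp add: ominus_def field_simps)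
    then have "[:ominus t, 1 + \<beta> * ominus t:] * [:0, 1 + \<beta> * t:] = [:- t, 1:] * [:0, 1:]"
      using nz by (simp add: ominus_def)
    moreover have "[:0, 1:] ^ (p - 1) = [:0, 1:] * [:0, 1 :: real:] ^ (p - 2)"
      by (rule power_minus_one_two[OF p])
    ultimately show ?thesis
      unfolding wave_poly_at_site_1[OF p] wave_poly_zero by (simp only: mult_regroup[of _ "[:0, 1 + \<beta> * t:]"])
  qed
  then show "res_sum m c (wave_poly (\<lambda>_. 0) p * N) Z
      = res_sum m c (wave_poly (at_site 1 (ominus t)) p * (N * [:0, 1 + \<beta> * t:])) (insert t Z)"
    using res_sum_insert[OF Z(1) t] by metis
qed

text \<open>The factor \<open>z \<boxplus> t\<close> of site 1 trades places with the
  \<open>z\<close> in the numerator, which becomes \<open>(z \<boxplus> t) (1 + \<beta> t)\<close>,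
  the factor of \<open>t\<close> in \<open>node_poly\<close>.\<close>

lemma EA_exit:
  assumes Z: "pos_alphabet Z" "admissible N Z" and t: "t > 0" "t \<notin> Z" and ps: "parts_le n ps"
  shows "EA (N * [:0, 1 + \<beta> * t:]) (insert t Z) (at_site 1 t) ps
    = EA (N * [:t * (1 + \<beta> * t), (1 + \<beta> * t)\<^sup>2:]) (insert t Z) (\<lambda>_. 0) ps"
proof (rule EA_change[OF _ _ _ _ ps])
  show "pos_alphabet (insert t Z)" "pos_alphabet (insert t Z)" using Z t by (auto simp: pos_alphabet_def)
  have fin: "finite Z" using Z by (simp add: pos_alphabet_def)
  show "admissible (N * [:0, 1 + \<beta> * t:]) (insert t Z)"
    by (rule admissible_mult[OF Z(2) fin t(2)]) (use beta_pos in \<open>auto simp: field_simps\<close>)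
  show "admissible (N * [:t * (1 + \<beta> * t), (1 + \<beta> * t)\<^sup>2:]) (insert t Z)"
    by (rule admissible_mult[OF Z(2) fin t(2)]) (use beta_pos in \<open>auto simp: field_simps power2_eq_square\<close>)
  fix p m c :: nat assume p: "p \<ge> 2"
  have "[:0, 1:] ^ (p - 1) = [:0, 1:] * [:0, 1 :: real:] ^ (p - 2)"
    by (rule power_minus_one_two[OF p])
  moreover have "[:t, 1 + \<beta> * t:] * [:0, 1 + \<beta> * t:] = [:0, 1:] * [:t * (1 + \<beta> * t), (1 + \<beta> * t)\<^sup>2:]"
    by (simp add: power2_eq_square algebra_simps)
  ultimately have "wave_poly (at_site 1 t) p * (N * [:0, 1 + \<beta> * t:])
    = wave_poly (\<lambda>_. 0) p * (N * [:t * (1 + \<beta> * t), (1 + \<beta> * t)\<^sup>2:])"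
    unfolding wave_poly_at_site_1[OF p] wave_poly_zero
    by (simp only: mult_regroup[of _ "[:0, 1 + \<beta> * t:]" "[:0, 1:]"]) (simp only: mult_ac)
  then show "res_sum m c (wave_poly (at_site 1 t) p * (N * [:0, 1 + \<beta> * t:])) (insert t Z)
      = res_sum m c (wave_poly (\<lambda>_. 0) p * (N * [:t * (1 + \<beta> * t), (1 + \<beta> * t)\<^sup>2:])) (insert t Z)"
    by simp
qed

definition node_poly :: "real set \<Rightarrow> real poly" where
  "node_poly X = (\<Prod>y\<in>X. [:y * (1 + \<beta> * y), (1 + \<beta> * y)\<^sup>2:])"

lemma poly_node_poly: "poly (node_poly X) z = (\<Prod>y\<in>X. (z \<boxplus> y) * (1 + \<beta> * y))"
  unfolding node_poly_def poly_prod by (rule prod.cong) (auto simp: oplus_def algebra_simps power2_eq_square)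

lemma admissible_node_poly: "finite X \<Longrightarrow> admissible (node_poly X) X"
proof (induction X rule: finite_induct)
  case empty
  then show ?case by (simp add: admissible_def node_poly_def)
next
  case (insert t X)
  have "node_poly (insert t X) = node_poly X * [:t * (1 + \<beta> * t), (1 + \<beta> * t)\<^sup>2:]"
    using insert.hyps by (simp add: node_poly_def mult.commute)
  then show ?case
    using admissible_mult[OF insert.IH insert.hyps(1,2), of "[:t * (1 + \<beta> * t), (1 + \<beta> * t)\<^sup>2:]"] beta_pos
    by (simp add: field_simps power2_eq_square)
qed

text \<open>The mirror image of \<open>FC_insert\<close>: the parameter enters at site 1 as
  \<open>ominus t\<close>, climbs to site \<open>n\<close>, where no part sees it and it may be
  replaced by \<open>t\<close>, and descends to leave at site 1.\<close>

theorem EA_insert: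
  assumes X: "pos_alphabet X" and t: "t > 0" "t \<notin> X" and n: "0 < n" and ps: "parts_le n ps"
  shows "EA (node_poly (insert t X)) (insert t X) (\<lambda>_. 0) ps
    = foldr (hop t) ([1..<n] @ rev [1..<n]) (EA (node_poly X) X (\<lambda>_. 0)) ps"
proof -
  have fin: "finite X" using X by (simp add: pos_alphabet_def)
  have X': "pos_alphabet (insert t X)" using X t by (auto simp: pos_alphabet_def)
  let ?N = "node_poly X * [:0, 1 + \<beta> * t:]"
  have top: "EA ?N (insert t X) (at_site n s) qs = EA ?N (insert t X) (at_site n s') qs"
    if "parts_le n qs" for s s' qs
    using that unfolding wave_poly_def
    by (intro EA_cong) (auto simp: parts_le_def at_site_def wave_poly_def intro!: prod.cong)
  have up: "foldr (hop t) (rev [1..<n]) (EA (node_poly X) X (\<lambda>_. 0)) qs = EA ?N (insert t X) (at_site n t) qs"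
    if qs: "parts_le n qs" for qs
  proof -
    have "foldr (hop t) (rev [1..<n]) (EA (node_poly X) X (\<lambda>_. 0)) qs = EA ?N (insert t X) (at_site n (ominus t)) qs"
      by (rule foldr_hop_ascend[where D = "parts_le n" and \<Phi> = "EA ?N (insert t X)"])
        (use EA_swapped[OF X'] parts_le_lower qs n t EA_enter[OF X admissible_node_poly[OF fin] t] in auto)
    then show ?thesis using top[OF qs] by simp
  qed
  have "foldr (hop t) [1..<n] (foldr (hop t) (rev [1..<n]) (EA (node_poly X) X (\<lambda>_. 0))) ps
    = EA ?N (insert t X) (at_site 1 t) ps"
    by (rule foldr_hop_descend[where D = "parts_le n" and \<Phi> = "EA ?N (insert t X)"])
      (use EA_swapped[OF X'] parts_le_lower ps n up in auto)
  also have "\<dots> = EA (node_poly X * [:t * (1 + \<beta> * t), (1 + \<beta> * t)\<^sup>2:]) (insert t X) (\<lambda>_. 0) ps"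
    by (rule EA_exit[OF X admissible_node_poly[OF fin] t ps])
  also have "node_poly X * [:t * (1 + \<beta> * t), (1 + \<beta> * t)\<^sup>2:] = node_poly (insert t X)"
    using fin t by (simp add: node_poly_def mult.commute)
  finally show ?thesis by simp
qed

text \<open>Without points only the residue at 0 remains, the coefficient of
  \<open>z ^ (m - p)\<close> in \<open>(1 + \<beta> z) ^ (- c)\<close>. It gives a unitriangular
  matrix for the staircase \<open>a, ..., 1\<close>. Any other strict partition of length
  \<open>a\<close> has a first part above \<open>a\<close>, and its first row is zero.\<close>

lemma EA_empty:
  assumes a: "0 < a" and ps: "parts_le n ps" "length ps = a"
  shows "EA (node_poly {}) {} (\<lambda>_. 0) ps = (if ps = rev [1..<Suc a] then 1 else 0)"
proof -
  have srt: "sorted_wrt (>) ps" and nz: "0 \<notin> set ps" using ps by (auto simp: parts_le_def strict_partition_def)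
  have entry: "res_sum m c (wave_poly (\<lambda>_. 0) p * node_poly {}) {}
      = (if m < p then 0 else (inverse (fps_of_poly [:1, \<beta>:]) ^ c) $ (m - p))" if "0 < m" "0 < p" for m c p
  proof -
    have "fps_of_poly ([:0, 1:] ^ (p - 1)) = (fps_X ^ (p - 1) :: real fps)" by (simp only: fps_of_poly_power fps_of_poly_fps_X)
    moreover have "m - 1 < p - 1 \<longleftrightarrow> m < p" "m - 1 - (p - 1) = m - p" using that by auto
    ultimately show ?thesis
      using that unfolding res_sum_def wave_poly_zero node_poly_def by (simp add: fps_X_power_mult_nth fps_of_poly_monom')
  qed
  have nth_pos: "0 < ps ! i" if "i < a" for i using nz ps(2) that nth_mem[of i ps] by (cases "ps ! i") auto
  show ?thesis
  proof (cases "ps = rev [1..<Suc a]")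
    case True
    have nth: "ps ! i = a - i" if "i < a" for i
      using that unfolding True by (subst rev_nth) (auto simp del: upt_Suc)
    have "dt a (\<lambda>i j. res_sum (a - j) (a - i) (wave_poly (\<lambda>_. 0) (ps ! i) * node_poly {}) {})
        = (\<Prod>i = 0..<a. res_sum (a - i) (a - i) (wave_poly (\<lambda>_. 0) (ps ! i) * node_poly {}) {})"
      by (rule dt_triangular) (auto simp: entry nth)
    also have "\<dots> = 1" by (rule prod.neutral) (auto simp: entry nth fps_nth_power_0)
    finally show ?thesis using True ps(2) by (simp add: EA_def del: upt_Suc)
  next
    case False
    have "ps ! 0 > a"
    proof (rule ccontr)
      assume "\<not> ps ! 0 > a"
      then have "ps ! 0 \<le> a" by simp
      have "set ps \<subseteq> {1..a}"
      proof
        fix x assume "x \<in> set ps"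
        then obtain i where i: "i < a" "x = ps ! i" using ps(2) by (auto simp: in_set_conv_nth)
        have "x \<le> ps ! 0" using i sorted_wrt_nth_less[OF srt, of 0 i] ps(2) by (cases i) auto
        then show "x \<in> {1..a}" using \<open>ps ! 0 \<le> a\<close> i nth_pos[of i] by auto
      qed
      moreover have "distinct ps" by (rule strict_dec_distinct[OF srt])
      ultimately have "set ps = {1..a}"
        using ps(2) distinct_card[of ps] by (intro card_subset_eq) auto
      then have "set ps = set (rev [1..<Suc a])"
        by (simp add: atLeastLessThanSuc_atLeastAtMost del: upt_Suc)
      moreover have "sorted_wrt (>) (rev [1..<Suc a])" by (simp only: sorted_wrt_rev) (simp add: sorted_wrt_upt del: upt_Suc)
      ultimately show False using False strict_dec_eqI[OF srt] by blast
    qed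
    then have "dt a (\<lambda>i j. res_sum (a - j) (a - i) (wave_poly (\<lambda>_. 0) (ps ! i) * node_poly {}) {}) = 0"
      using a by (intro dt_zero_row[of 0]) (auto simp: entry nth_pos)
    then show ?thesis using False ps(2) by (simp add: EA_def)
  qed
qed

text \<open>The parts are those of the staircase, each enlarged by \<open>b\<close>, so the shape is
  the \<open>a\<close> by \<open>b\<close> rectangle. They exceed every pole order, so no residue at
  0 survives and the entries are sums over \<open>X\<close>, to which Cauchy-Binet applies.\<close>

lemma EA_rectangle:
  assumes X: "pos_alphabet X" and ab: "0 < a" "a \<le> b"
  shows "EA (node_poly X) X (\<lambda>_. 0) (rev [Suc b..<Suc (a + b)]) = rect_sum a b X"
proof -
  have fin: "finite X" and pos: "\<And>z. z \<in> X \<Longrightarrow> z > 0" using X by (auto simp: pos_alphabet_def)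
  let ?ps = "rev [Suc b..<Suc (a + b)]"
  define \<rho> where "\<rho> z = poly (node_poly X) z / (\<Prod>y\<in>X - {z}. z - y)" for z
  \<comment> \<open>\<open>d\<close> takes everything out of the summand except the factors
    \<open>(1 / z + \<beta>) ^ i\<close> and \<open>z ^ j\<close> of the two Vandermonde matrices.
    Row \<open>i\<close> carries \<open>z\<close> to the power \<open>b - 1 - i + j\<close>, where
    \<open>i \<le> b - 1\<close> because \<open>i < a \<le> b\<close>.\<close>
  define d where "d z = z ^ (b - 1) / (1 + \<beta> * z) ^ a * \<rho> z" for z
  have cancel: "res_sum m c ([:0, 1:] ^ m * h) X = res_sum 0 c h X" for m c h
    by (induction m) (auto simp: res_sum_cancel_var[OF X] mult.assoc simp del: mult_pCons_left)
  have "EA (node_poly X) X (\<lambda>_. 0) ?ps = dt a (\<lambda>i j. \<Sum>z\<in>X. d z * (1 / z + \<beta>) ^ i * z ^ j)"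
    unfolding EA_def
  proof -
    have len: "length ?ps = a" by simp
    have "res_sum (a - j) (a - i) (wave_poly (\<lambda>_. 0) (?ps ! i) * node_poly X) X
        = (\<Sum>z\<in>X. d z * (1 / z + \<beta>) ^ i * z ^ j)" if i: "i < a" and j: "j < a" for i j
    proof -
      have "?ps ! i = a + b - i" using i by (subst rev_nth) (auto simp del: upt_Suc)
      then have "wave_poly (\<lambda>_. 0) (?ps ! i) * node_poly X
          = [:0, 1:] ^ (a - j) * ([:0, 1:] ^ (b - 1 - i + j) * node_poly X)"
        unfolding wave_poly_zero mult.assoc[symmetric] power_add[symmetric]
        using i j ab by (intro arg_cong[of _ _ "\<lambda>u. u * node_poly X"] arg_cong[of _ _ "(^) [:0, 1:]"]) auto
      then have "res_sum (a - j) (a - i) (wave_poly (\<lambda>_. 0) (?ps ! i) * node_poly X) X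
          = (\<Sum>z\<in>X. z ^ (b - 1 - i + j) * poly (node_poly X) z / ((1 + \<beta> * z) ^ (a - i) * (\<Prod>y\<in>X - {z}. z - y)))"
        by (simp only: cancel) (simp add: res_sum_def)
      also have "\<dots> = (\<Sum>z\<in>X. d z * (1 / z + \<beta>) ^ i * z ^ j)"
      proof (rule sum.cong[OF refl])
        fix z assume "z \<in> X"
        then have zp: "z > 0" "1 + \<beta> * z > 0" using pos one_plus_pos by auto
        have "1 / z + \<beta> = (1 + \<beta> * z) / z" using zp by (simp add: field_simps)
        moreover have "z ^ (b - 1) = z ^ (b - 1 - i) * z ^ i" "(1 + \<beta> * z) ^ a = (1 + \<beta> * z) ^ (a - i) * (1 + \<beta> * z) ^ i"
          using i ab by (simp_all add: power_add[symmetric])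
        ultimately show "z ^ (b - 1 - i + j) * poly (node_poly X) z / ((1 + \<beta> * z) ^ (a - i) * (\<Prod>y\<in>X - {z}. z - y))
            = d z * (1 / z + \<beta>) ^ i * z ^ j"
          unfolding d_def \<rho>_def using zp by (simp add: power_divide power_add)
      qed
      finally show ?thesis .
    qed
    then show "dt (length ?ps) (\<lambda>i j. res_sum (length ?ps - j) (length ?ps - i) (wave_poly (\<lambda>_. 0) (?ps ! i) * node_poly X) X)
        = dt a (\<lambda>i j. \<Sum>z\<in>X. d z * (1 / z + \<beta>) ^ i * z ^ j)"
      unfolding len by (rule dt_cong)
  qed
  also have "\<dots> = (\<Sum>I | I \<subseteq> X \<and> card I = a. dt a (\<lambda>i j. \<Sum>z\<in>I. d z * (1 / z + \<beta>) ^ i * z ^ j))"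
    by (rule dt_sum_subsets[OF fin])
  also have "\<dots> = rect_sum a b X"
    unfolding rect_sum_def
  proof (intro sum.cong refl)
    fix I assume "I \<in> {I. I \<subseteq> X \<and> card I = a}"
    then have I: "I \<subseteq> X" "card I = a" by auto
    have finI: "finite I" using I fin finite_subset by blast
    have "dt a (\<lambda>i j. \<Sum>z\<in>I. d z * (1 / z + \<beta>) ^ i * z ^ j) = (\<Prod>z\<in>I. d z * (\<Prod>y\<in>I - {z}. (z - y) / z))"
      using dt_square_nodes[OF finI I(2)] pos I(1) by blast
    also have "\<dots> = (\<Prod>z\<in>I. z ^ (b - a) * (\<Prod>y\<in>I. z \<boxplus> y) * (\<Prod>y\<in>X - I. ratio z y)
        * ((\<Prod>y\<in>I - {z}. 1 + \<beta> * y) / (1 + \<beta> * z) ^ (a - 1)))"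
    proof (rule prod.cong[OF refl])
      fix z assume z: "z \<in> I"
      have zX: "z \<in> X" using z I by auto
      have zp: "z > 0" "1 + \<beta> * z > 0" using pos[OF zX] one_plus_pos by auto
      have XI: "X - {z} = (I - {z}) \<union> (X - I)" "(I - {z}) \<inter> (X - I) = {}" using z I by auto
      have "(\<Prod>y\<in>X - {z}. z - y) = (\<Prod>y\<in>I - {z}. z - y) * (\<Prod>y\<in>X - I. z - y)"
        unfolding XI(1) by (rule prod.union_disjoint) (use finI fin XI in auto)
      moreover have "poly (node_poly X) z = (z \<boxplus> z) * (1 + \<beta> * z) * ((\<Prod>y\<in>I - {z}. z \<boxplus> y) * (\<Prod>y\<in>I - {z}. 1 + \<beta> * y))
          * (\<Prod>y\<in>X - I. (z \<boxplus> y) * (1 + \<beta> * y))"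
        unfolding poly_node_poly prod.remove[OF fin zX] XI(1)
        by (subst prod.union_disjoint) (use finI fin XI in \<open>auto simp: prod.distrib\<close>)
      moreover have "(\<Prod>y\<in>I. z \<boxplus> y) = (z \<boxplus> z) * (\<Prod>y\<in>I - {z}. z \<boxplus> y)" using finI z by (simp add: prod.remove)
      moreover have "(\<Prod>y\<in>I - {z}. (z - y) / z) = (\<Prod>y\<in>I - {z}. z - y) / z ^ (a - 1)"
        using finI z I by (simp add: prod_dividef)
      moreover have "(\<Prod>y\<in>X - I. ratio z y) = (\<Prod>y\<in>X - I. (z \<boxplus> y) * (1 + \<beta> * y)) / (\<Prod>y\<in>X - I. z - y)"
        by (simp add: ratio_def prod_dividef)
      moreover have "(\<Prod>y\<in>I - {z}. z - y) \<noteq> 0" "(\<Prod>y\<in>X - I. z - y) \<noteq> 0" using finI fin z by auto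
      moreover have "z ^ (b - 1) = z ^ (b - a) * z ^ (a - 1)" "(1 + \<beta> * z) ^ a = (1 + \<beta> * z) * (1 + \<beta> * z) ^ (a - 1)"
        using ab by (simp_all add: power_add[symmetric] power_Suc[symmetric] del: power_Suc)
      moreover have "z ^ (a - 1) \<noteq> 0" "(1 + \<beta> * z) ^ (a - 1) \<noteq> 0" using zp by auto
      moreover have "zb * za / (p * pa) * (zz * p * (u * v) * w / (s * r)) * (s / za) = zb * (zz * u) * (w / r) * (v / pa)"
        if "za \<noteq> 0" "p \<noteq> 0" "pa \<noteq> 0" "s \<noteq> 0" "r \<noteq> 0" for zb za p pa zz u v w s r :: real
      proof -
        have "zb * za / (p * pa) * (zz * p * (u * v) * w / (s * r)) * (s / za)
          = zb * (zz * u) * (w / r) * (v / pa) * ((za * inverse za) * (p * inverse p) * (s * inverse s))"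
          by (simp only: divide_inverse inverse_mult_distrib mult_ac)
        then show ?thesis using that by simp
      qed
      ultimately show "d z * (\<Prod>y\<in>I - {z}. (z - y) / z)
        = z ^ (b - a) * (\<Prod>y\<in>I. z \<boxplus> y) * (\<Prod>y\<in>X - I. ratio z y)
          * ((\<Prod>y\<in>I - {z}. 1 + \<beta> * y) / (1 + \<beta> * z) ^ (a - 1))"
        unfolding d_def \<rho>_def using zp by simp
    qed
    also have "\<dots> = (\<Prod>i\<in>I. i ^ (b - a)) * (\<Prod>i\<in>I. \<Prod>j\<in>I. i \<boxplus> j) * (\<Prod>i\<in>I. \<Prod>j\<in>X - I. ratio i j)
        * (\<Prod>z\<in>I. (\<Prod>y\<in>I - {z}. 1 + \<beta> * y) / (1 + \<beta> * z) ^ (a - 1))"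
      by (simp only: prod.distrib)
    \<comment> \<open>Each \<open>1 + \<beta> * y\<close> occurs once in the numerator for each of
      the \<open>a - 1\<close> other points of \<open>I\<close>.\<close>
    also have "(\<Prod>z\<in>I. (\<Prod>y\<in>I - {z}. 1 + \<beta> * y) / (1 + \<beta> * z) ^ (a - 1)) = 1"
    proof -
      have "(\<Prod>z\<in>I. \<Prod>y\<in>I - {z}. 1 + \<beta> * y) = (\<Prod>y\<in>I. \<Prod>z\<in>I - {y}. 1 + \<beta> * y)"
      proof -
        have "I - {z} = {y \<in> I. z \<noteq> y}" "I - {z} = {y \<in> I. y \<noteq> z}" for z by auto
        then show ?thesis
          using prod.swap_restrict[OF finI finI, of "\<lambda>z y. 1 + \<beta> * y" "\<lambda>z y. z \<noteq> y"] by simp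
      qed
      also have "\<dots> = (\<Prod>z\<in>I. (1 + \<beta> * z) ^ (a - 1))" using finI I(2) by simp
      finally have "(\<Prod>z\<in>I. (\<Prod>y\<in>I - {z}. 1 + \<beta> * y) / (1 + \<beta> * z) ^ (a - 1))
        = (\<Prod>z\<in>I. (1 + \<beta> * z) ^ (a - 1)) / (\<Prod>z\<in>I. (1 + \<beta> * z) ^ (a - 1))"
        by (simp only: prod_dividef)
      moreover have "(\<Prod>z\<in>I. (1 + \<beta> * z) ^ (a - 1)) \<noteq> 0"
        using finI one_plus_pos pos I(1) by (force simp: prod_zero_iff)
      ultimately show ?thesis by simp
    qed
    finally show "dt a (\<lambda>i j. \<Sum>z\<in>I. d z * (1 / z + \<beta>) ^ i * z ^ j)
      = (\<Prod>i\<in>I. i ^ (b - a)) * (\<Prod>i\<in>I. \<Prod>j\<in>I. i \<boxplus> j) * (\<Prod>i\<in>I. \<Prod>j\<in>X - I. ratio i j)"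
      by simp
  qed
  finally show ?thesis .
qed

end

section \<open>Signed permutations and the generic Hecke algebra\<close>

abbreviation pinv :: "(int \<Rightarrow> int) \<Rightarrow> int \<Rightarrow> int" where
  "pinv v \<equiv> inv_into UNIV v"

lemma cox_gen_zero_apply: "cox_gen 0 z = (if z = - 1 then 1 else if z = 1 then - 1 else z)"
  by (auto simp: cox_gen_def transpose_def)

lemma cox_gen_pos_apply:
  "0 < i \<Longrightarrow> cox_gen i z = (if z = int i then int i + 1 else if z = int i + 1 then int i
     else if z = - int i then - int i - 1 else if z = - int i - 1 then - int i else z)"
  by (auto simp: cox_gen_def transpose_def)

lemma cox_gen_involution [simp]: "cox_gen i (cox_gen i z) = z"
  by (cases "i = 0") (auto simp: cox_gen_zero_apply cox_gen_pos_apply)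

lemma cox_gen_comp_self: "cox_gen i \<circ> cox_gen i = id" "cox_gen i \<circ> (cox_gen i \<circ> v) = v"
  by (auto simp: fun_eq_iff)

lemma cox_gen_odd: "cox_gen i (- z) = - cox_gen i z"
  by (cases "i = 0") (auto simp: cox_gen_zero_apply cox_gen_pos_apply)

lemma cox_gen_eq_iff [simp]: "cox_gen i x = cox_gen i y \<longleftrightarrow> x = y"
  by (metis cox_gen_involution)

lemma cox_gen_eq_0_iff [simp]: "cox_gen i z = 0 \<longleftrightarrow> z = 0"
  by (cases "i = 0") (auto simp: cox_gen_zero_apply cox_gen_pos_apply)

lemma bij_cox_gen: "bij (cox_gen i)"
  by (rule o_bij[of "cox_gen i"]) (auto simp: fun_eq_iff)

lemma inv_cox_gen: "pinv (cox_gen i) = cox_gen i"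
  by (rule inv_equality) auto

lemma cox_gen_commute: "i + 1 < j \<Longrightarrow> cox_gen i \<circ> cox_gen j = cox_gen j \<circ> cox_gen i"
  by (cases "i = 0") (auto simp: fun_eq_iff cox_gen_zero_apply cox_gen_pos_apply)

lemma cox_gen_braid:
  "0 < i \<Longrightarrow> cox_gen i \<circ> (cox_gen (i + 1) \<circ> cox_gen i) = cox_gen (i + 1) \<circ> (cox_gen i \<circ> cox_gen (i + 1))"
proof
  fix z assume i: "0 < i"
  consider "z = int i" | "z = int i + 1" | "z = int i + 2" | "z = - int i" | "z = - int i - 1" | "z = - int i - 2"
    | "z \<noteq> int i" "z \<noteq> int i + 1" "z \<noteq> int i + 2" "z \<noteq> - int i" "z \<noteq> - int i - 1" "z \<noteq> - int i - 2"
    by blast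
  then show "(cox_gen i \<circ> (cox_gen (i + 1) \<circ> cox_gen i)) z = (cox_gen (i + 1) \<circ> (cox_gen i \<circ> cox_gen (i + 1))) z"
    by cases (use i in \<open>simp_all add: cox_gen_pos_apply\<close>)
qed

lemma cox_gen_four:
  "cox_gen 1 \<circ> (cox_gen 0 \<circ> (cox_gen 1 \<circ> cox_gen 0)) = cox_gen 0 \<circ> (cox_gen 1 \<circ> (cox_gen 0 \<circ> cox_gen 1))"
proof
  fix z :: int
  consider "z = 1" | "z = 2" | "z = - 1" | "z = - 2" | "z \<noteq> 1" "z \<noteq> 2" "z \<noteq> - 1" "z \<noteq> - 2" by blast
  then show "(cox_gen 1 \<circ> (cox_gen 0 \<circ> (cox_gen 1 \<circ> cox_gen 0))) z = (cox_gen 0 \<circ> (cox_gen 1 \<circ> (cox_gen 0 \<circ> cox_gen 1))) z"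
    by cases (simp_all add: cox_gen_pos_apply cox_gen_zero_apply)
qed

lemma cox_gen_signed_perms: "i < n \<Longrightarrow> cox_gen i \<in> signed_perms n"
  by (auto simp: signed_perms_def cox_gen_odd) (auto simp: cox_gen_def intro!: permutes_compose permutes_swap_id)

lemma signed_perms_comp: "v \<in> signed_perms n \<Longrightarrow> w \<in> signed_perms n \<Longrightarrow> v \<circ> w \<in> signed_perms n"
  by (auto simp: signed_perms_def permutes_compose)

lemma id_signed_perms: "id \<in> signed_perms n"
  by (simp add: signed_perms_def permutes_id)

lemma finite_signed_perms [simp]: "finite (signed_perms n)"
  by (rule finite_subset[of _ "{w. w permutes {- int n..int n} - {0}}"])
    (auto simp: signed_perms_def intro: finite_permutations)

lemma signed_perms_bij: "v \<in> signed_perms n \<Longrightarrow> bij v"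
  by (auto simp: signed_perms_def permutes_bij)

lemma signed_perms_odd: "v \<in> signed_perms n \<Longrightarrow> v (- z) = - v z"
  by (simp add: signed_perms_def)

lemma signed_perms_f_inv: "v \<in> signed_perms n \<Longrightarrow> v (pinv v z) = z"
  by (rule surj_f_inv_f[OF bij_is_surj[OF signed_perms_bij]])

lemma signed_perms_inv_odd:
  assumes v: "v \<in> signed_perms n"
  shows "pinv v (- z) = - pinv v z"
  by (rule inv_f_eq[OF bij_is_inj[OF signed_perms_bij[OF v]]])
    (simp add: signed_perms_odd[OF v] signed_perms_f_inv[OF v])

lemma signed_perms_inv_eq_iff: "v \<in> signed_perms n \<Longrightarrow> pinv v x = pinv v y \<longleftrightarrow> x = y"
  by (rule inj_eq[OF bij_is_inj[OF bij_imp_bij_inv[OF signed_perms_bij]]])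

lemma signed_perms_inv_zero:
  assumes v: "v \<in> signed_perms n"
  shows "pinv v z = 0 \<longleftrightarrow> z = 0"
proof -
  have "pinv v 0 = 0" using signed_perms_inv_odd[OF v, of 0] by simp
  then show ?thesis using signed_perms_inv_eq_iff[OF v, of z 0] by simp
qed

lemma signed_perms_inv_range: "v \<in> signed_perms n \<Longrightarrow> z \<noteq> 0 \<Longrightarrow> \<bar>z\<bar> \<le> int n \<Longrightarrow> \<bar>pinv v z\<bar> \<le> int n"
  using permutes_in_image[OF permutes_inv, of v "{- int n..int n} - {0}" z] by (auto simp: signed_perms_def)

lemma inv_cox_gen_comp: "v \<in> signed_perms n \<Longrightarrow> pinv (cox_gen i \<circ> v) = pinv v \<circ> cox_gen i"
  by (simp add: o_inv_distrib signed_perms_bij bij_cox_gen inv_cox_gen)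

lemma word_perm_Nil [simp]: "word_perm [] = id"
  and word_perm_Cons [simp]: "word_perm (i # as) = cox_gen i \<circ> word_perm as"
  by (auto simp: word_perm_def)

lemma word_perm_append: "word_perm (as @ bs) = word_perm as \<circ> word_perm bs"
  by (induction as) (auto simp: o_assoc)

lemma word_perm_signed_perms: "set as \<subseteq> {..<n} \<Longrightarrow> word_perm as \<in> signed_perms n"
  by (induction as) (auto simp: id_signed_perms intro!: signed_perms_comp cox_gen_signed_perms)

lemma inv_word_perm: "pinv (word_perm as) = word_perm (rev as)"
proof (induction as)
  case (Cons i as)
  have "bij (word_perm as)"
    by (rule signed_perms_bij[OF word_perm_signed_perms[of as "Suc (Max (set as))"]])
      (auto simp: less_Suc_eq_le)
  then show ?case
    by (simp only: word_perm_Cons o_inv_distrib[OF bij_cox_gen] inv_cox_gen Cons rev.simps word_perm_append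
        word_perm_Nil o_id)
qed simp

section \<open>The exchange property\<close>

text \<open>For \<open>q = - p\<close> this is the sign change at \<open>p\<close>; in particular
  \<open>reflection (- 1) 1\<close> is \<open>cox_gen 0\<close>.\<close>

definition reflection :: "int \<Rightarrow> int \<Rightarrow> int \<Rightarrow> int" where
  "reflection p q z = (if z = p then q else if z = q then p else if z = - p then - q else if z = - q then - p else z)"

lemma reflection_conj: "reflection p q \<circ> cox_gen j = cox_gen j \<circ> reflection (cox_gen j p) (cox_gen j q)"
proof
  fix z
  have "cox_gen j z = y \<longleftrightarrow> z = cox_gen j y" for y by (metis cox_gen_involution)
  then show "(reflection p q \<circ> cox_gen j) z = (cox_gen j \<circ> reflection (cox_gen j p) (cox_gen j q)) z"
    by (auto simp: reflection_def cox_gen_odd[symmetric])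
qed

text \<open>For \<open>j > 0\<close> a generator moves every value by at most 1, so it can reverse
  only neighbours, and among these only the two pairs it exchanges; \<open>cox_gen 0\<close>
  reverses only \<open>- 1\<close> and 1.\<close>

lemma reflection_simple:
  assumes "p < q" "p \<noteq> 0" "q \<noteq> 0" "cox_gen j q < cox_gen j p"
  shows "reflection p q = cox_gen j"
proof (cases "j = 0")
  case True
  then have "p = - 1" "q = 1" using assms by (auto simp: cox_gen_zero_apply split: if_splits)
  then show ?thesis using True by (auto simp: fun_eq_iff reflection_def cox_gen_zero_apply)
next
  case False
  have "z - 1 \<le> cox_gen j z" "cox_gen j z \<le> z + 1" for z using False by (simp_all add: cox_gen_pos_apply)
  from this(1)[of q] this(2)[of p] have q: "q = p + 1" using assms(1,4) by linarith
  have "p = int j \<or> p = - int j - 1"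
  proof (rule ccontr)
    assume np: "\<not> (p = int j \<or> p = - int j - 1)"
    then have "cox_gen j p \<le> p" using False by (simp add: cox_gen_pos_apply)
    moreover have "p + 1 \<le> cox_gen j (p + 1)" using np False by (simp add: cox_gen_pos_apply)
    ultimately show False using assms(4) q by simp
  qed
  then show ?thesis
  proof
    assume "p = int j"
    then show ?thesis using q False by (simp add: fun_eq_iff reflection_def cox_gen_pos_apply)
  next
    assume p: "p = - int j - 1"
    have "reflection p q z = cox_gen j z" for z
    proof -
      consider "z = int j" | "z = int j + 1" | "z = - int j" | "z = - int j - 1"
        | "z \<noteq> int j" "z \<noteq> int j + 1" "z \<noteq> - int j" "z \<noteq> - int j - 1" by blast
      then show ?thesis by cases (use p q False in \<open>simp_all add: reflection_def cox_gen_pos_apply\<close>)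
    qed
    then show ?thesis by blast
  qed
qed

text \<open>The pair \<open>p < q\<close> is followed through the letters of \<open>bs\<close>. As
  the inverse permutation reverses it, some letter does so first; that letter is the reflection in
  the current pair. Conjugation carries the given reflection up to this place, where the two
  cancel.\<close>

lemma word_exchange:
  "p < q \<Longrightarrow> p \<noteq> 0 \<Longrightarrow> q \<noteq> 0 \<Longrightarrow> word_perm (rev bs) p > word_perm (rev bs) q \<Longrightarrow>
    \<exists>cs. Suc (length cs) = length bs \<and> set cs \<subseteq> set bs \<and> reflection p q \<circ> word_perm bs = word_perm cs"
proof (induction bs arbitrary: p q)
  case (Cons j bs)
  show ?case
  proof (cases "cox_gen j p < cox_gen j q")
    case True
    obtain cs where cs: "Suc (length cs) = length bs" "set cs \<subseteq> set bs"
      "reflection (cox_gen j p) (cox_gen j q) \<circ> word_perm bs = word_perm cs"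
    proof -
      have "word_perm (rev bs) (cox_gen j p) > word_perm (rev bs) (cox_gen j q)" "cox_gen j p \<noteq> 0" "cox_gen j q \<noteq> 0"
        using Cons.prems by (simp_all add: word_perm_append)
      from Cons.IH[OF True this(2,3,1)] show ?thesis using that by blast
    qed
    have "reflection p q \<circ> word_perm (j # bs) = word_perm (j # cs)"
      by (simp only: word_perm_Cons o_assoc reflection_conj) (simp only: o_assoc[symmetric] cs(3))
    moreover have "Suc (length (j # cs)) = length (j # bs)" "set (j # cs) \<subseteq> set (j # bs)" using cs by auto
    ultimately show ?thesis by blast
  next
    case False
    then have "cox_gen j q < cox_gen j p" using Cons.prems(1) by (metis cox_gen_eq_iff linorder_neqE_linordered_idom less_irrefl)
    then have "reflection p q = cox_gen j" using reflection_simple Cons.prems by blast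
    then have "reflection p q \<circ> word_perm (j # bs) = word_perm bs" by (simp only: word_perm_Cons cox_gen_comp_self)
    moreover have "Suc (length bs) = length (j # bs)" "set bs \<subseteq> set (j # bs)" by auto
    ultimately show ?thesis by blast
  qed
qed simp

text \<open>A left descent of \<open>v\<close> in terms of positions: \<open>i + 1\<close> stands
  before \<open>i\<close>, respectively 1 stands at a negative position.\<close>

definition ldesc :: "nat \<Rightarrow> (int \<Rightarrow> int) \<Rightarrow> bool" where
  "ldesc i v \<longleftrightarrow> (if i = 0 then pinv v 1 < 0 else pinv v (int i) > pinv v (int i + 1))"

lemma ldesc_cox_gen:
  assumes v: "v \<in> signed_perms n"
  shows "ldesc i (cox_gen i \<circ> v) \<longleftrightarrow> \<not> ldesc i v"
proof (cases "i = 0")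
  case True
  have "pinv v 1 \<noteq> 0" using signed_perms_inv_zero[OF v, of 1] by simp
  then show ?thesis
    using True signed_perms_inv_odd[OF v, of 1] by (auto simp: ldesc_def inv_cox_gen_comp[OF v] cox_gen_zero_apply)
next
  case False
  have "pinv v (int i) \<noteq> pinv v (int i + 1)" using signed_perms_inv_eq_iff[OF v] by simp
  then show ?thesis
    using False by (auto simp: ldesc_def inv_cox_gen_comp[OF v] cox_gen_pos_apply)
qed

lemma ldesc_word_exchange:
  assumes as: "set as \<subseteq> {..<n}" and d: "ldesc i (word_perm as)"
  shows "\<exists>cs. Suc (length cs) = length as \<and> set cs \<subseteq> set as \<and> cox_gen i \<circ> word_perm as = word_perm cs"
proof (cases "i = 0")
  case True
  have v: "word_perm as \<in> signed_perms n" by (rule word_perm_signed_perms[OF as])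
  have "reflection (- 1) 1 = cox_gen i" using True by (auto simp: fun_eq_iff reflection_def cox_gen_zero_apply)
  then show ?thesis
    using word_exchange[of "- 1" 1 as] d True signed_perms_inv_odd[OF v, of 1]
    by (auto simp: ldesc_def inv_word_perm)
next
  case False
  have "reflection (int i) (int i + 1) = cox_gen i" using False by (auto simp: fun_eq_iff reflection_def cox_gen_pos_apply)
  then show ?thesis
    using word_exchange[of "int i" "int i + 1" as] d False by (auto simp: ldesc_def inv_word_perm)
qed

text \<open>The positions of \<open>1, ..., n\<close> increase, the first of them is positive and
  the last at most \<open>n\<close>. Hence the position of \<open>j\<close> is at least
  \<open>j\<close>, counting upwards, and at most \<open>j\<close>, counting downwards.\<close>

lemma no_ldesc_id:
  assumes v: "v \<in> signed_perms n" and nd: "\<And>i. i < n \<Longrightarrow> \<not> ldesc i v"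
  shows "v = id"
proof -
  have inj: "pinv v x = pinv v y \<Longrightarrow> x = y" for x y
    using signed_perms_inv_eq_iff[OF v] by simp
  have step: "pinv v (int j) + 1 \<le> pinv v (int j + 1)" if "0 < j" "j < n" for j
  proof -
    have "pinv v (int j) \<noteq> pinv v (int j + 1)" using inj by fastforce
    then show ?thesis using nd[OF that(2)] that(1) by (simp add: ldesc_def)
  qed
  have low: "int j \<le> pinv v (int j)" if "0 < j" "j \<le> n" for j
    using that
  proof (induction j)
    case (Suc j)
    show ?case
    proof (cases "j = 0")
      case True
      have "pinv v 1 \<noteq> 0" using signed_perms_inv_zero[OF v, of 1] by simp
      then show ?thesis using nd[of 0] Suc.prems True by (auto simp: ldesc_def)
    next
      case False
      then show ?thesis using Suc step[of j] by (auto simp: add.commute)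
    qed
  qed simp
  have up: "pinv v (int j) \<le> int j" if "0 < j" "j \<le> n" for j
    using that(2,1)
  proof (induction j rule: inc_induct)
    case base
    then show ?case using signed_perms_inv_range[OF v, of "int n"] by auto
  next
    case (step j)
    then show ?case using \<open>\<And>j. 0 < j \<Longrightarrow> j < n \<Longrightarrow> pinv v (int j) + 1 \<le> pinv v (int j + 1)\<close>[of j] by (auto simp: add.commute)
  qed
  have pos: "pinv v z = z" if "0 < z" "z \<le> int n" for z
  proof -
    have "0 < nat z" "nat z \<le> n" "int (nat z) = z" using that by auto
    then show ?thesis using low[of "nat z"] up[of "nat z"] by simp
  qed
  have "pinv v z = z" for z
  proof (cases "z \<in> {- int n..int n} - {0}")
    case True
    then show ?thesis using pos[of z] pos[of "- z"] signed_perms_inv_odd[OF v, of z] by (cases "0 < z") auto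
  next
    case False
    moreover have "pinv v permutes ({- int n..int n} - {0})" using v by (simp add: signed_perms_def permutes_inv)
    ultimately show ?thesis by (rule permutes_not_in[rotated])
  qed
  then have "v z = z" for z using signed_perms_f_inv[OF v, of z] by simp
  then show ?thesis by auto
qed

lemma signed_perms_word_exists:
  assumes "v \<in> signed_perms n"
  shows "\<exists>as. set as \<subseteq> {..<n} \<and> word_perm as = v"
proof -
  \<comment> \<open>As in the rearrangement inequality, undoing a left descent strictly increases
    this sum. It is bounded by \<open>M\<close>, so the process ends, and it can end only at the
    identity.\<close>
  define \<mu> where "\<mu> v = (\<Sum>j\<in>{1..int n}. j * pinv v j)" for v
  define M where "M = (\<Sum>j\<in>{1..int n}. j * int n)"
  have bound: "\<mu> v \<le> M" if "v \<in> signed_perms n" for v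
    unfolding \<mu>_def M_def
  proof (rule sum_mono)
    fix j assume "j \<in> {1..int n}"
    then show "j * pinv v j \<le> j * int n"
      using signed_perms_inv_range[OF that, of j] by (intro mult_left_mono) auto
  qed
  have up: "\<mu> v < \<mu> (cox_gen i \<circ> v)" if v: "v \<in> signed_perms n" and i: "i < n" and d: "ldesc i v" for v i
  proof (cases "i = 0")
    case True
    have "\<mu> (cox_gen i \<circ> v) = (\<Sum>j\<in>{1..int n}. j * pinv v (cox_gen i j))"
      by (simp add: \<mu>_def inv_cox_gen_comp[OF v])
    moreover have "{1..int n} = insert 1 {2..int n}" using i by auto
    moreover have "(\<Sum>j\<in>{2..int n}. j * pinv v (cox_gen i j)) = (\<Sum>j\<in>{2..int n}. j * pinv v j)"
      by (rule sum.cong) (use True in \<open>auto simp: cox_gen_zero_apply\<close>)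
    ultimately show ?thesis
      using d True signed_perms_inv_odd[OF v, of 1] by (simp add: \<mu>_def ldesc_def cox_gen_zero_apply)
  next
    case False
    let ?R = "{1..int n} - {int i, int i + 1}"
    have "\<mu> (cox_gen i \<circ> v) = (\<Sum>j\<in>{1..int n}. j * pinv v (cox_gen i j))"
      by (simp add: \<mu>_def inv_cox_gen_comp[OF v])
    moreover have split: "(\<Sum>j\<in>{1..int n}. f j) = f (int i) + f (int i + 1) + (\<Sum>j\<in>?R. f j)" for f :: "int \<Rightarrow> int"
    proof -
      have "{1..int n} = insert (int i) (insert (int i + 1) ?R)" using i False by auto
      then have "(\<Sum>j\<in>{1..int n}. f j) = (\<Sum>j\<in>insert (int i) (insert (int i + 1) ?R). f j)" by (rule arg_cong)
      also have "\<dots> = f (int i) + f (int i + 1) + (\<Sum>j\<in>?R. f j)" by simp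
      finally show ?thesis .
    qed
    moreover have "(\<Sum>j\<in>?R. j * pinv v (cox_gen i j)) = (\<Sum>j\<in>?R. j * pinv v j)"
      by (rule sum.cong) (use False in \<open>auto simp: cox_gen_pos_apply\<close>)
    moreover have "pinv v (int i) > pinv v (int i + 1)" using d False by (simp add: ldesc_def)
    ultimately show ?thesis
      unfolding \<mu>_def[of v] split[of "\<lambda>j. j * pinv v j"] using False by (simp add: cox_gen_pos_apply algebra_simps)
  qed
  show ?thesis
    using assms
  proof (induction "nat (M - \<mu> v)" arbitrary: v rule: less_induct)
    case less
    show ?case
    proof (cases "\<exists>i<n. ldesc i v")
      case True
      then obtain i where i: "i < n" "ldesc i v" by auto
      have w: "cox_gen i \<circ> v \<in> signed_perms n" using less.prems i by (intro signed_perms_comp cox_gen_signed_perms)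
      have "nat (M - \<mu> (cox_gen i \<circ> v)) < nat (M - \<mu> v)"
        using up[OF less.prems i] bound[OF w] by simp
      from less.hyps[OF this w] obtain as where "set as \<subseteq> {..<n}" "word_perm as = cox_gen i \<circ> v" by auto
      then show ?thesis using i by (intro exI[of _ "i # as"]) (auto simp: cox_gen_comp_self)
    next
      case False
      then have "v = id" using no_ldesc_id[OF less.prems] by auto
      then show ?thesis by (intro exI[of _ "[]"]) auto
    qed
  qed
qed

section \<open>Length and reduced words\<close>

definition cox_length :: "nat \<Rightarrow> (int \<Rightarrow> int) \<Rightarrow> nat" where
  "cox_length n v = (LEAST m. \<exists>as. set as \<subseteq> {..<n} \<and> word_perm as = v \<and> length as = m)"

lemma reduced_word_iff:
  assumes v: "v \<in> signed_perms n"
  shows "reduced_word n v as \<longleftrightarrow> set as \<subseteq> {..<n} \<and> word_perm as = v \<and> length as = cox_length n v"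
proof -
  let ?P = "\<lambda>m. \<exists>as. set as \<subseteq> {..<n} \<and> word_perm as = v \<and> length as = m"
  have ex: "\<exists>m. ?P m" using signed_perms_word_exists[OF v] by auto
  have "?P (cox_length n v)" unfolding cox_length_def by (rule LeastI_ex[OF ex])
  moreover have "cox_length n v \<le> length bs" if "set bs \<subseteq> {..<n}" "word_perm bs = v" for bs
    unfolding cox_length_def by (rule Least_le) (use that in auto)
  ultimately show ?thesis unfolding reduced_word_def by (metis le_antisym)
qed

lemma reduced_word_exists: "v \<in> signed_perms n \<Longrightarrow> \<exists>as. reduced_word n v as"
proof -
  assume v: "v \<in> signed_perms n"
  let ?P = "\<lambda>m. \<exists>as. set as \<subseteq> {..<n} \<and> word_perm as = v \<and> length as = m"
  have "?P (cox_length n v)" unfolding cox_length_def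
    by (rule LeastI_ex) (use signed_perms_word_exists[OF v] in auto)
  then show ?thesis using reduced_word_iff[OF v] by auto
qed

lemma cox_length_le: "set as \<subseteq> {..<n} \<Longrightarrow> cox_length n (word_perm as) \<le> length as"
  unfolding cox_length_def by (rule Least_le) auto

text \<open>The exchange property deletes a letter from a shortest word of \<open>v\<close>;
  conversely, prefixing \<open>i\<close> to a word of the shorter element gives back
  \<open>v\<close>.\<close>

lemma cox_length_ldesc:
  assumes v: "v \<in> signed_perms n" and i: "i < n" and d: "ldesc i v"
  shows "cox_length n v = Suc (cox_length n (cox_gen i \<circ> v))"
proof -
  obtain as where as: "set as \<subseteq> {..<n}" "word_perm as = v" "length as = cox_length n v"
    using reduced_word_exists[OF v] reduced_word_iff[OF v] by auto
  obtain cs where cs: "Suc (length cs) = length as" "set cs \<subseteq> set as" "cox_gen i \<circ> v = word_perm cs"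
    using ldesc_word_exchange[OF as(1), of i] d as(2) by auto
  then have "Suc (cox_length n (cox_gen i \<circ> v)) \<le> cox_length n v"
    using cox_length_le[OF order.trans[OF cs(2) as(1)]] as(3) by simp
  moreover have "cox_gen i \<circ> v \<in> signed_perms n" using v i by (intro signed_perms_comp cox_gen_signed_perms)
  then obtain bs where bs: "set bs \<subseteq> {..<n}" "word_perm bs = cox_gen i \<circ> v" "length bs = cox_length n (cox_gen i \<circ> v)"
    using reduced_word_exists reduced_word_iff by metis
  then have "word_perm (i # bs) = v" by (simp add: cox_gen_comp_self)
  then have "cox_length n v \<le> Suc (cox_length n (cox_gen i \<circ> v))"
    using cox_length_le[of "i # bs" n] bs i by simp
  ultimately show ?thesis by simp
qed

lemma reduced_word_Cons:
  assumes v: "v \<in> signed_perms n" and i: "i < n"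
  shows "ldesc i v \<Longrightarrow> reduced_word n (cox_gen i \<circ> v) as \<Longrightarrow> reduced_word n v (i # as)"
    and "reduced_word n v (i # as) \<Longrightarrow> ldesc i v \<and> reduced_word n (cox_gen i \<circ> v) as"
proof -
  have w: "cox_gen i \<circ> v \<in> signed_perms n" using v i by (intro signed_perms_comp cox_gen_signed_perms)
  show "reduced_word n v (i # as)" if "ldesc i v" "reduced_word n (cox_gen i \<circ> v) as"
    using that i cox_length_ldesc[OF v i] unfolding reduced_word_iff[OF v] reduced_word_iff[OF w]
    by (auto simp: cox_gen_comp_self)
  assume r: "reduced_word n v (i # as)"
  then have as: "set as \<subseteq> {..<n}" "word_perm as = cox_gen i \<circ> v" "Suc (length as) = cox_length n v"
    unfolding reduced_word_iff[OF v] by (auto simp: cox_gen_comp_self)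
  have "ldesc i v"
  proof (rule ccontr)
    assume "\<not> ldesc i v"
    then have "ldesc i (cox_gen i \<circ> v)" using ldesc_cox_gen[OF v] by simp
    from cox_length_ldesc[OF w i this] have "cox_length n (cox_gen i \<circ> v) = Suc (cox_length n v)"
      by (simp add: cox_gen_comp_self)
    then show False using cox_length_le[OF as(1)] as by simp
  qed
  then show "ldesc i v \<and> reduced_word n (cox_gen i \<circ> v) as"
    using as cox_length_ldesc[OF v i] unfolding reduced_word_iff[OF w] by auto
qed

section \<open>The free algebra modulo the relations\<close>

abbreviation u_word :: "nat list \<Rightarrow> free_alg" where
  "u_word as \<equiv> prod_list (map u_gen as)"

lemma u_word_single: "u_word as = Poly_Mapping.single (Word as) 1"
  by (induction as) (auto simp: u_gen_def mult_single plus_word_def zero_word_def[symmetric])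

lemma free_alg_on_single: "set as \<subseteq> {..<n} \<Longrightarrow> Poly_Mapping.single (Word as) c \<in> free_alg_on n"
  by (auto simp: free_alg_on_def)

lemma free_alg_on_scalar: "scalar c \<in> free_alg_on n"
  unfolding scalar_def zero_word_def by (rule free_alg_on_single) simp

lemma free_alg_on_u_word: "set as \<subseteq> {..<n} \<Longrightarrow> u_word as \<in> free_alg_on n"
  unfolding u_word_single by (rule free_alg_on_single)

lemma free_alg_on_one: "1 \<in> free_alg_on n"
  using free_alg_on_u_word[of "[]"] by simp

lemma free_alg_on_add: "f \<in> free_alg_on n \<Longrightarrow> g \<in> free_alg_on n \<Longrightarrow> f + g \<in> free_alg_on n"
  using Poly_Mapping.keys_add[of f g] unfolding free_alg_on_def by blast

lemma free_alg_on_zero: "0 \<in> free_alg_on n"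
  by (simp add: free_alg_on_def)

lemma free_alg_on_sum: "(\<And>a. a \<in> A \<Longrightarrow> f a \<in> free_alg_on n) \<Longrightarrow> sum f A \<in> free_alg_on n"
  by (induction A rule: infinite_finite_induct) (auto intro: free_alg_on_add free_alg_on_zero)

lemma free_alg_on_minus: "f \<in> free_alg_on n \<Longrightarrow> - f \<in> free_alg_on n"
  by (simp add: free_alg_on_def)

lemma free_alg_on_mult:
  assumes "f \<in> free_alg_on n" "g \<in> free_alg_on n"
  shows "f * g \<in> free_alg_on n"
  unfolding free_alg_on_def
proof (rule CollectI, rule ballI)
  fix v assume "v \<in> Poly_Mapping.keys (f * g)"
  then obtain a b where "v = a + b" "a \<in> Poly_Mapping.keys f" "b \<in> Poly_Mapping.keys g"
    using Poly_Mapping.keys_mult[of f g] by blast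
  then show "set (letters v) \<subseteq> {..<n}"
    using assms unfolding free_alg_on_def by (auto simp: plus_word_def)
qed

lemma rel_ideal_left: "f \<in> rel_ideal n \<Longrightarrow> h \<in> free_alg_on n \<Longrightarrow> h * f \<in> rel_ideal n"
proof (induction rule: rel_ideal.induct)
  case (gen r f g)
  then have "(h * f) * r * g \<in> rel_ideal n" by (intro rel_ideal.gen free_alg_on_mult)
  then show ?case by (simp add: mult.assoc)
qed (auto simp: distrib_left intro: rel_ideal.zero rel_ideal.add)

lemma rel_ideal_uminus: "f \<in> rel_ideal n \<Longrightarrow> - f \<in> rel_ideal n"
  using rel_ideal_left[of f n "- 1"] free_alg_on_minus[OF free_alg_on_one] by simp

definition hcong :: "nat \<Rightarrow> free_alg \<Rightarrow> free_alg \<Rightarrow> bool" where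
  "hcong n f g \<longleftrightarrow> f - g \<in> rel_ideal n"

lemma hcong_refl [simp]: "hcong n f f"
  by (simp add: hcong_def rel_ideal.zero)

lemma hcong_sym: "hcong n f g \<Longrightarrow> hcong n g f"
  unfolding hcong_def using rel_ideal_uminus[of "f - g"] by simp

lemma hcong_trans: "hcong n f g \<Longrightarrow> hcong n g h \<Longrightarrow> hcong n f h"
  unfolding hcong_def using rel_ideal.add[of "f - g" n "g - h"] by simp

lemma hcong_mult_left: "hcong n f g \<Longrightarrow> h \<in> free_alg_on n \<Longrightarrow> hcong n (h * f) (h * g)"
  unfolding hcong_def using rel_ideal_left[of "f - g" n h] by (simp add: right_diff_distrib)

lemma hcong_Cons: "hcong n (u_word as) (u_word bs) \<Longrightarrow> i < n \<Longrightarrow> hcong n (u_word (i # as)) (u_word (i # bs))"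
  using hcong_mult_left[of n "u_word as" "u_word bs" "u_word [i]"] free_alg_on_u_word[of "[i]" n] by simp

lemma hcong_relator:
  assumes "r \<in> relators n" "r = f - g" "set cs \<subseteq> {..<n}"
  shows "hcong n (f * u_word cs) (g * u_word cs)"
proof -
  have "1 * r * u_word cs \<in> rel_ideal n"
    using assms by (intro rel_ideal.gen free_alg_on_one free_alg_on_u_word)
  then show ?thesis using assms(2) by (simp add: hcong_def left_diff_distrib)
qed

lemma hcong_square:
  assumes "i < n" "set cs \<subseteq> {..<n}"
  shows "hcong n (u_word (i # i # cs)) (scalar beta * u_word (i # cs))"
proof -
  have "u_gen i * u_gen i - scalar beta * u_gen i \<in> relators n" using assms by (auto simp: relators_def)
  from hcong_relator[OF this refl assms(2)] show ?thesis by (simp add: mult.assoc)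
qed

lemma hcong_commute:
  assumes "i + 1 < j" "j < n" "set cs \<subseteq> {..<n}"
  shows "hcong n (u_word (i # j # cs)) (u_word (j # i # cs))"
proof -
  have "u_gen i * u_gen j - u_gen j * u_gen i \<in> relators n"
    unfolding relators_def by (intro UnI2 CollectI exI[of _ i] exI[of _ j]) (use assms in auto)
  from hcong_relator[OF this refl assms(3)] show ?thesis by (simp add: mult.assoc)
qed

lemma hcong_braid:
  assumes "0 < i" "i + 1 < n" "set cs \<subseteq> {..<n}"
  shows "hcong n (u_word (i # (i + 1) # i # cs)) (u_word ((i + 1) # i # (i + 1) # cs))"
proof -
  have "u_gen i * u_gen (i + 1) * u_gen i - u_gen (i + 1) * u_gen i * u_gen (i + 1) \<in> relators n"
    unfolding relators_def using assms by blast
  from hcong_relator[OF this refl assms(3)] show ?thesis by (simp add: mult.assoc)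
qed

lemma hcong_four:
  assumes "1 < n" "set cs \<subseteq> {..<n}"
  shows "hcong n (u_word (1 # 0 # 1 # 0 # cs)) (u_word (0 # 1 # 0 # 1 # cs))"
proof -
  have "u_gen 1 * u_gen 0 * u_gen 1 * u_gen 0 - u_gen 0 * u_gen 1 * u_gen 0 * u_gen 1 \<in> relators n"
    using assms by (auto simp: relators_def)
  from hcong_relator[OF this refl assms(2)] show ?thesis by (simp add: mult.assoc)
qed

text \<open>Two left descents of \<open>v\<close> allow to split off the longest element of the dihedral
  parabolic subgroup they generate.\<close>

lemma two_ldesc_lt:
  assumes v: "v \<in> signed_perms n" and ij: "i < j" "j < n" and d: "ldesc i v" "ldesc j v"
  shows "\<exists>as bs. reduced_word n v (i # as) \<and> reduced_word n v (j # bs) \<and> hcong n (u_word (i # as)) (u_word (j # bs))"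
proof -
  have S: "cox_gen l \<circ> w \<in> signed_perms n" if "w \<in> signed_perms n" "l < n" for w l
    using that by (intro signed_perms_comp cox_gen_signed_perms)
  have i: "i < n" using ij by simp
  have red: "reduced_word n v (is @ cs)"
    if "reduced_word n v js'" "length js' = length (is @ cs)" "set (is @ cs) \<subseteq> {..<n}" "word_perm (is @ cs) = v" for "is" cs js'
    using that unfolding reduced_word_iff[OF v] by simp
  \<comment> \<open>The product of the two generators has order 2, 3 or 4, matching the three
    relations between different generators.\<close>
  consider "i + 1 < j" | "j = i + 1" "0 < i" | "j = 1" "i = 0" using ij by linarith
  then show ?thesis
  proof cases
    case 1
    have d2: "ldesc j (cox_gen i \<circ> v)"
      using d 1 unfolding ldesc_def inv_cox_gen_comp[OF v]
      by (cases "i = 0") (auto simp: cox_gen_zero_apply cox_gen_pos_apply)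
    let ?y = "cox_gen j \<circ> (cox_gen i \<circ> v)"
    have y: "?y \<in> signed_perms n" using v i ij by (intro S)
    obtain cs where cs: "reduced_word n ?y cs" using reduced_word_exists[OF y] by auto
    have csn: "set cs \<subseteq> {..<n}" and csp: "word_perm cs = ?y" using cs unfolding reduced_word_iff[OF y] by auto
    have r1: "reduced_word n v (i # j # cs)"
      by (intro reduced_word_Cons(1)) (use v i ij d d2 cs S in auto)
    have "word_perm ([j, i] @ cs) = v"
    proof -
      have "word_perm ([j, i] @ cs) = (cox_gen j \<circ> cox_gen i) \<circ> ?y" by (simp add: csp o_assoc)
      also have "\<dots> = (cox_gen i \<circ> cox_gen j) \<circ> ?y" by (simp only: cox_gen_commute[OF 1])
      also have "\<dots> = v" by (simp only: o_assoc[symmetric] cox_gen_comp_self)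
      finally show ?thesis .
    qed
    then have "reduced_word n v (j # i # cs)" using red[OF r1, of "[j, i]" cs] csn ij by simp
    then show ?thesis using r1 hcong_commute[OF 1 ij(2) csn] by blast
  next
    case 2
    have d': "pinv v (int i) > pinv v (int i + 1)" "pinv v (int i + 1) > pinv v (int i + 2)"
    proof -
      have e: "int j + 1 = int i + 2" "int j = int i + 1" using 2 by auto
      show "pinv v (int i) > pinv v (int i + 1)" using d 2 by (simp add: ldesc_def)
      have "pinv v (int j) > pinv v (int j + 1)" using d(2) ij by (simp add: ldesc_def)
      then show "pinv v (int i + 1) > pinv v (int i + 2)" unfolding e(1) unfolding e(2) .
    qed
    let ?v1 = "cox_gen i \<circ> v" let ?v2 = "cox_gen j \<circ> ?v1" let ?y = "cox_gen i \<circ> ?v2"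
    have v1: "?v1 \<in> signed_perms n" and v2: "?v2 \<in> signed_perms n" and y: "?y \<in> signed_perms n"
      using v i ij by (auto intro!: S)
    have ci: "cox_gen i (int i) = int i + 1" "cox_gen i (int i + 1) = int i" "cox_gen i (int i + 2) = int i + 2"
      and cj: "cox_gen j (int i) = int i" "cox_gen j (int i + 1) = int i + 2"
      using 2 by (simp_all add: cox_gen_pos_apply)
    have e: "int j + 1 = int i + 2" "int j = int i + 1" using 2 by auto
    have "ldesc j ?v1 \<longleftrightarrow> pinv v (cox_gen i (int j)) > pinv v (cox_gen i (int j + 1))"
      using 2 by (simp add: ldesc_def inv_cox_gen_comp[OF v])
    then have d2: "ldesc j ?v1" unfolding e(1) unfolding e(2) ci using d' by simp
    have "ldesc i ?v2 \<longleftrightarrow> pinv v (cox_gen i (cox_gen j (int i))) > pinv v (cox_gen i (cox_gen j (int i + 1)))"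
      using 2 by (simp add: ldesc_def inv_cox_gen_comp[OF v1] inv_cox_gen_comp[OF v])
    then have d3: "ldesc i ?v2" unfolding cj ci using d' by simp
    obtain cs where cs: "reduced_word n ?y cs" using reduced_word_exists[OF y] by auto
    have csn: "set cs \<subseteq> {..<n}" and csp: "word_perm cs = ?y" using cs unfolding reduced_word_iff[OF y] by auto
    have r1: "reduced_word n v (i # j # i # cs)"
      by (intro reduced_word_Cons(1)) (use v v1 v2 i ij d d2 d3 cs in auto)
    have "word_perm ([j, i, j] @ cs) = v"
    proof -
      have "word_perm ([j, i, j] @ cs) = (cox_gen j \<circ> (cox_gen i \<circ> cox_gen j)) \<circ> ?y" by (simp add: csp o_assoc)
      also have "\<dots> = (cox_gen i \<circ> (cox_gen j \<circ> cox_gen i)) \<circ> ?y" using cox_gen_braid[OF 2(2)] 2(1) by simp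
      also have "\<dots> = v" by (simp only: o_assoc[symmetric] cox_gen_comp_self)
      finally show ?thesis .
    qed
    then have "reduced_word n v (j # i # j # cs)" using red[OF r1, of "[j, i, j]" cs] csn ij by simp
    then show ?thesis using r1 hcong_braid[OF 2(2) _ csn] 2(1) ij by blast
  next
    case 3
    have d': "pinv v 1 < 0" "pinv v 1 > pinv v 2" using d 3 by (auto simp: ldesc_def)
    let ?v1 = "cox_gen 0 \<circ> v" let ?v2 = "cox_gen 1 \<circ> ?v1" let ?v3 = "cox_gen 0 \<circ> ?v2" let ?y = "cox_gen 1 \<circ> ?v3"
    have n: "0 < n" "1 < n" using 3 ij by auto
    have v1: "?v1 \<in> signed_perms n" and v2: "?v2 \<in> signed_perms n" and v3: "?v3 \<in> signed_perms n" and y: "?y \<in> signed_perms n"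
      using v n by (auto intro!: S)
    have odd: "pinv v (- 1) = - pinv v 1" "pinv v (- 2) = - pinv v 2" using signed_perms_inv_odd[OF v] by auto
    have d2: "ldesc 1 ?v1" using d' odd unfolding ldesc_def inv_cox_gen_comp[OF v]
      by (simp add: cox_gen_pos_apply cox_gen_zero_apply)
    have d3: "ldesc 0 ?v2" using d' odd unfolding ldesc_def inv_cox_gen_comp[OF v1] inv_cox_gen_comp[OF v]
      by (simp add: cox_gen_pos_apply cox_gen_zero_apply)
    have d4: "ldesc 1 ?v3"
      using d' odd unfolding ldesc_def inv_cox_gen_comp[OF v2] inv_cox_gen_comp[OF v1] inv_cox_gen_comp[OF v]
      by (simp add: cox_gen_pos_apply cox_gen_zero_apply)
    obtain cs where cs: "reduced_word n ?y cs" using reduced_word_exists[OF y] by auto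
    have csn: "set cs \<subseteq> {..<n}" and csp: "word_perm cs = ?y" using cs unfolding reduced_word_iff[OF y] by auto
    have d1: "ldesc 0 v" using d 3 by simp
    have r1: "reduced_word n v (0 # 1 # 0 # 1 # cs)"
      by (rule reduced_word_Cons(1)[OF v n(1) d1 reduced_word_Cons(1)[OF v1 n(2) d2
          reduced_word_Cons(1)[OF v2 n(1) d3 reduced_word_Cons(1)[OF v3 n(2) d4 cs]]]])
    have "word_perm ([1, 0, 1, 0] @ cs) = v"
    proof -
      have "word_perm ([1, 0, 1, 0] @ cs) = (cox_gen 1 \<circ> (cox_gen 0 \<circ> (cox_gen 1 \<circ> cox_gen 0))) \<circ> ?y"
        by (simp add: csp o_assoc)
      also have "\<dots> = (cox_gen 0 \<circ> (cox_gen 1 \<circ> (cox_gen 0 \<circ> cox_gen 1))) \<circ> ?y" by (simp only: cox_gen_four)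
      also have "\<dots> = v" by (simp only: o_assoc[symmetric] cox_gen_comp_self)
      finally show ?thesis .
    qed
    then have r2: "reduced_word n v (1 # 0 # 1 # 0 # cs)" using red[OF r1, of "[1, 0, 1, 0]" cs] csn n by simp
    have "reduced_word n v (i # 1 # 0 # 1 # cs)" "reduced_word n v (j # 0 # 1 # 0 # cs)"
      "hcong n (u_word (i # 1 # 0 # 1 # cs)) (u_word (j # 0 # 1 # 0 # cs))"
      using r1 r2 hcong_sym[OF hcong_four[OF n(2) csn]] 3 by auto
    then show ?thesis by blast
  qed
qed

lemma two_ldesc:
  assumes "v \<in> signed_perms n" "i \<noteq> j" "i < n" "j < n" "ldesc i v" "ldesc j v"
  shows "\<exists>as bs. reduced_word n v (i # as) \<and> reduced_word n v (j # bs) \<and> hcong n (u_word (i # as)) (u_word (j # bs))"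
proof (cases "i < j")
  case True
  then show ?thesis using two_ldesc_lt[of v n i j] assms by simp
next
  case False
  then have "j < i" using assms(2) by simp
  then obtain bs as where "reduced_word n v (j # bs)" "reduced_word n v (i # as)" "hcong n (u_word (j # bs)) (u_word (i # as))"
    using two_ldesc_lt[of v n j i] assms by blast
  then show ?thesis using hcong_sym by blast
qed

text \<open>Induction on the length. If the first letters agree, the tails are reduced words of one
  shorter element. If they differ, both are left descents, and \<open>two_ldesc\<close> supplies two
  congruent reduced words with these first letters; each given word is congruent to the one that
  shares its first letter.\<close>

lemma matsumoto:
  "v \<in> signed_perms n \<Longrightarrow> reduced_word n v as \<Longrightarrow> reduced_word n v bs \<Longrightarrow> hcong n (u_word as) (u_word bs)"
proof (induction "length as" arbitrary: v as bs)
  case 0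
  then have "length bs = 0" using reduced_word_iff[OF 0(2)] by metis
  then show ?case using 0 by simp
next
  case (Suc m)
  note v = Suc.prems(1)
  obtain i as' j bs' where as: "as = i # as'" and bs: "bs = j # bs'"
    using Suc.prems Suc.hyps(2) reduced_word_iff[OF v] by (metis length_Suc_conv)
  have ij: "i < n" "j < n" using Suc.prems as bs reduced_word_iff[OF v] by auto
  have tail: "hcong n (u_word (l # cs)) (u_word (l # ds))"
    if "reduced_word n v (l # cs)" "reduced_word n v (l # ds)" for l cs ds
  proof -
    have l: "l < n" using that(1) reduced_word_iff[OF v] by auto
    have "cox_gen l \<circ> v \<in> signed_perms n" using v l by (intro signed_perms_comp cox_gen_signed_perms)
    moreover have "reduced_word n (cox_gen l \<circ> v) cs" "reduced_word n (cox_gen l \<circ> v) ds"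
      using reduced_word_Cons(2)[OF v l] that by auto
    moreover have "m = length cs" using that(1) Suc.prems(2) Suc.hyps(2) unfolding reduced_word_iff[OF v] by simp
    ultimately show ?thesis using Suc.hyps(1) l by (intro hcong_Cons) auto
  qed
  show ?case
  proof (cases "i = j")
    case True
    then show ?thesis using tail Suc.prems unfolding as bs by simp
  next
    case False
    have "ldesc i v" "ldesc j v" using reduced_word_Cons(2)[OF v] Suc.prems as bs ij by auto
    then obtain cs ds where "reduced_word n v (i # cs)" "reduced_word n v (j # ds)" "hcong n (u_word (i # cs)) (u_word (j # ds))"
      using two_ldesc[OF v False ij] by blast
    then show ?thesis using tail Suc.prems hcong_trans unfolding as bs by meson
  qed
qed

lemma u_perm_reduced:
  assumes "v \<in> signed_perms n" "reduced_word n v as"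
  shows "hcong n (u_word as) (u_perm n v)"
  unfolding u_perm_def by (rule matsumoto[OF assms]) (rule someI[of "reduced_word n v", OF assms(2)])

lemma scalar_mult_single: "scalar c * Poly_Mapping.single w d = Poly_Mapping.single w (c * d)"
  by (simp add: scalar_def mult_single)

lemma scalar_mult: "scalar c * scalar d = scalar (c * d)"
  by (simp add: scalar_def mult_single)

lemma u_gen_scalar: "u_gen i * (scalar c * u_word as) = scalar c * u_word (i # as)"
  by (simp add: u_word_single u_gen_def scalar_mult_single mult_single plus_word_def)

text \<open>Multiplying \<open>u_v\<close> by \<open>u_i\<close> from the left gives
  \<open>u\<close> of \<open>s_i v\<close> if \<open>i\<close> is not a left descent. If it is,
  \<open>v\<close> has a reduced word starting with \<open>i\<close>, and the quadratic relation
  turns the product into \<open>\<beta> u_v\<close>.\<close>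

lemma u_word_spanned:
  "set as \<subseteq> {..<n} \<Longrightarrow> \<exists>c v. v \<in> signed_perms n \<and> hcong n (u_word as) (scalar c * u_perm n v)"
proof (induction as)
  case Nil
  have "reduced_word n id []" by (simp add: reduced_word_def)
  note u_perm_reduced[OF id_signed_perms this]
  moreover have "scalar 1 * u_perm n id = u_perm n id" by (simp add: scalar_def)
  ultimately show ?case using id_signed_perms by metis
next
  case (Cons i as)
  then obtain c v where v: "v \<in> signed_perms n" and cv: "hcong n (u_word as) (scalar c * u_perm n v)" by auto
  have i: "i < n" using Cons.prems by simp
  obtain R where R: "reduced_word n v R" "u_perm n v = u_word R"
    using reduced_word_exists[OF v] unfolding u_perm_def by (metis someI_ex)
  have ui: "u_gen i \<in> free_alg_on n" using free_alg_on_u_word[of "[i]" n] i by simp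
  have 1: "hcong n (u_word (i # as)) (scalar c * u_word (i # R))"
    using hcong_mult_left[OF cv ui] unfolding R(2) u_gen_scalar by simp
  show ?case
  proof (cases "ldesc i v")
    case True
    have w: "cox_gen i \<circ> v \<in> signed_perms n" using v i by (intro signed_perms_comp cox_gen_signed_perms)
    obtain cs where cs: "reduced_word n (cox_gen i \<circ> v) cs" using reduced_word_exists[OF w] by auto
    have r: "reduced_word n v (i # cs)" by (rule reduced_word_Cons(1)[OF v i True cs])
    have csn: "set cs \<subseteq> {..<n}" using cs by (simp add: reduced_word_def)
    have "hcong n (u_word (i # R)) (u_word (i # i # cs))"
      by (rule hcong_Cons[OF matsumoto[OF v R(1) r] i])
    also note hcong_square[OF i csn]
    finally (hcong_trans) have "hcong n (u_word (i # R)) (scalar beta * u_word (i # cs))" .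
    moreover have "hcong n (scalar beta * u_word (i # cs)) (scalar beta * u_perm n v)"
      by (rule hcong_mult_left[OF u_perm_reduced[OF v r] free_alg_on_scalar])
    ultimately have "hcong n (u_word (i # R)) (scalar beta * u_perm n v)" by (rule hcong_trans)
    from hcong_mult_left[OF this free_alg_on_scalar, of c] have "hcong n (u_word (i # as)) (scalar (c * beta) * u_perm n v)"
      using hcong_trans[OF 1] by (simp add: mult.assoc[symmetric] scalar_mult)
    then show ?thesis using v by blast
  next
    case False
    have w: "cox_gen i \<circ> v \<in> signed_perms n" using v i by (intro signed_perms_comp cox_gen_signed_perms)
    have "reduced_word n (cox_gen i \<circ> v) (i # R)"
      by (rule reduced_word_Cons(1)[OF w i]) (use ldesc_cox_gen[OF v] False R(1) in \<open>auto simp: cox_gen_comp_self\<close>)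
    from u_perm_reduced[OF w this] have "hcong n (scalar c * u_word (i # R)) (scalar c * u_perm n (cox_gen i \<circ> v))"
      by (rule hcong_mult_left[OF _ free_alg_on_scalar])
    then show ?thesis using w hcong_trans[OF 1] by blast
  qed
qed

lemma poly_mapping_sum_singles: "f = (\<Sum>w\<in>Poly_Mapping.keys f. Poly_Mapping.single w (Poly_Mapping.lookup f w))"
  by (rule poly_mapping_eqI) (auto simp: lookup_sum lookup_single when_def in_keys_iff)

lemma scalar_add: "scalar (c + d) = scalar c + scalar d"
  by (simp add: scalar_def single_add)

lemma free_alg_spanned:
  assumes "f \<in> free_alg_on n"
  shows "\<exists>h. f - (\<Sum>v\<in>signed_perms n. scalar (h v) * u_perm n v) \<in> rel_ideal n"
proof -
  define P where "P f \<longleftrightarrow> (\<exists>h. hcong n f (\<Sum>v\<in>signed_perms n. scalar (h v) * u_perm n v))" for f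
  have add: "P (f + g)" if "P f" "P g" for f g
  proof -
    from that obtain h k where hk: "hcong n f (\<Sum>v\<in>signed_perms n. scalar (h v) * u_perm n v)"
      "hcong n g (\<Sum>v\<in>signed_perms n. scalar (k v) * u_perm n v)" by (auto simp: P_def)
    have "hcong n (f + g) (\<Sum>v\<in>signed_perms n. scalar (h v + k v) * u_perm n v)"
      using rel_ideal.add[OF hk[unfolded hcong_def]]
      by (simp add: hcong_def scalar_add distrib_right sum.distrib algebra_simps)
    then show ?thesis unfolding P_def by (rule exI[of _ "\<lambda>v. h v + k v"])
  qed
  have zero: "P 0"
    unfolding P_def by (rule exI[of _ "\<lambda>_. 0"]) (simp add: scalar_def)
  have single: "P (Poly_Mapping.single w c)" if w: "set (letters w) \<subseteq> {..<n}" for w c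
  proof -
    obtain d v where v: "v \<in> signed_perms n" "hcong n (u_word (letters w)) (scalar d * u_perm n v)"
      using u_word_spanned[OF w] by blast
    have "hcong n (Poly_Mapping.single w c) (scalar (c * d) * u_perm n v)"
      using hcong_mult_left[OF v(2) free_alg_on_scalar, of c]
      by (simp add: u_word_single scalar_mult_single mult.assoc[symmetric] scalar_mult)
    moreover have "(\<Sum>u\<in>signed_perms n. scalar (if u = v then c * d else 0) * u_perm n u) = scalar (c * d) * u_perm n v"
    proof -
      have "(\<Sum>u\<in>signed_perms n. scalar (if u = v then c * d else 0) * u_perm n u)
        = (\<Sum>u\<in>signed_perms n. if u = v then scalar (c * d) * u_perm n v else 0)"
        by (rule sum.cong) (auto simp: scalar_def)
      then show ?thesis using v(1) by simp
    qed
    ultimately show ?thesis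
      unfolding P_def by (intro exI[of _ "\<lambda>u. if u = v then c * d else 0"]) (simp only:)
  qed
  have "P (\<Sum>w\<in>A. Poly_Mapping.single w (Poly_Mapping.lookup f w))" if "finite A" "A \<subseteq> Poly_Mapping.keys f" for A
    using that
  proof (induction A rule: finite_induct)
    case (insert w A)
    then have "set (letters w) \<subseteq> {..<n}" using assms by (auto simp: free_alg_on_def)
    then show ?case using insert by (auto intro!: add single)
  qed (simp add: zero)
  from this[OF finite_keys order_refl] have "P f" unfolding poly_mapping_sum_singles[symmetric] .
  then show ?thesis unfolding P_def hcong_def .
qed

section \<open>Evaluation at real \<open>\<beta>\<close> and extraction of a coefficient\<close>

definition ev :: "real \<Rightarrow> int poly \<Rightarrow> real" where
  "ev b c = poly (map_poly real_of_int c) b"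

lemma ev_pCons [simp]: "ev b (pCons a p) = of_int a + b * ev b p"
  by (simp add: ev_def map_poly_pCons)

lemma ev_zero [simp]: "ev b 0 = 0" and ev_one [simp]: "ev b 1 = 1" and ev_beta [simp]: "ev b beta = b"
  by (simp_all add: ev_def beta_def map_poly_pCons)

lemma ev_add: "ev b (c + d) = ev b c + ev b d"
proof -
  have "map_poly real_of_int (c + d) = map_poly real_of_int c + map_poly real_of_int d"
    by (rule poly_eqI) (simp add: coeff_map_poly)
  then show ?thesis by (simp add: ev_def)
qed

lemma ev_smult: "ev b (Polynomial.smult a c) = of_int a * ev b c"
  by (induction c) (auto simp: algebra_simps)

lemma ev_mult: "ev b (c * d) = ev b c * ev b d"
  by (induction c) (auto simp: ev_add ev_smult algebra_simps)

lemma ev_eqI: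
  assumes "\<And>b. b > 0 \<Longrightarrow> ev b c = ev b d"
  shows "c = d"
proof -
  let ?p = "map_poly real_of_int c - map_poly real_of_int d"
  have "{0<..} \<subseteq> {b. poly ?p b = 0}" using assms by (auto simp: ev_def)
  then have "infinite {b. poly ?p b = 0}" using infinite_Ioi[of "0 :: real"] finite_subset by blast
  then have "?p = 0" using poly_roots_finite by blast
  then have eq: "map_poly real_of_int c = map_poly real_of_int d" by simp
  show ?thesis
  proof (rule poly_eqI)
    fix k
    have "coeff (map_poly real_of_int c) k = coeff (map_poly real_of_int d) k" by (simp only: eq)
    then show "coeff c k = coeff d k" by (simp add: coeff_map_poly)
  qed
qed

text \<open>Since \<open>\<phi> b\<close> kills the ideal and picks out \<open>u_w\<close> from the
  spanning family, every expansion of \<open>f\<close> has the same value of its coefficient at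
  \<open>w\<close> for each \<open>b > 0\<close>. Polynomials with equal values at all positive
  reals coincide, so the definite description in \<open>u_coeff\<close> has exactly one
  candidate.\<close>

theorem u_coeff_eval:
  assumes \<phi>_add: "\<And>b f g. \<phi> b (f + g) = \<phi> b f + \<phi> b g"
    and \<phi>_scalar: "\<And>b c f. \<phi> b (scalar c * f) = ev b c * \<phi> b f"
    and \<phi>_ideal: "\<And>b f. b > 0 \<Longrightarrow> f \<in> rel_ideal n \<Longrightarrow> \<phi> b f = 0"
    and \<phi>_perm: "\<And>b v. b > 0 \<Longrightarrow> v \<in> signed_perms n \<Longrightarrow> \<phi> b (u_perm n v) = (if v = w then 1 else 0)"
    and w: "w \<in> signed_perms n" and f: "f \<in> free_alg_on n" and b: "b > 0"
  shows "ev b (u_coeff n w f) = \<phi> b f"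
proof -
  have eval: "ev b (h w) = \<phi> b f"
    if "f - (\<Sum>v\<in>signed_perms n. scalar (h v) * u_perm n v) \<in> rel_ideal n" "b > 0" for h b
  proof -
    have z: "\<phi> b 0 = 0" using \<phi>_add[of b 0 0] by simp
    have s: "\<phi> b (sum g A) = (\<Sum>a\<in>A. \<phi> b (g a))" for g and A :: "(int \<Rightarrow> int) set"
      by (induction A rule: infinite_finite_induct) (auto simp: z \<phi>_add)
    let ?S = "\<Sum>v\<in>signed_perms n. scalar (h v) * u_perm n v"
    have "\<phi> b f = \<phi> b ((f - ?S) + ?S)" by simp
    also have "\<dots> = \<phi> b ?S" by (simp only: \<phi>_add[of b "f - ?S" ?S] \<phi>_ideal[OF that(2,1)] add_0)
    also have "\<dots> = (\<Sum>v\<in>signed_perms n. if v = w then ev b (h v) else 0)"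
      unfolding s by (rule sum.cong) (auto simp: \<phi>_scalar \<phi>_perm[OF that(2)])
    also have "\<dots> = ev b (h w)" using w by simp
    finally show ?thesis by simp
  qed
  let ?P = "\<lambda>c. \<exists>h. h w = c \<and> f - (\<Sum>v\<in>signed_perms n. scalar (h v) * u_perm n v) \<in> rel_ideal n"
  obtain h where h: "f - (\<Sum>v\<in>signed_perms n. scalar (h v) * u_perm n v) \<in> rel_ideal n"
    using free_alg_spanned[OF f] by blast
  have "u_coeff n w f = h w"
    unfolding u_coeff_def
  proof (rule the_equality)
    show "?P (h w)" using h by blast
    fix c assume "?P c"
    then obtain k where k: "k w = c" "f - (\<Sum>v\<in>signed_perms n. scalar (k v) * u_perm n v) \<in> rel_ideal n" by blast
    show "c = h w" by (rule ev_eqI) (use eval[OF h] eval[OF k(2)] k(1) in simp)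
  qed
  then show ?thesis using eval[OF h b] by simp
qed

section \<open>Tableaux with bounded entries\<close>

lemma mem_shifted_diagram:
  "(i, j) \<in> shifted_diagram la \<longleftrightarrow> 1 \<le> i \<and> i \<le> length la \<and> i \<le> j \<and> j < la ! (i - 1) + i"
  by (auto simp: shifted_diagram_def)

lemma finite_shifted_diagram [simp]: "finite (shifted_diagram la)"
proof -
  have "shifted_diagram la \<subseteq> (SIGMA i:{1..length la}. {i..<la ! (i - 1) + i})"
    by (auto simp: mem_shifted_diagram)
  then show ?thesis by (rule finite_subset) auto
qed

lemma card_shifted_diagram: "card (shifted_diagram la) = sum_list la"
proof -
  have "shifted_diagram la = (SIGMA i:{1..length la}. {i..<la ! (i - 1) + i})"
    by (auto simp: mem_shifted_diagram)
  then have "card (shifted_diagram la) = (\<Sum>i\<in>{1..length la}. la ! (i - 1))" by simp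
  also have "\<dots> = (\<Sum>i\<in>{0..<length la}. la ! i)"
    by (rule sum.reindex_bij_witness[where i = Suc and j = "\<lambda>i. i - 1"]) auto
  finally show ?thesis by (simp add: sum_list_sum_nth)
qed

lemma strict_part_unique:
  assumes "strict_partition la" "i < length la" "k < length la" "la ! i = la ! k"
  shows "i = k"
proof -
  have "sorted_wrt (>) la" using assms(1) by (simp add: strict_partition_def)
  from sorted_wrt_nth_less[OF this, of i k] sorted_wrt_nth_less[OF this, of k i] show ?thesis
    using assms(2-4) by (metis less_irrefl linorder_neqE_nat)
qed

text \<open>Lowering \<open>j + 1\<close> removes the last cell of its row, which lies on diagonal
  \<open>j\<close>. For \<open>j = 0\<close> the row is the last one and the list becomes shorter,
  hence the separate case.\<close>

lemma shifted_diagram_lower: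
  assumes la: "strict_partition la" and i: "i < length la" "la ! i = Suc j" and j: "j \<notin> set la"
  shows "shifted_diagram (lower j la) = shifted_diagram la - {(Suc i, Suc i + j)}"
proof (cases "j = 0")
  case False
  have nth: "lower j la ! k = (if k = i then j else la ! k)" if "k < length la" for k
  proof (cases "k = i")
    case False
    then have "la ! k \<noteq> Suc j" using strict_part_unique[OF la that i(1)] i(2) by metis
    then show ?thesis using False \<open>j \<noteq> 0\<close> that by (simp add: lower_def)
  qed (use \<open>j \<noteq> 0\<close> i in \<open>simp add: lower_def\<close>)
  have len: "length (lower j la) = length la" using False by (simp add: lower_def)
  show ?thesis
  proof (rule Set.set_eqI)
    fix c :: "nat \<times> nat" obtain a k where c: "c = (a, k)" by (cases c)
    show "c \<in> shifted_diagram (lower j la) \<longleftrightarrow> c \<in> shifted_diagram la - {(Suc i, Suc i + j)}"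
    proof (cases "a = Suc i")
      case True
      then show ?thesis using i nth[OF i(1)] by (auto simp: c mem_shifted_diagram len)
    next
      case False
      then have "lower j la ! (a - 1) = la ! (a - 1)" if "1 \<le> a" "a \<le> length la"
        using nth[of "a - 1"] that by auto
      then show ?thesis using False by (auto simp: c mem_shifted_diagram len)
    qed
  qed
next
  case True
  have gt: "la ! k > 1" if "k < i" for k
    using sorted_wrt_nth_less[of "(>)" la k i] la i that True by (auto simp: strict_partition_def)
  have last: "Suc i = length la"
  proof (rule ccontr)
    assume "Suc i \<noteq> length la"
    then have *: "Suc i < length la" using i by simp
    then have "la ! Suc i < 1" using sorted_wrt_nth_less[of "(>)" la i "Suc i"] la i True by (auto simp: strict_partition_def)
    then show False using la * nth_mem[OF *] by (auto simp: strict_partition_def)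
  qed
  have la_eq: "la = take i la @ [1]" using last i True by (metis One_nat_def lessI take_Suc_conv_app_nth take_all order_refl)
  have filt: "filter (\<lambda>p. p \<noteq> 1) (take i la) = take i la"
  proof (rule filter_True, rule ballI)
    fix x assume "x \<in> set (take i la)"
    then obtain k where "k < i" "x = la ! k" by (auto simp: in_set_conv_nth)
    then show "x \<noteq> 1" using gt[of k] by simp
  qed
  have "lower j la = filter (\<lambda>p. p \<noteq> 1) la" using True by (simp add: lower_def)
  also have "\<dots> = filter (\<lambda>p. p \<noteq> 1) (take i la @ [1])" by (rule arg_cong[OF la_eq])
  also have "\<dots> = take i la" by (simp only: filter_append filt) simp
  finally have low: "lower j la = take i la" .
  show ?thesis
  proof (rule Set.set_eqI)
    fix c :: "nat \<times> nat" obtain a k where c: "c = (a, k)" by (cases c)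
    show "c \<in> shifted_diagram (lower j la) \<longleftrightarrow> c \<in> shifted_diagram la - {(Suc i, Suc i + j)}"
    proof (cases "a = Suc i")
      case True
      then show ?thesis unfolding low using i \<open>j = 0\<close> by (auto simp: c mem_shifted_diagram)
    next
      case False
      then have "a \<le> i \<longleftrightarrow> a \<le> length la" using last by auto
      moreover have "take i la ! (a - 1) = la ! (a - 1)" if "1 \<le> a" "a \<le> i" using that by simp
      ultimately show ?thesis unfolding low using False i(1) by (auto simp: c mem_shifted_diagram)
    qed
  qed
qed

section \<open>The ordered alphabet and entrywise tableau conditions\<close>

lemma prec_rank_inj: "s \<noteq> 0 \<Longrightarrow> s' \<noteq> 0 \<Longrightarrow> prec_rank s = prec_rank s' \<Longrightarrow> s = s'"
  unfolding prec_rank_def by (auto split: if_splits) presburger+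

lemma prec_rank_pos: "s \<noteq> 0 \<Longrightarrow> 0 < prec_rank s"
  by (auto simp: prec_rank_def)

lemma prec_max_finite:
  assumes "finite S" "S \<noteq> {}"
  shows "prec_max S \<in> S" "s \<in> S \<Longrightarrow> prec_rank s \<le> prec_rank (prec_max S)"
proof -
  have "Max (prec_rank ` S) \<in> prec_rank ` S" using assms by (intro Max_in) auto
  then obtain m where m: "Max (prec_rank ` S) = prec_rank m" "m \<in> S" by (rule imageE)
  have "is_arg_max prec_rank (\<lambda>x. x \<in> S) m"
    using m(2) assms unfolding is_arg_max_linorder m(1)[symmetric] by auto
  then have "is_arg_max prec_rank (\<lambda>x. x \<in> S) (prec_max S)"
    unfolding prec_max_def arg_max_on_def arg_max_def by (rule someI)
  then show "prec_max S \<in> S" "s \<in> S \<Longrightarrow> prec_rank s \<le> prec_rank (prec_max S)"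
    by (auto simp: is_arg_max_linorder)
qed

lemma prec_min_finite:
  assumes "finite S" "S \<noteq> {}"
  shows "prec_min S \<in> S" "s \<in> S \<Longrightarrow> prec_rank (prec_min S) \<le> prec_rank s"
  using arg_min_if_finite[OF assms, of prec_rank] unfolding prec_min_def by (auto simp: not_less)

definition row_rel :: "int \<Rightarrow> int \<Rightarrow> bool" where
  "row_rel s s' \<longleftrightarrow> prec_rank s < prec_rank s' \<or> s = s' \<and> s > 0"

definition col_rel :: "int \<Rightarrow> int \<Rightarrow> bool" where
  "col_rel s s' \<longleftrightarrow> prec_rank s < prec_rank s' \<or> s = s' \<and> s < 0"

text \<open>Conditions on all pairs of entries are inherited by subsets, which makes it possible to
  delete a single entry from a tableau.\<close>

lemma prec_max_min_iff:
  assumes S: "finite S" "S \<noteq> {}" "0 \<notin> S" and S': "finite S'" "S' \<noteq> {}" "0 \<notin> S'"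
  shows "(let x = prec_max S; y = prec_min S' in prec_rank x < prec_rank y \<or> x = y \<and> Q x)
    \<longleftrightarrow> (\<forall>s\<in>S. \<forall>s'\<in>S'. prec_rank s < prec_rank s' \<or> s = s' \<and> Q s)" (is "?l \<longleftrightarrow> ?r")
proof
  assume l: ?l
  show ?r
  proof (intro ballI)
    fix s s' assume s: "s \<in> S" "s' \<in> S'"
    have le: "prec_rank s \<le> prec_rank (prec_max S)" "prec_rank (prec_min S') \<le> prec_rank s'"
      using prec_max_finite(2)[OF S(1,2)] prec_min_finite(2)[OF S'(1,2)] s by auto
    show "prec_rank s < prec_rank s' \<or> s = s' \<and> Q s"
    proof (cases "prec_rank s < prec_rank s'")
      case False
      then have "prec_rank s = prec_rank s'" "prec_rank s = prec_rank (prec_max S)" "prec_max S = prec_min S'" "Q (prec_max S)"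
        using l le by (auto simp: Let_def)
      moreover have "prec_max S \<noteq> 0" "s \<noteq> 0" "s' \<noteq> 0" using prec_max_finite(1)[OF S(1,2)] S S' s by metis+
      ultimately show ?thesis using prec_rank_inj by metis
    qed simp
  qed
next
  assume ?r
  then show ?l using prec_max_finite(1)[OF S(1,2)] prec_min_finite(1)[OF S'(1,2)] by (simp add: Let_def)
qed

lemma shifted_svt_iff:
  "T \<in> shifted_svt la \<longleftrightarrow>
     (\<forall>c. c \<notin> shifted_diagram la \<longrightarrow> T c = {}) \<and>
     (\<forall>c\<in>shifted_diagram la. finite (T c) \<and> T c \<noteq> {} \<and> 0 \<notin> T c) \<and>
     (\<forall>i j. (i, j) \<in> shifted_diagram la \<and> (i + 1, j) \<in> shifted_diagram la \<longrightarrow>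
        (\<forall>s\<in>T (i, j). \<forall>s'\<in>T (i + 1, j). col_rel s s')) \<and>
     (\<forall>i j. (i, j) \<in> shifted_diagram la \<and> (i, j + 1) \<in> shifted_diagram la \<longrightarrow>
        (\<forall>s\<in>T (i, j). \<forall>s'\<in>T (i, j + 1). row_rel s s'))"
proof (cases "\<forall>c\<in>shifted_diagram la. finite (T c) \<and> T c \<noteq> {} \<and> 0 \<notin> T c")
  case True
  have "(let x = prec_max (T c); y = prec_min (T d) in prec_rank x < prec_rank y \<or> x = y \<and> Q x)
    \<longleftrightarrow> (\<forall>s\<in>T c. \<forall>s'\<in>T d. prec_rank s < prec_rank s' \<or> s = s' \<and> Q s)"
    if "c \<in> shifted_diagram la" "d \<in> shifted_diagram la" for c d Q
    by (rule prec_max_min_iff) (use True that in auto)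
  from this[where Q = "\<lambda>x. x < 0"] this[where Q = "\<lambda>x. x > 0"]
  show ?thesis using True unfolding shifted_svt_def row_rel_def col_rel_def by auto
qed (auto simp: shifted_svt_def)

lemma shifted_svtD:
  assumes "T \<in> shifted_svt la"
  shows "c \<notin> shifted_diagram la \<Longrightarrow> T c = {}"
    and "c \<in> shifted_diagram la \<Longrightarrow> finite (T c)" "c \<in> shifted_diagram la \<Longrightarrow> T c \<noteq> {}"
    and "0 \<notin> T c"
    and "(i, k) \<in> shifted_diagram la \<Longrightarrow> (i + 1, k) \<in> shifted_diagram la \<Longrightarrow> s \<in> T (i, k) \<Longrightarrow> s' \<in> T (i + 1, k) \<Longrightarrow> col_rel s s'"
    and "(i, k) \<in> shifted_diagram la \<Longrightarrow> (i, k + 1) \<in> shifted_diagram la \<Longrightarrow> s \<in> T (i, k) \<Longrightarrow> s' \<in> T (i, k + 1) \<Longrightarrow> row_rel s s'"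
proof -
  note * = assms[unfolded shifted_svt_iff]
  show "c \<notin> shifted_diagram la \<Longrightarrow> T c = {}" "c \<in> shifted_diagram la \<Longrightarrow> finite (T c)"
    "c \<in> shifted_diagram la \<Longrightarrow> T c \<noteq> {}"
    using * by metis+
  show "0 \<notin> T c" using * by (cases "c \<in> shifted_diagram la") (metis, metis empty_iff)
qed (use assms in \<open>simp_all add: shifted_svt_iff\<close>)

text \<open>The inverse of \<open>prec_rank\<close> on positive ranks: odd ranks are the negative
  letters, even ranks the positive ones.\<close>

definition int_of_rank :: "nat \<Rightarrow> int" where
  "int_of_rank r = (if even r then int (r div 2) else - int (Suc r div 2))"

lemma prec_rank_int_of_rank: "0 < r \<Longrightarrow> prec_rank (int_of_rank r) = int r"
  unfolding prec_rank_def int_of_rank_def by (auto elim!: evenE oddE)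

lemma int_of_rank_nonzero: "0 < r \<Longrightarrow> int_of_rank r \<noteq> 0"
  unfolding int_of_rank_def by (auto elim!: evenE oddE)

text \<open>The bound depends only on the diagonal, so that it can be raised one diagonal, that is
  one \<open>opr\<close>, at a time.\<close>

definition bounded_svt :: "nat list \<Rightarrow> (nat \<Rightarrow> nat) \<Rightarrow> (nat \<times> nat \<Rightarrow> int set) set" where
  "bounded_svt la B = {T \<in> shifted_svt la.
     \<forall>i j. (i, j) \<in> shifted_diagram la \<longrightarrow> (\<forall>s\<in>T (i, j). prec_rank s \<le> int (B (j - i)))}"

lemma bounded_svtD: "T \<in> bounded_svt la B \<Longrightarrow> (i, k) \<in> shifted_diagram la \<Longrightarrow> s \<in> T (i, k) \<Longrightarrow> prec_rank s \<le> int (B (k - i))"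
  by (simp add: bounded_svt_def)

lemma bounded_svt_nonzero: "T \<in> bounded_svt la B \<Longrightarrow> s \<in> T c \<Longrightarrow> s \<noteq> 0"
  using shifted_svtD(4)[of T la c] by (auto simp: bounded_svt_def)

lemma bounded_svt_nonempty: "T \<in> bounded_svt la B \<Longrightarrow> c \<in> shifted_diagram la \<Longrightarrow> T c \<noteq> {}"
  by (auto simp: bounded_svt_def shifted_svt_def)

lemma bounded_svt_subset:
  assumes T: "T \<in> bounded_svt la B" and sub: "\<And>c. U c \<subseteq> T c"
    and ne: "\<And>c. c \<in> shifted_diagram la \<Longrightarrow> U c \<noteq> {}"
  shows "U \<in> bounded_svt la B"
proof -
  from T have T': "T \<in> shifted_svt la" by (simp add: bounded_svt_def)
  show ?thesis
    unfolding bounded_svt_def shifted_svt_iff mem_Collect_eq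
  proof (intro conjI allI impI ballI)
    fix c assume "c \<notin> shifted_diagram la"
    then show "U c = {}" using shifted_svtD(1)[OF T', of c] sub[of c] by auto
  next
    fix c assume c: "c \<in> shifted_diagram la"
    show "U c \<noteq> {}" by (rule ne[OF c])
    show "finite (U c)" by (rule finite_subset[OF sub shifted_svtD(2)[OF T' c]])
    show "0 \<notin> U c" using shifted_svtD(4)[OF T', of c] sub[of c] by auto
  next
    fix i k s s' assume "(i, k) \<in> shifted_diagram la \<and> (i + 1, k) \<in> shifted_diagram la" "s \<in> U (i, k)" "s' \<in> U (i + 1, k)"
    then show "col_rel s s'" using shifted_svtD(5)[OF T', of i k s s'] sub by auto
  next
    fix i k s s' assume "(i, k) \<in> shifted_diagram la \<and> (i, k + 1) \<in> shifted_diagram la" "s \<in> U (i, k)" "s' \<in> U (i, k + 1)"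
    then show "row_rel s s'" using shifted_svtD(6)[OF T', of i k s s'] sub by auto
  next
    fix i k s assume "(i, k) \<in> shifted_diagram la" "s \<in> U (i, k)"
    then show "prec_rank s \<le> int (B (k - i))" using bounded_svtD[OF T] sub by blast
  qed
qed

lemma abs_le_prec_rank: "s \<noteq> 0 \<Longrightarrow> \<bar>s\<bar> \<le> prec_rank s"
  by (auto simp: prec_rank_def)

lemma finite_bounded_svt [simp]: "finite (bounded_svt la B)"
proof -
  let ?D = "shifted_diagram la"
  define A where "A = (\<Union>c\<in>?D. {- int (B (snd c - fst c))..int (B (snd c - fst c))})"
  have "finite {T. \<forall>c. (c \<in> ?D \<longrightarrow> T c \<in> Pow A) \<and> (c \<notin> ?D \<longrightarrow> T c = {})}"
    by (rule finite_set_of_finite_funs) (auto simp: A_def)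
  moreover have "bounded_svt la B \<subseteq> {T. \<forall>c. (c \<in> ?D \<longrightarrow> T c \<in> Pow A) \<and> (c \<notin> ?D \<longrightarrow> T c = {})}"
  proof (clarify, intro conjI impI)
    fix T i j assume T: "T \<in> bounded_svt la B"
    show "T (i, j) \<in> Pow A" if d: "(i, j) \<in> ?D"
    proof
      show "T (i, j) \<subseteq> A"
      proof
        fix s assume s: "s \<in> T (i, j)"
        then have "prec_rank s \<le> int (B (j - i))" using T d by (auto simp: bounded_svt_def)
        then have "\<bar>s\<bar> \<le> int (B (j - i))"
          using abs_le_prec_rank[OF bounded_svt_nonzero[OF T s]] by linarith
        then show "s \<in> A" using d by (auto simp: A_def intro!: bexI[of _ "(i, j)"])
      qed
    qed
    show "T (i, j) = {}" if "(i, j) \<notin> ?D" using T that by (auto simp: bounded_svt_def shifted_svt_def)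
  qed
  ultimately show ?thesis using finite_subset by blast
qed

section \<open>Weighted sums of bounded tableaux\<close>

context beta_real
begin

text \<open>The exponent \<open>|T| - |\<lambda>|\<close> is distributed over the cells; the
  subtraction is not cut off for the nonempty cells of a tableau.\<close>

definition cell_weight :: "(nat \<Rightarrow> real) \<Rightarrow> int set \<Rightarrow> real" where
  "cell_weight x S = \<beta> ^ (card S - 1) * (\<Prod>s\<in>S. x (nat \<bar>s\<bar>))"

definition tab_sum :: "(nat \<Rightarrow> real) \<Rightarrow> (nat \<Rightarrow> nat) \<Rightarrow> nat list \<Rightarrow> real" where
  "tab_sum x B la = (\<Sum>T\<in>bounded_svt la B. \<Prod>c\<in>shifted_diagram la. cell_weight x (T c))"

lemma cell_weight_insert:
  "finite S \<Longrightarrow> S \<noteq> {} \<Longrightarrow> s \<notin> S \<Longrightarrow> cell_weight x (insert s S) = \<beta> * x (nat \<bar>s\<bar>) * cell_weight x S"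
  by (cases "card S") (auto simp: cell_weight_def)

end

text \<open>Raising the bound on one diagonal: the new value can only occur in the removable corner
  of that diagonal, because the bounds on the neighbouring diagonals forbid a cell to its right or below.\<close>

locale raise_bound =
  fixes la :: "nat list" and B :: "nat \<Rightarrow> nat" and j r :: nat and \<sigma> :: int
  assumes la: "strict_partition la" and r: "r = Suc (B j)" and \<sigma>: "\<sigma> = int_of_rank r"
    and nbr: "(\<sigma> < 0 \<and> B (Suc j) \<le> r \<and> (0 < j \<longrightarrow> B (j - 1) < r)) \<or> (\<sigma> > 0 \<and> B (Suc j) < r \<and> (0 < j \<longrightarrow> B (j - 1) \<le> r))"
begin

abbreviation "D \<equiv> shifted_diagram la"

definition "B' = B(j := r)"

lemma rank_\<sigma>: "prec_rank \<sigma> = int r" "\<sigma> \<noteq> 0"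
  using prec_rank_int_of_rank[of r] int_of_rank_nonzero[of r] r \<sigma> by auto

text \<open>The cell to the right lies on diagonal \<open>j + 1\<close>, the cell below on
  \<open>j - 1\<close>. A negative \<open>\<sigma>\<close> may repeat only downwards and a positive
  one only to the right, and \<open>nbr\<close> is strict on exactly that diagonal. So neither cell
  exists: the row ends here, and no part equals \<open>j\<close>.\<close>

lemma content_inside:
  assumes T: "T \<in> bounded_svt la B'" and ij: "(i, i + j) \<in> D" "\<sigma> \<in> T (i, i + j)"
  shows "la ! (i - 1) = Suc j" "j \<notin> set la"
proof -
  have right: "(i, i + j + 1) \<notin> D"
  proof
    assume d: "(i, i + j + 1) \<in> D"
    then obtain s where s: "s \<in> T (i, i + j + 1)" "row_rel \<sigma> s" "prec_rank s \<le> int (B' (Suc j))"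
      using T ij unfolding bounded_svt_def shifted_svt_iff by fastforce
    then show False using nbr rank_\<sigma> by (auto simp: row_rel_def B'_def)
  qed
  have below: "(i + 1, i + j) \<notin> D"
  proof
    assume d: "(i + 1, i + j) \<in> D"
    then have "0 < j" by (auto simp: mem_shifted_diagram)
    from d obtain s where s: "s \<in> T (i + 1, i + j)" "col_rel \<sigma> s" "prec_rank s \<le> int (B' (i + j - (i + 1)))"
      using T ij unfolding bounded_svt_def shifted_svt_iff by fastforce
    moreover have "i + j - (i + 1) = j - 1" "j - 1 \<noteq> j" using \<open>0 < j\<close> by auto
    ultimately show False using nbr rank_\<sigma> \<open>0 < j\<close> by (auto simp: col_rel_def B'_def simp del: diff_Suc_1 One_nat_def)
  qed
  have i: "1 \<le> i" "i \<le> length la" "j < la ! (i - 1)" using ij by (auto simp: mem_shifted_diagram)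
  then show eq: "la ! (i - 1) = Suc j" using right by (auto simp: mem_shifted_diagram)
  show "j \<notin> set la"
  proof
    assume "j \<in> set la"
    then obtain k where k: "k < length la" "la ! k = j" by (auto simp: in_set_conv_nth)
    have "j > 0" using \<open>j \<in> set la\<close> la by (metis gr0I strict_partition_def)
    have "i - 1 < k"
    proof (rule ccontr)
      assume "\<not> i - 1 < k"
      then have "k = i - 1 \<or> k < i - 1" by auto
      moreover have "i - 1 < length la" using i by auto
      ultimately show False
        using sorted_wrt_nth_less[of "(>)" la k "i - 1"] la i k eq by (auto simp: strict_partition_def)
    qed
    then have il: "i < length la" "i \<le> k" using k i by auto
    have "la ! i \<ge> j"
      using sorted_wrt_nth_less[of "(>)" la i k] la il k by (cases "i = k") (auto simp: strict_partition_def)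
    then show False using below il \<open>j > 0\<close> by (auto simp: mem_shifted_diagram)
  qed
qed

lemma bounded_mono: "bounded_svt la B \<subseteq> bounded_svt la B'"
  unfolding bounded_svt_def B'_def using r by (auto simp: fun_upd_def) force

lemma bounded_without:
  assumes "T \<in> bounded_svt la B'" "\<And>i. (i, i + j) \<in> D \<Longrightarrow> \<sigma> \<notin> T (i, i + j)"
  shows "T \<in> bounded_svt la B"
proof -
  have "prec_rank s \<le> int (B (k - i))" if d: "(i, k) \<in> D" and s: "s \<in> T (i, k)" for i k s
  proof (cases "k - i = j")
    case True
    then have k: "k = i + j" using d by (auto simp: mem_shifted_diagram)
    have "prec_rank s \<le> int r" using bounded_svtD[OF assms(1) d s] True by (simp add: B'_def)
    moreover have "s \<noteq> 0" using assms(1) d s by (auto simp: bounded_svt_def shifted_svt_iff)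
    then have "prec_rank s \<noteq> int r" using assms(2)[of i] d s k rank_\<sigma> prec_rank_inj[of s \<sigma>] by auto
    ultimately show ?thesis using True r by simp
  qed (use bounded_svtD[OF assms(1) that] in \<open>simp add: B'_def\<close>)
  then show ?thesis using assms(1) by (auto simp: bounded_svt_def)
qed

lemma bounded_not_removable:
  assumes "\<not> removable j la"
  shows "bounded_svt la B' = bounded_svt la B"
proof (rule antisym[OF subsetI bounded_mono])
  fix T assume T: "T \<in> bounded_svt la B'"
  show "T \<in> bounded_svt la B"
  proof (rule bounded_without[OF T], rule notI)
    fix i assume i: "(i, i + j) \<in> D" "\<sigma> \<in> T (i, i + j)"
    then have "Suc j \<in> set la" using content_inside(1)[OF T i] nth_mem[of "i - 1" la] by (auto simp: mem_shifted_diagram)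
    then show False using content_inside(2)[OF T i] assms by (auto simp: removable_def)
  qed
qed

context
  fixes i0 :: nat
  assumes i0: "i0 < length la" "la ! i0 = Suc j" and nj: "j \<notin> set la"
begin

definition "c0 = (Suc i0, Suc i0 + j)"

lemma c0_corner: "c0 \<in> D" "(Suc i0, Suc (Suc i0 + j)) \<notin> D" "(Suc (Suc i0), Suc i0 + j) \<notin> D"
proof -
  show "c0 \<in> D" "(Suc i0, Suc (Suc i0 + j)) \<notin> D" using i0 by (auto simp: c0_def mem_shifted_diagram)
  show "(Suc (Suc i0), Suc i0 + j) \<notin> D"
  proof
    assume d: "(Suc (Suc i0), Suc i0 + j) \<in> D"
    then have *: "Suc i0 < length la" by (auto simp: mem_shifted_diagram)
    then have "la ! Suc i0 < Suc j" using sorted_wrt_nth_less[of "(>)" la i0 "Suc i0"] la i0 by (auto simp: strict_partition_def)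
    moreover have "la ! Suc i0 \<noteq> j" using nj * nth_mem by blast
    ultimately show False using d by (auto simp: mem_shifted_diagram)
  qed
qed

lemma D_lower: "shifted_diagram (lower j la) = D - {c0}"
  using shifted_diagram_lower[OF la i0 nj] by (simp add: c0_def)

lemma \<sigma>_only_c0: "T \<in> bounded_svt la B' \<Longrightarrow> (i, i + j) \<in> D \<Longrightarrow> \<sigma> \<in> T (i, i + j) \<Longrightarrow> (i, i + j) = c0"
proof -
  assume T: "T \<in> bounded_svt la B'" and d: "(i, i + j) \<in> D" "\<sigma> \<in> T (i, i + j)"
  have "i - 1 < length la" "1 \<le> i" using d by (auto simp: mem_shifted_diagram)
  moreover from this have "i - 1 = i0"
    using strict_part_unique[OF la _ i0(1)] content_inside(1)[OF T d] i0(2) by metis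
  ultimately show ?thesis by (auto simp: c0_def)
qed

lemma rel_to_\<sigma>:
  assumes "s \<noteq> 0"
  shows "0 < j \<Longrightarrow> prec_rank s \<le> int (B (j - 1)) \<Longrightarrow> row_rel s \<sigma>"
    and "prec_rank s \<le> int (B (Suc j)) \<Longrightarrow> col_rel s \<sigma>"
proof -
  have *: "prec_rank s \<le> int r \<Longrightarrow> prec_rank s < prec_rank \<sigma> \<or> s = \<sigma>"
    using prec_rank_inj[OF assms rank_\<sigma>(2)] rank_\<sigma>(1) by fastforce
  show "row_rel s \<sigma>" if "0 < j" "prec_rank s \<le> int (B (j - 1))"
    using * that nbr rank_\<sigma> by (auto simp: row_rel_def)
  show "col_rel s \<sigma>" if "prec_rank s \<le> int (B (Suc j))"
    using * that nbr rank_\<sigma> by (auto simp: col_rel_def)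
qed

lemma \<sigma>_not_below: "T \<in> bounded_svt la B \<Longrightarrow> \<sigma> \<notin> T c0"
  using bounded_svtD[of T la B "Suc i0" "Suc i0 + j" \<sigma>] c0_corner(1) rank_\<sigma> r by (auto simp: c0_def)

lemma bounded_insert:
  assumes T: "T \<in> bounded_svt la B"
  shows "T(c0 := insert \<sigma> (T c0)) \<in> bounded_svt la B'" (is "?U \<in> _")
proof -
  have ne: "\<And>c. c \<in> D \<Longrightarrow> finite (T c) \<and> T c \<noteq> {} \<and> 0 \<notin> T c" and out: "\<And>c. c \<notin> D \<Longrightarrow> T c = {}"
    and bd: "\<And>i k s. (i, k) \<in> D \<Longrightarrow> s \<in> T (i, k) \<Longrightarrow> prec_rank s \<le> int (B (k - i))"
    and col: "\<And>i k s s'. (i, k) \<in> D \<Longrightarrow> (i + 1, k) \<in> D \<Longrightarrow> s \<in> T (i, k) \<Longrightarrow> s' \<in> T (i + 1, k) \<Longrightarrow> col_rel s s'"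
    and row: "\<And>i k s s'. (i, k) \<in> D \<Longrightarrow> (i, k + 1) \<in> D \<Longrightarrow> s \<in> T (i, k) \<Longrightarrow> s' \<in> T (i, k + 1) \<Longrightarrow> row_rel s s'"
    using T by (auto simp: bounded_svt_def shifted_svt_iff)
  show ?thesis
    unfolding bounded_svt_def shifted_svt_iff mem_Collect_eq
  proof (intro conjI allI impI ballI)
    fix i k s s' assume d: "(i, k) \<in> D \<and> (i + 1, k) \<in> D" and s: "s \<in> ?U (i, k)" "s' \<in> ?U (i + 1, k)"
    have nc: "(i, k) \<noteq> c0" using d c0_corner(3) by (auto simp: c0_def)
    then have sT: "s \<in> T (i, k)" "s \<noteq> 0" using s d ne[of "(i, k)"] by auto
    show "col_rel s s'"
    proof (cases "(i + 1, k) = c0 \<and> s' = \<sigma>")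
      case True
      then have "k - i = Suc j" by (auto simp: c0_def)
      then show ?thesis using rel_to_\<sigma>(2)[OF sT(2)] bd[of i k s] d sT True by auto
    next
      case False
      then have "s' \<in> T (i + 1, k)" using s by (auto split: if_splits)
      then show ?thesis using col d sT by blast
    qed
  next
    fix i k s s' assume d: "(i, k) \<in> D \<and> (i, k + 1) \<in> D" and s: "s \<in> ?U (i, k)" "s' \<in> ?U (i, k + 1)"
    have nc: "(i, k) \<noteq> c0" using d c0_corner(2) by (auto simp: c0_def)
    then have sT: "s \<in> T (i, k)" "s \<noteq> 0" using s d ne[of "(i, k)"] by auto
    show "row_rel s s'"
    proof (cases "(i, k + 1) = c0 \<and> s' = \<sigma>")
      case True
      then have "k - i = j - 1" "0 < j" using d by (auto simp: c0_def mem_shifted_diagram)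
      then show ?thesis using rel_to_\<sigma>(1)[OF sT(2)] bd[of i k s] d sT True by auto
    next
      case False
      then have "s' \<in> T (i, k + 1)" using s by (auto split: if_splits)
      then show ?thesis using row d sT by blast
    qed
  next
    fix i k s assume d: "(i, k) \<in> D" and s: "s \<in> ?U (i, k)"
    show "prec_rank s \<le> int (B' (k - i))"
    proof (cases "(i, k) = c0 \<and> s = \<sigma>")
      case True
      then show ?thesis using rank_\<sigma> by (auto simp: c0_def B'_def)
    next
      case False
      then have "s \<in> T (i, k)" using s by (auto split: if_splits)
      from bd[OF d this] show ?thesis unfolding B'_def using r by auto
    qed
  qed (use ne out c0_corner(1) rank_\<sigma>(2) in \<open>auto split: if_splits\<close>)
qed

lemma bounded_new:
  assumes T: "T \<in> bounded_svt (lower j la) B"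
  shows "T(c0 := {\<sigma>}) \<in> bounded_svt la B'" (is "?U \<in> _")
proof -
  have ne: "\<And>c. c \<in> D \<Longrightarrow> c \<noteq> c0 \<Longrightarrow> finite (T c) \<and> T c \<noteq> {} \<and> 0 \<notin> T c" and out: "\<And>c. c \<notin> D \<Longrightarrow> T c = {}"
    and bd: "\<And>i k s. (i, k) \<in> D \<Longrightarrow> (i, k) \<noteq> c0 \<Longrightarrow> s \<in> T (i, k) \<Longrightarrow> prec_rank s \<le> int (B (k - i))"
    and col: "\<And>i k s s'. (i, k) \<in> D \<Longrightarrow> (i + 1, k) \<in> D \<Longrightarrow> (i, k) \<noteq> c0 \<Longrightarrow> (i + 1, k) \<noteq> c0
        \<Longrightarrow> s \<in> T (i, k) \<Longrightarrow> s' \<in> T (i + 1, k) \<Longrightarrow> col_rel s s'"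
    and row: "\<And>i k s s'. (i, k) \<in> D \<Longrightarrow> (i, k + 1) \<in> D \<Longrightarrow> (i, k) \<noteq> c0 \<Longrightarrow> (i, k + 1) \<noteq> c0
        \<Longrightarrow> s \<in> T (i, k) \<Longrightarrow> s' \<in> T (i, k + 1) \<Longrightarrow> row_rel s s'"
    using T unfolding bounded_svt_def shifted_svt_iff D_lower by auto
  show ?thesis
    unfolding bounded_svt_def shifted_svt_iff mem_Collect_eq
  proof (intro conjI allI impI ballI)
    fix i k s s' assume d: "(i, k) \<in> D \<and> (i + 1, k) \<in> D" and s: "s \<in> ?U (i, k)" "s' \<in> ?U (i + 1, k)"
    have nc: "(i, k) \<noteq> c0" using d c0_corner(3) by (auto simp: c0_def)
    then have sT: "s \<in> T (i, k)" "s \<noteq> 0" using s d ne[of "(i, k)"] by auto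
    show "col_rel s s'"
    proof (cases "(i + 1, k) = c0")
      case True
      then have "k - i = Suc j" "s' = \<sigma>" using s by (auto simp: c0_def)
      then show ?thesis using rel_to_\<sigma>(2)[OF sT(2)] bd[of i k s] d sT nc by auto
    next
      case False
      then show ?thesis using col[of i k s s'] d sT s nc by auto
    qed
  next
    fix i k s s' assume d: "(i, k) \<in> D \<and> (i, k + 1) \<in> D" and s: "s \<in> ?U (i, k)" "s' \<in> ?U (i, k + 1)"
    have nc: "(i, k) \<noteq> c0" using d c0_corner(2) by (auto simp: c0_def)
    then have sT: "s \<in> T (i, k)" "s \<noteq> 0" using s d ne[of "(i, k)"] by auto
    show "row_rel s s'"
    proof (cases "(i, k + 1) = c0")
      case True
      then have "k - i = j - 1" "0 < j" "s' = \<sigma>" using d s by (auto simp: c0_def mem_shifted_diagram)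
      then show ?thesis using rel_to_\<sigma>(1)[OF sT(2)] bd[of i k s] d sT nc by auto
    next
      case False
      then show ?thesis using row[of i k s s'] d sT s nc by auto
    qed
  next
    fix i k s assume d: "(i, k) \<in> D" and s: "s \<in> ?U (i, k)"
    show "prec_rank s \<le> int (B' (k - i))"
    proof (cases "(i, k) = c0")
      case True
      then show ?thesis using rank_\<sigma> s by (auto simp: c0_def B'_def)
    next
      case False
      then have "s \<in> T (i, k)" using s by simp
      from bd[OF d False this] show ?thesis unfolding B'_def using r by auto
    qed
  qed (use ne out c0_corner(1) rank_\<sigma>(2) in \<open>auto split: if_splits\<close>)
qed

lemma bounded_remove:
  assumes T: "T \<in> bounded_svt la B'" and \<sigma>T: "\<sigma> \<in> T c0"
  shows "T c0 \<noteq> {\<sigma>} \<Longrightarrow> T(c0 := T c0 - {\<sigma>}) \<in> bounded_svt la B"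
    and "T c0 = {\<sigma>} \<Longrightarrow> T(c0 := {}) \<in> bounded_svt (lower j la) B"
proof -
  have only: "(i, i + j) \<in> D \<Longrightarrow> (i, i + j) \<noteq> c0 \<Longrightarrow> \<sigma> \<notin> T (i, i + j)" for i using \<sigma>_only_c0[OF T] by blast
  show "T(c0 := T c0 - {\<sigma>}) \<in> bounded_svt la B" if "T c0 \<noteq> {\<sigma>}"
  proof (rule bounded_without)
    have "(T(c0 := T c0 - {\<sigma>})) c \<noteq> {}" if "c \<in> D" for c
      using bounded_svt_nonempty[OF T that] \<open>T c0 \<noteq> {\<sigma>}\<close> by (cases "c = c0") auto
    then show "T(c0 := T c0 - {\<sigma>}) \<in> bounded_svt la B'"
      by (intro bounded_svt_subset[OF T]) auto
  next
    fix i show "\<sigma> \<notin> (T(c0 := T c0 - {\<sigma>})) (i, i + j)" if "(i, i + j) \<in> D" using only[OF that] by auto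
  qed
  show "T(c0 := {}) \<in> bounded_svt (lower j la) B" if "T c0 = {\<sigma>}"
  proof -
    have bd: "prec_rank s \<le> int (B (k - i))" if d: "(i, k) \<in> D - {c0}" and s: "s \<in> T (i, k)" for i k s
    proof (cases "k - i = j")
      case True
      then have k: "k = i + j" using d by (auto simp: mem_shifted_diagram)
      have "prec_rank s \<le> int r" using bounded_svtD[OF T, of i k s] d s True by (simp add: B'_def)
      moreover have "s \<noteq> 0" using bounded_svt_nonzero[OF T s] .
      then have "prec_rank s \<noteq> int r" using only[of i] d s k rank_\<sigma> prec_rank_inj[of s \<sigma>] by auto
      ultimately show ?thesis using True r by simp
    qed (use bounded_svtD[OF T, of i k s] that in \<open>simp add: B'_def\<close>)
    have U: "(T(c0 := {})) c = T c" if "c \<in> D - {c0}" for c using that by auto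
    from T have T': "T \<in> shifted_svt la" by (simp add: bounded_svt_def)
    show ?thesis
      unfolding bounded_svt_def shifted_svt_iff D_lower mem_Collect_eq
    proof (intro conjI allI impI ballI)
      fix c assume "c \<notin> D - {c0}"
      then show "(T(c0 := {})) c = {}" using shifted_svtD(1)[OF T', of c] by auto
    next
      fix i k s s' assume "(i, k) \<in> D - {c0} \<and> (i + 1, k) \<in> D - {c0}" "s \<in> (T(c0 := {})) (i, k)" "s' \<in> (T(c0 := {})) (i + 1, k)"
      then show "col_rel s s'" using shifted_svtD(5)[OF T', of i k s s'] U by auto
    next
      fix i k s s' assume "(i, k) \<in> D - {c0} \<and> (i, k + 1) \<in> D - {c0}" "s \<in> (T(c0 := {})) (i, k)" "s' \<in> (T(c0 := {})) (i, k + 1)"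
      then show "row_rel s s'" using shifted_svtD(6)[OF T', of i k s s'] U by auto
    next
      fix i k s assume "(i, k) \<in> D - {c0}" "s \<in> (T(c0 := {})) (i, k)"
      then show "prec_rank s \<le> int (B (k - i))" using bd U by metis
    next
      fix c assume "c \<in> D - {c0}"
      then show "finite ((T(c0 := {})) c)" "(T(c0 := {})) c \<noteq> {}" "0 \<notin> (T(c0 := {})) c"
        using shifted_svtD(2-4)[OF T', of c] unfolding U[OF \<open>c \<in> D - {c0}\<close>] by auto
    qed
  qed
qed

end
end

context beta_real
begin

text \<open>The tableaux below the raised bound fall into three classes: \<open>\<sigma>\<close> is
  absent; it joins other entries of the corner, with factor \<open>\<beta> x\<close>; or it is alone
  in the corner, with factor \<open>x\<close> and a tableau of the lowered shape. These are the
  three terms of the hop.\<close>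

lemma tab_sum_raise:
  assumes rb: "raise_bound la B j r \<sigma>"
  shows "tab_sum x (B(j := r)) la = hop (x (nat \<bar>\<sigma>\<bar>)) j (tab_sum x B) la"
proof -
  interpret raise_bound la B j r \<sigma> by (rule rb)
  note B'_def[symmetric, simp]
  show ?thesis
  proof (cases "removable j la")
    case False
    then show ?thesis using bounded_not_removable by (simp add: tab_sum_def hop_def opr_def)
  next
    case True
    then obtain i where i: "i < length la" "la ! i = Suc j" and nj: "j \<notin> set la"
      by (auto simp: removable_def in_set_conv_nth)
    define c where "c = c0 i"
    define wt where "wt E T = (\<Prod>d\<in>E. cell_weight x (T d))" for E and T :: "nat \<times> nat \<Rightarrow> int set"
    note c_in = c0_corner(1)[OF i nj, folded c_def]
    note D_low = D_lower[OF i nj, folded c_def]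
    let ?A = "bounded_svt la B" and ?L = "bounded_svt (lower j la) B"
    let ?p = "\<lambda>T. T(c := {\<sigma>})" and ?q = "\<lambda>T. T(c := insert \<sigma> (T c))"
    have A: "\<sigma> \<notin> T c" "T c \<noteq> {}" "finite (T c)" if "T \<in> ?A" for T
      using \<sigma>_not_below[OF i nj that] bounded_svt_nonempty[OF that c_in] shifted_svtD(2)[of T la c] c_in that
      by (auto simp: c_def bounded_svt_def)
    have L: "T c = {}" if "T \<in> ?L" for T
      using shifted_svtD(1)[of T "lower j la" c] that D_low by (auto simp: bounded_svt_def)
    have split: "bounded_svt la B' = ?A \<union> (?p ` ?L \<union> ?q ` ?A)"
    proof
      show "?A \<union> (?p ` ?L \<union> ?q ` ?A) \<subseteq> bounded_svt la B'"
        using bounded_mono bounded_new[OF i nj] bounded_insert[OF i nj] by (auto simp: c_def)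
      show "bounded_svt la B' \<subseteq> ?A \<union> (?p ` ?L \<union> ?q ` ?A)"
      proof
        fix T assume T: "T \<in> bounded_svt la B'"
        consider "\<sigma> \<notin> T c" | "T c = {\<sigma>}" | "\<sigma> \<in> T c" "T c \<noteq> {\<sigma>}" by auto
        then show "T \<in> ?A \<union> (?p ` ?L \<union> ?q ` ?A)"
        proof cases
          case 1
          have "T \<in> ?A"
            by (rule bounded_without[OF T]) (use \<sigma>_only_c0[OF i nj T] 1 in \<open>auto simp: c_def\<close>)
          then show ?thesis by simp
        next
          case 2
          then have "T(c := {}) \<in> ?L" using bounded_remove(2)[OF i nj T] by (simp add: c_def)
          moreover have "T = ?p (T(c := {}))" using 2 by (simp add: fun_upd_idem)
          ultimately show ?thesis by blast
        next
          case 3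
          then have "T(c := T c - {\<sigma>}) \<in> ?A" using bounded_remove(1)[OF i nj T] by (simp add: c_def)
          moreover have "T = ?q (T(c := T c - {\<sigma>}))" using 3 by (auto simp: insert_absorb)
          ultimately show ?thesis by blast
        qed
      qed
    qed
    have inj_p: "inj_on ?p ?L"
    proof (rule inj_onI, rule ext)
      fix T U d assume TU: "T \<in> ?L" "U \<in> ?L" and eq: "?p T = ?p U"
      show "T d = U d"
      proof (cases "d = c")
        case False
        then show ?thesis using fun_cong[OF eq, of d] by simp
      qed (simp add: L TU)
    qed
    have inj_q: "inj_on ?q ?A"
    proof (rule inj_onI, rule ext)
      fix T U d assume TU: "T \<in> ?A" "U \<in> ?A" and eq: "?q T = ?q U"
      have "insert \<sigma> (T c) = insert \<sigma> (U c)" using fun_cong[OF eq, of c] by simp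
      then have "T c = U c" using A(1)[OF TU(1)] A(1)[OF TU(2)] by (metis insert_ident)
      then show "T d = U d" using fun_cong[OF eq, of d] by (cases "d = c") simp_all
    qed
    have wt_D: "wt D T = cell_weight x (T c) * wt (D - {c}) T" for T
      unfolding wt_def using c_in by (intro prod.remove) auto
    have wt_upd: "wt (D - {c}) (T(c := S)) = wt (D - {c}) T" for T S
      unfolding wt_def by (rule prod.cong) auto
    have "tab_sum x B' la = (\<Sum>T\<in>?A \<union> (?p ` ?L \<union> ?q ` ?A). wt D T)"
      by (simp add: tab_sum_def split wt_def)
    also have "\<dots> = (\<Sum>T\<in>?A. wt D T) + ((\<Sum>T\<in>?p ` ?L. wt D T) + (\<Sum>T\<in>?q ` ?A. wt D T))"
    proof -
      have "?p ` ?L \<inter> ?q ` ?A = {}"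
      proof -
        have "?p T \<noteq> ?q U" if "U \<in> ?A" for T U
        proof
          assume "?p T = ?q U"
          then have "{\<sigma>} = insert \<sigma> (U c)" by (metis fun_upd_same)
          then show False using A(1,2)[OF that] by auto
        qed
        then show ?thesis by auto
      qed
      moreover have "?A \<inter> (?p ` ?L \<union> ?q ` ?A) = {}" using A(1) by fastforce
      ultimately show ?thesis by (simp add: sum.union_disjoint)
    qed
    also have "(\<Sum>T\<in>?p ` ?L. wt D T) = x (nat \<bar>\<sigma>\<bar>) * tab_sum x B (lower j la)"
      unfolding sum.reindex[OF inj_p]
      by (simp add: tab_sum_def D_low wt_D wt_upd sum_distrib_left cell_weight_def) (simp add: wt_def cell_weight_def)
    also have "(\<Sum>T\<in>?q ` ?A. wt D T) = x (nat \<bar>\<sigma>\<bar>) * \<beta> * (\<Sum>T\<in>?A. wt D T)"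
      unfolding sum.reindex[OF inj_q] sum_distrib_left
      by (rule sum.cong) (auto simp: wt_D wt_upd cell_weight_insert A)
    also have "(\<Sum>T\<in>?A. wt D T) = tab_sum x B la"
      by (simp add: tab_sum_def wt_def)
    finally show ?thesis using True by (simp add: hop_def opr_def algebra_simps)
  qed
qed

lemma int_of_rank_odd: "int_of_rank (Suc (2 * N)) = - int (Suc N)"
  and int_of_rank_even: "int_of_rank (Suc (Suc (2 * N))) = int (Suc N)"
  by (auto simp: int_of_rank_def)

text \<open>Rank \<open>2 N + 1\<close> is the letter \<open>- (N + 1)\<close>. It repeats only in
  columns, so \<open>raise_bound\<close> wants diagonal \<open>j + 1\<close> raised before
  \<open>j\<close>, and the diagonals are treated from \<open>n - 1\<close> down to 0.\<close>

lemma tab_sum_descend: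
  assumes "j \<le> n" "parts_le n la"
  shows "foldr (hop (x (Suc N))) [j..<n] (tab_sum x (\<lambda>c. if c < n then 2 * N else 0)) la
    = tab_sum x (\<lambda>c. if c < j then 2 * N else if c < n then Suc (2 * N) else 0) la"
  using assms
proof (induction j arbitrary: la rule: inc_induct)
  case base
  have "(\<lambda>c. if c < n then 2 * N else 0) = (\<lambda>c. if c < n then 2 * N else if c < n then Suc (2 * N) else 0)"
    by auto
  from arg_cong[OF this, of "\<lambda>B. tab_sum x B la"] show ?case by simp
next
  case (step j)
  let ?B = "\<lambda>j c. if c < j then 2 * N else if c < n then Suc (2 * N) else 0"
  have "foldr (hop (x (Suc N))) [j..<n] (tab_sum x (\<lambda>c. if c < n then 2 * N else 0)) la
    = hop (x (Suc N)) j (foldr (hop (x (Suc N))) [Suc j..<n] (tab_sum x (\<lambda>c. if c < n then 2 * N else 0))) la"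
    using step.hyps by (simp add: upt_conv_Cons)
  also have "\<dots> = hop (x (Suc N)) j (tab_sum x (?B (Suc j))) la"
    by (rule hop_cong[of "parts_le n"]) (use step parts_le_lower in auto)
  also have "\<dots> = tab_sum x ((?B (Suc j))(j := Suc (2 * N))) la"
  proof -
    have "raise_bound la (?B (Suc j)) j (Suc (2 * N)) (- int (Suc N))"
      by unfold_locales (use step in \<open>auto simp: parts_le_def int_of_rank_odd\<close>)
    from tab_sum_raise[OF this, of x] show ?thesis by (simp only: abs_minus_cancel abs_of_nat nat_int)
  qed
  also have "(?B (Suc j))(j := Suc (2 * N)) = ?B j" using step.hyps by (auto simp: fun_eq_iff)
  finally show ?case .
qed

text \<open>Rank \<open>2 N + 2\<close> is the letter \<open>N + 1\<close>. It repeats only in rows,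
  so the diagonals are raised in the opposite order, from 0 upwards.\<close>

lemma tab_sum_ascend:
  assumes start: "\<And>la. parts_le n la \<Longrightarrow> \<psi> la = tab_sum x (\<lambda>c. if c < n then Suc (2 * N) else 0) la"
    and "j \<le> n" "parts_le n la"
  shows "foldr (hop (x (Suc N))) (rev [0..<j]) \<psi> la
    = tab_sum x (\<lambda>c. if c < j then Suc (Suc (2 * N)) else if c < n then Suc (2 * N) else 0) la"
  using assms(2,3)
proof (induction j arbitrary: la)
  case 0
  then show ?case using start by simp
next
  case (Suc j)
  let ?B = "\<lambda>j c. if c < j then Suc (Suc (2 * N)) else if c < n then Suc (2 * N) else 0"
  have "foldr (hop (x (Suc N))) (rev [0..<Suc j]) \<psi> la = hop (x (Suc N)) j (foldr (hop (x (Suc N))) (rev [0..<j]) \<psi>) la"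
    by simp
  also have "\<dots> = hop (x (Suc N)) j (tab_sum x (?B j)) la"
    by (rule hop_cong[of "parts_le n"]) (use Suc parts_le_lower in auto)
  also have "\<dots> = tab_sum x ((?B j)(j := Suc (Suc (2 * N)))) la"
  proof -
    have "raise_bound la (?B j) j (Suc (Suc (2 * N))) (int (Suc N))"
      by unfold_locales (use Suc.prems in \<open>auto simp: parts_le_def int_of_rank_even\<close>)
    from tab_sum_raise[OF this, of x] show ?thesis by (simp only: abs_minus_cancel abs_of_nat nat_int)
  qed
  also have "(?B j)(j := Suc (Suc (2 * N))) = ?B (Suc j)" using Suc.prems by (auto simp: fun_eq_iff)
  finally show ?case .
qed

lemma tab_sum_zero: "strict_partition la \<Longrightarrow> tab_sum x (\<lambda>_. 0) la = (if la = [] then 1 else 0)"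
proof (cases "la = []")
  case True
  have "shifted_diagram [] = {}" by (auto simp: mem_shifted_diagram)
  moreover from this have "bounded_svt [] (\<lambda>_. 0) = {\<lambda>_. {}}"
    by (auto simp: bounded_svt_def shifted_svt_def)
  ultimately show ?thesis using True by (simp add: tab_sum_def)
next
  case False
  assume la: "strict_partition la"
  have "hd la \<noteq> 0" using la False by (metis hd_in_set strict_partition_def)
  then have "(1, 1) \<in> shifted_diagram la" using False by (auto simp: mem_shifted_diagram hd_conv_nth Suc_le_eq)
  then have "T \<notin> bounded_svt la (\<lambda>_. 0)" for T
  proof -
    assume c: "(1, 1) \<in> shifted_diagram la"
    show ?thesis
    proof
      assume T: "T \<in> bounded_svt la (\<lambda>_. 0)"
      obtain s where s: "s \<in> T (1, 1)" using bounded_svt_nonempty[OF T c] by auto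
      then show False using bounded_svtD[OF T c s] prec_rank_pos[OF bounded_svt_nonzero[OF T s]] by simp
    qed
  qed
  then have "bounded_svt la (\<lambda>_. 0) = {}" by blast
  then show ?thesis using False by (simp add: tab_sum_def)
qed

lemma foldr_hop_cong:
  assumes "\<And>qs. parts_le n qs \<Longrightarrow> \<psi> qs = \<phi> qs" "parts_le n ps"
  shows "foldr (hop t) js \<psi> ps = foldr (hop t) js \<phi> ps"
  using assms(2)
proof (induction js arbitrary: ps)
  case (Cons j js)
  show ?case
    by (simp, rule hop_cong[of "parts_le n"]) (use Cons parts_le_lower in auto)
qed (simp add: assms(1))

text \<open>Both sides are the indicator of the empty shape for \<open>N = 0\<close> and obey the
  same recursion: the letters \<open>- (N + 1)\<close> and \<open>N + 1\<close> supply the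
  descending and the ascending half of the word in \<open>FC_insert\<close>.\<close>

theorem tab_sum_eq_FC:
  assumes x: "\<And>i. i \<in> {1..N} \<Longrightarrow> x i > 0" "inj_on x {1..N}" and n: "0 < n" and la: "parts_le n la"
  shows "tab_sum x (\<lambda>c. if c < n then 2 * N else 0) la = FC (\<lambda>_. 0) la (x ` {1..N})"
  using x la
proof (induction N arbitrary: la)
  case 0
  then have "tab_sum x (\<lambda>_. 0) la = (if la = [] then 1 else 0)" by (intro tab_sum_zero) (simp add: parts_le_def)
  moreover have "(\<lambda>c. if c < n then 2 * 0 else 0) = (\<lambda>_. 0 :: nat)" by auto
  ultimately show ?case by (cases la) (simp_all only: FC.simps, auto)
next
  case (Suc N)
  let ?X = "x ` {1..N}" and ?t = "x (Suc N)"
  have X: "pos_alphabet ?X" using Suc.prems(1) by (auto simp: pos_alphabet_def)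
  have t: "?t > 0" using Suc.prems(1) by simp
  have t': "?t \<notin> ?X"
  proof
    assume "?t \<in> ?X"
    then obtain i where "i \<in> {1..N}" "x (Suc N) = x i" by auto
    then show False using inj_onD[OF Suc.prems(2), of "Suc N" i] by simp
  qed
  have ins: "insert ?t ?X = x ` {1..Suc N}" by (auto simp: atLeastAtMostSuc_conv)
  have IH: "tab_sum x (\<lambda>c. if c < n then 2 * N else 0) qs = FC (\<lambda>_. 0) qs ?X" if "parts_le n qs" for qs
    by (rule Suc.IH[OF _ _ that]) (use Suc.prems(1) inj_on_subset[OF Suc.prems(2)] in auto)
  have "tab_sum x (\<lambda>c. if c < n then 2 * Suc N else 0) la
    = foldr (hop ?t) (rev [0..<n]) (foldr (hop ?t) [0..<n] (tab_sum x (\<lambda>c. if c < n then 2 * N else 0))) la"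
  proof -
    have "foldr (hop ?t) (rev [0..<n]) (foldr (hop ?t) [0..<n] (tab_sum x (\<lambda>c. if c < n then 2 * N else 0))) la
      = tab_sum x (\<lambda>c. if c < n then Suc (Suc (2 * N)) else if c < n then Suc (2 * N) else 0) la"
      by (rule tab_sum_ascend[OF _ order_refl Suc.prems(3)]) (use tab_sum_descend[of 0 n] in simp)
    also have "(\<lambda>c. if c < n then Suc (Suc (2 * N)) else if c < n then Suc (2 * N) else 0) = (\<lambda>c. if c < n then 2 * Suc N else 0)"
      by auto
    finally show ?thesis by (rule sym)
  qed
  also have "\<dots> = foldr (hop ?t) (rev [0..<n] @ [0..<n]) (\<lambda>qs. FC (\<lambda>_. 0) qs ?X) la"
    using foldr_hop_cong[where \<phi> = "\<lambda>qs. FC (\<lambda>_. 0) qs ?X", OF IH Suc.prems(3), of ?t "rev [0..<n] @ [0..<n]"] by simp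
  also have "\<dots> = FC (\<lambda>_. 0) la (insert ?t ?X)" by (rule FC_insert[OF X t t' n Suc.prems(3), symmetric])
  finally show ?case by (simp only: ins)
qed

end

section \<open>The representation on pairs of partitions\<close>

lemma mem_lower_pos: "0 < j \<Longrightarrow> Suc j \<in> set ps \<Longrightarrow> x \<in> set (lower j ps) \<longleftrightarrow> x = j \<or> (x \<in> set ps \<and> x \<noteq> Suc j)"
  using set_lower(2)[of j ps] by auto

lemma mem_lower_0: "x \<in> set (lower 0 ps) \<longleftrightarrow> x \<in> set ps \<and> x \<noteq> 1"
  by (simp add: set_lower(3))

lemma mem_lower_other: "x \<noteq> j \<Longrightarrow> x \<noteq> Suc j \<Longrightarrow> x \<in> set (lower j ps) \<longleftrightarrow> x \<in> set ps"
  by (auto simp: lower_def)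

lemma lower_commute: "Suc i < j \<Longrightarrow> lower i (lower j ps) = lower j (lower i ps)"
  by (induction ps) (auto simp: lower_Cons)

context beta_real
begin

lemma opr_zero [simp]: "opr j (\<lambda>_. 0) ps = 0"
  by (simp add: opr_def)

lemma opr_square: "opr j (opr j \<psi>) ps = \<beta> * opr j \<psi> ps"
proof -
  have "\<not> removable j (lower j ps)"
    using set_lower(1)[of j ps] by (auto simp: removable_def)
  then show ?thesis by (simp add: opr_def)
qed

lemma opr_commute:
  assumes "Suc i < j"
  shows "opr i (opr j \<psi>) ps = opr j (opr i \<psi>) ps"
proof -
  have "removable i (lower j ps) \<longleftrightarrow> removable i ps" "removable j (lower i ps) \<longleftrightarrow> removable j ps"
    using assms by (auto simp: removable_def mem_lower_other)
  then show ?thesis by (simp add: opr_def lower_commute[OF assms] algebra_simps)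
qed

text \<open>Both braid words act as zero: the last move would need a part at a site just vacated or
  a free site just filled. The same happens to the words of length four in
  \<open>opr_four\<close>.\<close>

lemma opr_braid:
  assumes "0 < i"
  shows "opr i (opr (Suc i) (opr i \<psi>)) ps = 0" "opr (Suc i) (opr i (opr (Suc i) \<psi>)) ps = 0"
  using assms by (auto simp: opr_def removable_def mem_lower_pos mem_lower_other)

lemma opr_four:
  "opr 1 (opr 0 (opr 1 (opr 0 \<psi>))) ps = 0" "opr 0 (opr 1 (opr 0 (opr 1 \<psi>))) ps = 0"
  by (auto simp: opr_def removable_def mem_lower_pos mem_lower_0)

lemma opr_sum: "opr j (\<lambda>ps. \<Sum>x\<in>A. c x * \<psi> x ps) qs = (\<Sum>x\<in>A. c x * opr j (\<psi> x) qs)"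
  by (auto simp: opr_def sum_distrib_left sum.distrib[symmetric] algebra_simps)

type_synonym vec = "nat list \<times> nat list \<Rightarrow> real"

text \<open>The second partition is read from the top: a part \<open>r\<close> stands for the value \<open>n + 1 - r\<close>.\<close>

definition gop :: "nat \<Rightarrow> nat \<Rightarrow> nat \<Rightarrow> vec \<Rightarrow> vec" where
  "gop k n i \<Psi> s = (if i < k then opr i (\<lambda>p. \<Psi> (p, snd s)) (fst s)
     else if k < i \<and> i < n then opr (n - i) (\<lambda>q. \<Psi> (fst s, q)) (snd s) else 0)"

definition wact :: "nat \<Rightarrow> nat \<Rightarrow> nat list \<Rightarrow> vec \<Rightarrow> vec" where
  "wact k n as \<Psi> = foldr (gop k n) as \<Psi>"

definition alg_act :: "nat \<Rightarrow> nat \<Rightarrow> free_alg \<Rightarrow> vec \<Rightarrow> vec" where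
  "alg_act k n f \<Psi> s = (\<Sum>w\<in>Poly_Mapping.keys f. ev \<beta> (Poly_Mapping.lookup f w) * wact k n (letters w) \<Psi> s)"

lemma wact_simps [simp]: "wact k n [] \<Psi> = \<Psi>" "wact k n (i # as) \<Psi> = gop k n i (wact k n as \<Psi>)"
  by (simp_all add: wact_def)

lemma wact_append: "wact k n (as @ bs) \<Psi> = wact k n as (wact k n bs \<Psi>)"
  by (simp add: wact_def)

lemma gop_sum: "gop k n i (\<lambda>s. \<Sum>x\<in>A. c x * \<Psi> x s) = (\<lambda>s. \<Sum>x\<in>A. c x * gop k n i (\<Psi> x) s)"
  by (rule ext) (auto simp: gop_def opr_sum)

lemma wact_sum: "wact k n as (\<lambda>s. \<Sum>x\<in>A. c x * \<Psi> x s) = (\<lambda>s. \<Sum>x\<in>A. c x * wact k n as (\<Psi> x) s)"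
  by (induction as) (simp_all add: gop_sum)

lemma gop_zero [simp]: "gop k n i (\<lambda>_. 0) = (\<lambda>_. 0)"
  by (rule ext) (simp add: gop_def)

lemma alg_act_superset:
  assumes "finite A" "Poly_Mapping.keys f \<subseteq> A"
  shows "alg_act k n f \<Psi> s = (\<Sum>w\<in>A. ev \<beta> (Poly_Mapping.lookup f w) * wact k n (letters w) \<Psi> s)"
  unfolding alg_act_def by (rule sum.mono_neutral_left) (use assms in \<open>auto simp: in_keys_iff\<close>)

lemma alg_act_zero [simp]: "alg_act k n 0 \<Psi> s = 0"
  by (simp add: alg_act_def)

lemma alg_act_add: "alg_act k n (f + g) \<Psi> s = alg_act k n f \<Psi> s + alg_act k n g \<Psi> s"
proof -
  let ?A = "Poly_Mapping.keys f \<union> Poly_Mapping.keys g"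
  have "Poly_Mapping.keys (f + g) \<subseteq> ?A" by (rule Poly_Mapping.keys_add)
  then show ?thesis
    by (simp add: alg_act_superset[of ?A] lookup_add ev_add distrib_right sum.distrib)
qed

lemma alg_act_sum: "alg_act k n (sum f A) \<Psi> s = (\<Sum>x\<in>A. alg_act k n (f x) \<Psi> s)"
  by (induction A rule: infinite_finite_induct) (auto simp: alg_act_add)

lemma alg_act_single: "alg_act k n (Poly_Mapping.single w c) \<Psi> s = ev \<beta> c * wact k n (letters w) \<Psi> s"
  by (simp add: alg_act_superset[of "{w}"])

lemma alg_act_diff: "alg_act k n (f - g) \<Psi> s = alg_act k n f \<Psi> s - alg_act k n g \<Psi> s"
  using alg_act_add[of k n "f - g" g \<Psi> s] by simp

lemma alg_act_mult: "alg_act k n (f * g) \<Psi> = alg_act k n f (alg_act k n g \<Psi>)"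
proof
  fix s
  let ?l = Poly_Mapping.lookup and ?k = Poly_Mapping.keys
  have "f * g = (\<Sum>v\<in>?k f. Poly_Mapping.single v (?l f v)) * (\<Sum>w\<in>?k g. Poly_Mapping.single w (?l g w))"
    by (simp only: poly_mapping_sum_singles[symmetric])
  also have "\<dots> = (\<Sum>v\<in>?k f. \<Sum>w\<in>?k g. Poly_Mapping.single (v + w) (?l f v * ?l g w))"
    by (simp add: sum_product mult_single)
  finally have "alg_act k n (f * g) \<Psi> s
    = (\<Sum>v\<in>?k f. \<Sum>w\<in>?k g. ev \<beta> (?l f v * ?l g w) * wact k n (letters (v + w)) \<Psi> s)"
    by (simp add: alg_act_sum alg_act_single)
  also have "\<dots> = (\<Sum>v\<in>?k f. ev \<beta> (?l f v) * (\<Sum>w\<in>?k g. ev \<beta> (?l g w) * wact k n (letters v) (wact k n (letters w) \<Psi>) s))"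
    by (simp add: plus_word_def wact_append ev_mult sum_distrib_left mult.assoc)
  also have "\<dots> = alg_act k n f (\<lambda>s. \<Sum>w\<in>?k g. ev \<beta> (?l g w) * wact k n (letters w) \<Psi> s) s"
    by (simp only: alg_act_def wact_sum)
  also have "(\<lambda>s. \<Sum>w\<in>?k g. ev \<beta> (?l g w) * wact k n (letters w) \<Psi> s) = alg_act k n g \<Psi>"
    by (rule ext) (simp add: alg_act_def)
  finally show "alg_act k n (f * g) \<Psi> s = alg_act k n f (alg_act k n g \<Psi>) s" .
qed

lemma alg_act_u_gen: "alg_act k n (u_gen i) \<Psi> = gop k n i \<Psi>"
  by (rule ext) (simp add: u_gen_def alg_act_single)

lemma alg_act_u_word: "alg_act k n (u_word as) \<Psi> = wact k n as \<Psi>"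
  by (rule ext) (simp add: u_word_single alg_act_single)

lemma alg_act_scalar: "alg_act k n (scalar c * f) \<Psi> s = ev \<beta> c * alg_act k n f \<Psi> s"
  by (simp add: alg_act_mult) (simp add: scalar_def alg_act_single zero_word_def)

lemma gop_square: "gop k n i (gop k n i \<Psi>) s = \<beta> * gop k n i \<Psi> s"
  by (simp add: gop_def opr_square)

lemma gop_commute:
  assumes "i + 1 < j" "j < n"
  shows "gop k n i (gop k n j \<Psi>) s = gop k n j (gop k n i \<Psi>) s"
proof -
  consider "j < k" | "i < k" "k < j" | "k < i" | "i = k" | "j = k" using assms by linarith
  then show ?thesis
  proof cases
    case 1
    then show ?thesis using assms opr_commute[of i j] by (simp add: gop_def)
  next
    case 2
    then show ?thesis using assms by (auto simp: gop_def opr_def algebra_simps)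
  next
    case 3
    then show ?thesis using assms opr_commute[of "n - j" "n - i"] by (simp add: gop_def)
  qed (use assms in \<open>simp_all add: gop_def\<close>)
qed

text \<open>A braid involving \<open>u_k\<close> is zero on both sides. On the second partition the
  reversal \<open>n - i\<close> interchanges the two words of \<open>opr_braid\<close>, which both
  vanish.\<close>

lemma gop_braid:
  assumes "0 < i" "i + 1 < n"
  shows "gop k n i (gop k n (i + 1) (gop k n i \<Psi>)) s = gop k n (i + 1) (gop k n i (gop k n (i + 1) \<Psi>)) s"
proof -
  consider "i + 1 < k" | "k < i" | "i = k \<or> i + 1 = k" using assms by linarith
  then show ?thesis
  proof cases
    case 1
    then show ?thesis using assms by (simp add: gop_def opr_braid)
  next
    case 2
    have "n - i = Suc (n - (i + 1))" "0 < n - (i + 1)" using assms by auto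
    then show ?thesis using 2 assms opr_braid[of "n - (i + 1)"] by (simp add: gop_def)
  qed (use assms in \<open>auto simp: gop_def\<close>)
qed

lemma gop_four:
  assumes "0 < k"
  shows "gop k n 1 (gop k n 0 (gop k n 1 (gop k n 0 \<Psi>))) s = gop k n 0 (gop k n 1 (gop k n 0 (gop k n 1 \<Psi>))) s"
  using assms opr_four by (cases "k = 1") (auto simp: gop_def)

lemma alg_act_relator:
  assumes "0 < k" "r \<in> relators n"
  shows "alg_act k n r \<Psi> = (\<lambda>_. 0)"
proof (rule ext)
  fix s
  note hom = alg_act_diff alg_act_mult alg_act_u_gen
  consider i where "i < n" "r = u_gen i * u_gen i - scalar beta * u_gen i"
    | "r = u_gen 1 * u_gen 0 * u_gen 1 * u_gen 0 - u_gen 0 * u_gen 1 * u_gen 0 * u_gen 1"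
    | i where "0 < i" "i + 1 < n" "r = u_gen i * u_gen (i + 1) * u_gen i - u_gen (i + 1) * u_gen i * u_gen (i + 1)"
    | i j where "i < n" "j < n" "\<bar>int i - int j\<bar> > 1" "r = u_gen i * u_gen j - u_gen j * u_gen i"
    using assms(2) unfolding relators_def by (auto split: if_splits)
  then show "alg_act k n r \<Psi> s = 0"
  proof cases
    case 1
    then show ?thesis by (simp add: alg_act_diff alg_act_scalar) (simp add: alg_act_mult alg_act_u_gen gop_square)
  next
    case 2
    then show ?thesis using gop_four[OF assms(1)] by (simp add: hom)
  next
    case 3
    then show ?thesis using gop_braid[of i n] by (simp add: hom)
  next
    case 4
    then have "i + 1 < j \<or> j + 1 < i" by linarith
    then show ?thesis using 4 gop_commute[of i j n] gop_commute[of j i n] by (cases s) (auto simp: hom)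
  qed
qed

lemma alg_act_ideal:
  assumes k: "0 < k" and f: "f \<in> rel_ideal n"
  shows "alg_act k n f \<Psi> = (\<lambda>_. 0)"
  using f
proof (induction rule: rel_ideal.induct)
  case (gen r f g)
  have "alg_act k n f (\<lambda>_. 0) = (\<lambda>_. 0)"
  proof (rule ext)
    fix s
    have "wact k n as (\<lambda>_. 0) = (\<lambda>_. 0)" for as by (induction as) auto
    then show "alg_act k n f (\<lambda>_. 0) s = 0" by (simp add: alg_act_def)
  qed
  then show ?case by (simp add: alg_act_mult alg_act_relator[OF k gen(1)])
qed (auto simp: fun_eq_iff alg_act_add)

end

section \<open>Minimal coset representatives\<close>

lemma signed_perms_pinv_mono:
  assumes v: "v \<in> signed_perms n" and S: "strict_mono_on S v" and xy: "x \<in> v ` S" "y \<in> v ` S" "x < y"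
  shows "pinv v x < pinv v y"
proof -
  obtain s t where st: "s \<in> S" "t \<in> S" "x = v s" "y = v t" using xy by auto
  have "pinv v (v z) = z" for z by (rule inv_f_f[OF bij_is_inj[OF signed_perms_bij[OF v]]])
  moreover have "s < t" using strict_mono_on_less[OF S st(1,2)] st xy(3) by simp
  ultimately show ?thesis using st by simp
qed

lemma signed_perms_pinv_mem: "v \<in> signed_perms n \<Longrightarrow> x \<in> v ` S \<Longrightarrow> pinv v x \<in> S"
  using inv_f_f[OF bij_is_inj[OF signed_perms_bij]] by fastforce

text \<open>By \<open>reflection_simple\<close> the generator can destroy monotonicity only at a
  pair of values that it exchanges, and no such pair lies in the image.\<close>

lemma strict_mono_on_cox_gen:
  assumes v: "strict_mono_on S v" and z: "0 \<notin> v ` S"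
    and i: "0 < i \<Longrightarrow> \<not> (int i \<in> v ` S \<and> int i + 1 \<in> v ` S) \<and> \<not> (- int i \<in> v ` S \<and> - int i - 1 \<in> v ` S)"
    and i0: "i = 0 \<Longrightarrow> \<not> (1 \<in> v ` S \<and> - 1 \<in> v ` S)"
  shows "strict_mono_on S (cox_gen i \<circ> v)"
proof (rule strict_mono_onI)
  fix r s assume rs: "r \<in> S" "s \<in> S" "r < s"
  then have lt: "v r < v s" using strict_mono_onD[OF v] by blast
  have mem: "v r \<in> v ` S" "v s \<in> v ` S" using rs by auto
  have nz: "v r \<noteq> 0" "v s \<noteq> 0" using mem z by metis+
  show "(cox_gen i \<circ> v) r < (cox_gen i \<circ> v) s"
  proof (rule ccontr)
    assume "\<not> ?thesis"
    then have "cox_gen i (v s) < cox_gen i (v r)" using lt by (metis comp_apply cox_gen_eq_iff linorder_neqE less_irrefl)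
    note eq = reflection_simple[OF lt nz this]
    have refl: "cox_gen i (v r) = v s" unfolding eq[symmetric] by (simp add: reflection_def)
    show False
    proof (cases "i = 0")
      case True
      then have "v r = - 1 \<and> v s = 1" using refl lt by (auto simp: cox_gen_zero_apply split: if_splits)
      then show False using i0[OF True] mem by auto
    next
      case False
      then have "v r = int i \<and> v s = int i + 1 \<or> v r = - int i - 1 \<and> v s = - int i"
        using refl lt by (auto simp: cox_gen_pos_apply split: if_splits)
      then show False using i False mem by auto
    qed
  qed
qed

lemma cox_gen_0 [simp]: "cox_gen i 0 = 0"
  using cox_gen_eq_0_iff by blast

lemma cox_gen_int: "0 < i \<Longrightarrow> cox_gen i (int m) = int (transpose i (Suc i) m)"
  by (auto simp: cox_gen_pos_apply transpose_def)

lemma cox_gen_image_iff: "z \<in> cox_gen i ` M \<longleftrightarrow> cox_gen i z \<in> M"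
  by (metis cox_gen_involution image_iff)

lemma int_sign_cases: obtains "z = 0" | m where "0 < m" "z = int m" | m where "0 < m" "z = - int m"
  by (metis int_cases2 gr0I of_nat_0 minus_zero)

lemma image_fixed: "(\<And>z. z \<in> M \<Longrightarrow> f z = z) \<Longrightarrow> f ` M = M"
  by force

locale rect_rep =
  fixes a b k :: nat
  assumes k: "0 < k"
begin

abbreviation n :: nat where "n \<equiv> a + b + k"

text \<open>The value set, at the positions \<open>1, ..., k\<close>, of the Grassmannian signed
  permutation of \<open>p\<close>.\<close>

definition Cset :: "nat list \<Rightarrow> int set" where
  "Cset p = {z. z < 0 \<and> nat (- z) \<in> set p \<or> 0 < z \<and> z \<le> int k \<and> nat z \<notin> set p}"

text \<open>Beyond \<open>k\<close> lies the type A block: \<open>Aset\<close> holds the values at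
  its last \<open>a\<close> positions, \<open>Bset\<close> those at the \<open>b\<close> positions
  before them.\<close>

definition Aset :: "nat list \<Rightarrow> int set" where
  "Aset q = {z. int k < z \<and> z \<le> int n \<and> nat (int n + 1 - z) \<in> set q}"

definition Bset :: "nat list \<Rightarrow> int set" where
  "Bset q = {int k<..int n} - Aset q"

text \<open>\<open>v\<close> is the minimal coset representative whose value sets encode the pair \<open>(p, q)\<close>; the action
  of \<open>u\<^sub>i\<close> matches left multiplication by \<open>s\<^sub>i\<close>.\<close>

definition Rep :: "nat list \<Rightarrow> nat list \<Rightarrow> (int \<Rightarrow> int) \<Rightarrow> bool" where
  "Rep p q v \<longleftrightarrow> v \<in> signed_perms n \<and> strict_mono_on {0<..int k} v \<and>
     strict_mono_on {int k<..int (k + b)} v \<and> strict_mono_on {int (k + b)<..int n} v \<and>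
     v ` {0<..int k} = Cset p \<and> v ` {int k<..int (k + b)} = Bset q \<and> v ` {int (k + b)<..int n} = Aset q"

lemma mem_Cset:
  "0 < m \<Longrightarrow> int m \<in> Cset p \<longleftrightarrow> m \<le> k \<and> m \<notin> set p" "0 < m \<Longrightarrow> - int m \<in> Cset p \<longleftrightarrow> m \<in> set p" "0 \<notin> Cset p"
  by (auto simp: Cset_def)

lemma mem_Aset: "int m \<in> Aset q \<longleftrightarrow> k < m \<and> m \<le> n \<and> n + 1 - m \<in> set q" "- int m \<notin> Aset q"
  by (auto simp: Aset_def nat_diff_distrib') (auto simp: nat_diff_distrib' of_nat_diff nat_add_distrib)

lemma mem_Bset: "int m \<in> Bset q \<longleftrightarrow> k < m \<and> m \<le> n \<and> n + 1 - m \<notin> set q" "- int m \<notin> Bset q"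
  using mem_Aset by (auto simp: Bset_def)

definition rem :: "nat \<Rightarrow> nat list \<Rightarrow> nat list \<Rightarrow> bool" where
  "rem i p q \<longleftrightarrow> i < k \<and> removable i p \<or> k < i \<and> i < n \<and> removable (n - i) q"

definition lowp :: "nat \<Rightarrow> nat list \<Rightarrow> nat list" where
  "lowp i p = (if i < k then lower i p else p)"

definition lowq :: "nat \<Rightarrow> nat list \<Rightarrow> nat list" where
  "lowq i q = (if k < i then lower (n - i) q else q)"

text \<open>If the part can be lowered, each value set contains at most one of the two neighbouring
  values exchanged by the generator; replacing one by the other is the effect of lowering.\<close>

lemma low_images:
  assumes p: "parts_le k p" and r: "rem i p q"
  shows "cox_gen i ` Cset p = Cset (lowp i p)" "cox_gen i ` Aset q = Aset (lowq i q)"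
    "cox_gen i ` Bset q = Bset (lowq i q)"
proof -
  consider "i < k" "removable i p" | "k < i" "i < n" "removable (n - i) q" using r by (auto simp: rem_def)
  then have "cox_gen i ` Cset p = Cset (lowp i p) \<and> cox_gen i ` Aset q = Aset (lowq i q)
    \<and> cox_gen i ` {int k<..int n} = {int k<..int n}"
  proof cases
    case 1
    have fixd: "cox_gen i z = z" if "int k < z" for z
      using that 1 by (cases "i = 0") (auto simp: cox_gen_zero_apply cox_gen_pos_apply)
    have "cox_gen i ` Aset q = Aset q" "cox_gen i ` {int k<..int n} = {int k<..int n}"
      by (rule image_fixed, rule fixd, simp add: Aset_def) (rule image_fixed, rule fixd, simp)
    moreover have "cox_gen i ` Cset p = Cset (lower i p)"
    proof (rule Set.set_eqI)
      fix z
      show "z \<in> cox_gen i ` Cset p \<longleftrightarrow> z \<in> Cset (lower i p)"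
      proof (cases "i = 0")
        case True
        have one: "1 \<in> set p" using 1 True by (simp add: removable_def)
        have p1: "int 1 \<in> Cset w \<longleftrightarrow> 1 \<notin> set w" "- int 1 \<in> Cset w \<longleftrightarrow> 1 \<in> set w" for w
          using mem_Cset(1,2)[of 1 w] k by auto
        consider "z = 1" | "z = - 1" | "z \<noteq> 1" "z \<noteq> - 1" by blast
        then show ?thesis
        proof cases
          case 3
          then have "cox_gen i z = z" using True by (simp add: cox_gen_zero_apply)
          moreover have "z \<in> Cset (lower i p) \<longleftrightarrow> z \<in> Cset p"
            using 3 True by (cases z rule: int_sign_cases) (auto simp: mem_Cset mem_lower_0)
          ultimately show ?thesis by (simp add: cox_gen_image_iff)
        qed (use True one p1 in \<open>auto simp: cox_gen_image_iff cox_gen_zero_apply mem_lower_0\<close>)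
      next
        case False
        have t: "0 < transpose i (Suc i) m" if "0 < m" for m using that False by (auto simp: transpose_def)
        have tk: "transpose i (Suc i) m \<le> k \<longleftrightarrow> m \<le> k" for m using 1 by (auto simp: transpose_def)
        have tp: "transpose i (Suc i) m \<in> set p \<longleftrightarrow> m \<in> set (lower i p)" for m
          using 1 False by (auto simp: transpose_def removable_def mem_lower_pos)
        show ?thesis
          by (cases z rule: int_sign_cases)
            (use False t tk tp in \<open>auto simp: cox_gen_image_iff cox_gen_int cox_gen_odd mem_Cset\<close>)
      qed
    qed
    ultimately show ?thesis using 1 by (simp add: lowp_def lowq_def)
  next
    case 2
    have i0: "0 < i" using 2 by simp
    have fixd: "cox_gen i z = z" if "\<bar>z\<bar> \<le> int k" for z
      using that 2 by (auto simp: cox_gen_pos_apply)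
    have "cox_gen i ` Cset p = Cset p"
      using p by (intro image_fixed fixd) (auto simp: Cset_def parts_le_def)
    moreover have tU: "k < transpose i (Suc i) m \<and> transpose i (Suc i) m \<le> n \<longleftrightarrow> k < m \<and> m \<le> n" for m
      using 2 by (auto simp: transpose_def)
    moreover have "cox_gen i ` {int k<..int n} = {int k<..int n}"
    proof (rule Set.set_eqI)
      fix z show "z \<in> cox_gen i ` {int k<..int n} \<longleftrightarrow> z \<in> {int k<..int n}"
        using 2 by (auto simp: cox_gen_image_iff cox_gen_pos_apply split: if_splits)
    qed
    moreover have "cox_gen i ` Aset q = Aset (lower (n - i) q)"
    proof (rule Set.set_eqI)
      fix z
      have tq: "n + 1 - transpose i (Suc i) m \<in> set q \<longleftrightarrow> n + 1 - m \<in> set (lower (n - i) q)" if "k < m" "m \<le> n" for m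
      proof -
        have s: "Suc (n - i) \<in> set q" "n - i \<notin> set q" "0 < n - i" using 2 by (auto simp: removable_def)
        consider "m = i" | "m = Suc i" | "m \<noteq> i" "m \<noteq> Suc i" by blast
        then show ?thesis
        proof cases
          case 1
          then have "n + 1 - m = Suc (n - i)" "n + 1 - transpose i (Suc i) m = n - i" using 2 by auto
          then show ?thesis using s by (simp add: mem_lower_pos)
        next
          case c2: 2
          then have "n + 1 - m = n - i" "n + 1 - transpose i (Suc i) m = Suc (n - i)" using 2 by auto
          then show ?thesis using s by (simp add: mem_lower_pos)
        next
          case 3
          then have "n + 1 - m \<noteq> n - i" "n + 1 - m \<noteq> Suc (n - i)" using 2 that by auto
          then show ?thesis using s 3 by (simp add: mem_lower_pos)
        qed
      qed
      show "z \<in> cox_gen i ` Aset q \<longleftrightarrow> z \<in> Aset (lower (n - i) q)"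
      proof (cases "\<exists>m. z = int m")
        case True
        then obtain m where "z = int m" by auto
        then show ?thesis using tU[of m] tq[of m] by (auto simp: cox_gen_image_iff cox_gen_int[OF i0] mem_Aset)
      next
        case False
        then obtain m where "z = - int m" by (metis int_cases2)
        then show ?thesis by (simp add: cox_gen_image_iff cox_gen_odd cox_gen_int[OF i0] mem_Aset)
      qed
    qed
    ultimately show ?thesis using 2 by (simp add: lowp_def lowq_def)
  qed
  moreover have "inj (cox_gen i)" by (simp add: inj_def)
  ultimately show "cox_gen i ` Cset p = Cset (lowp i p)" "cox_gen i ` Aset q = Aset (lowq i q)"
    "cox_gen i ` Bset q = Bset (lowq i q)"
    unfolding Bset_def by (auto simp: image_set_diff)
qed

text \<open>The set never contains both values of a pair exchanged by the generator, so composing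
  with it keeps a monotone block monotone.\<close>

definition no_clash :: "nat \<Rightarrow> int set \<Rightarrow> bool" where
  "no_clash i M \<longleftrightarrow> 0 \<notin> M \<and> (0 < i \<longrightarrow> \<not> (int i \<in> M \<and> int i + 1 \<in> M) \<and> \<not> (- int i \<in> M \<and> - int i - 1 \<in> M)) \<and>
     (i = 0 \<longrightarrow> \<not> (1 \<in> M \<and> - 1 \<in> M))"

lemma no_clash_image: "no_clash i M \<Longrightarrow> no_clash i (cox_gen i ` M)"
  unfolding no_clash_def cox_gen_image_iff
  by (cases "i = 0") (auto simp: cox_gen_zero_apply cox_gen_pos_apply)

lemma no_clash_rem:
  assumes p: "parts_le k p" and r: "rem i p q"
  shows "no_clash i (Cset p)" "no_clash i (Aset q)" "no_clash i (Bset q)"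
proof -
  have e: "int i + 1 = int (Suc i)" "- int i - 1 = - int (Suc i)" "1 = int 1" by auto
  have z: "0 \<notin> Aset q" "0 \<notin> Bset q" "- 1 \<notin> Aset q" "- 1 \<notin> Bset q" by (auto simp: Aset_def Bset_def)
  consider "i < k" "removable i p" | "k < i" "i < n" "removable (n - i) q" using r by (auto simp: rem_def)
  then have "no_clash i (Cset p) \<and> no_clash i (Aset q) \<and> no_clash i (Bset q)"
  proof cases
    case 1
    have "\<not> (1 \<in> Cset p \<and> - 1 \<in> Cset p)" using mem_Cset(1,2)[of 1 p] by auto
    then show ?thesis
      using 1 z unfolding no_clash_def e(1,2)
      by (auto simp: mem_Cset mem_Aset mem_Bset removable_def simp del: of_nat_Suc)
  next
    case 2
    have "Suc n - i = Suc (n - i)" using 2 by auto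
    then show ?thesis
      using 2 z p unfolding no_clash_def e(1,2)
      by (auto simp: mem_Cset mem_Aset mem_Bset removable_def parts_le_def simp del: of_nat_Suc)
  qed
  then show "no_clash i (Cset p)" "no_clash i (Aset q)" "no_clash i (Bset q)" by auto
qed

lemma strict_mono_no_clash: "strict_mono_on S v \<Longrightarrow> no_clash i (v ` S) \<Longrightarrow> strict_mono_on S (cox_gen i \<circ> v)"
  by (rule strict_mono_on_cox_gen) (auto simp: no_clash_def)

lemma Rep_low:
  assumes p: "parts_le k p" and r: "rem i p q"
  shows "Rep p q v \<Longrightarrow> Rep (lowp i p) (lowq i q) (cox_gen i \<circ> v)"
    and "Rep (lowp i p) (lowq i q) u \<Longrightarrow> Rep p q (cox_gen i \<circ> u)"
proof -
  have i: "i < n" using r by (auto simp: rem_def)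
  note im = low_images[OF p r] and nc = no_clash_rem[OF p r]
  show "Rep (lowp i p) (lowq i q) (cox_gen i \<circ> v)" if "Rep p q v"
    using that nc unfolding Rep_def im[symmetric] image_comp[symmetric]
    by (auto intro!: strict_mono_no_clash signed_perms_comp cox_gen_signed_perms[OF i] simp del: comp_apply)
  have twice: "cox_gen i ` cox_gen i ` M = M" for M by (simp add: image_image)
  show "Rep p q (cox_gen i \<circ> u)" if "Rep (lowp i p) (lowq i q) u"
    using that no_clash_image[OF nc(1)] no_clash_image[OF nc(2)] no_clash_image[OF nc(3)]
    unfolding Rep_def im[symmetric] image_comp[symmetric]
    by (auto intro!: strict_mono_no_clash signed_perms_comp cox_gen_signed_perms[OF i] simp: twice simp del: comp_apply)
qed

text \<open>A left descent compares the positions of \<open>i\<close> and \<open>i + 1\<close>.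
  Inside one block they are in order, otherwise the blocks decide, and among the values up to
  \<open>k\<close> the signs decide. For \<open>i = k\<close> the smaller value always stands first,
  in agreement with the zero action of \<open>u_k\<close>.\<close>

lemma Rep_ldesc_iff:
  assumes p: "parts_le k p" and R: "Rep p q v" and i: "i < n"
  shows "ldesc i v \<longleftrightarrow> rem i p q"
proof -
  have v: "v \<in> signed_perms n" using R by (simp add: Rep_def)
  have C: "strict_mono_on {0<..int k} v" "v ` {0<..int k} = Cset p"
    and B: "strict_mono_on {int k<..int (k + b)} v" "v ` {int k<..int (k + b)} = Bset q"
    and A: "strict_mono_on {int (k + b)<..int n} v" "v ` {int (k + b)<..int n} = Aset q" using R by (auto simp: Rep_def)
  note monoC = signed_perms_pinv_mono[OF v C(1), unfolded C(2)]
  note monoB = signed_perms_pinv_mono[OF v B(1), unfolded B(2)]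
  note monoA = signed_perms_pinv_mono[OF v A(1), unfolded A(2)]
  have memC: "z \<in> Cset p \<Longrightarrow> 0 < pinv v z \<and> pinv v z \<le> int k" for z
    using signed_perms_pinv_mem[OF v, of z "{0<..int k}"] C(2) by auto
  have memB: "z \<in> Bset q \<Longrightarrow> int k < pinv v z \<and> pinv v z \<le> int (k + b)" for z
    using signed_perms_pinv_mem[OF v, of z "{int k<..int (k + b)}"] B(2) by auto
  have memA: "z \<in> Aset q \<Longrightarrow> int (k + b) < pinv v z" for z
    using signed_perms_pinv_mem[OF v, of z "{int (k + b)<..int n}"] A(2) by auto
  have odd: "pinv v (- z) = - pinv v z" for z by (rule signed_perms_inv_odd[OF v])
  have e: "int i + 1 = int (Suc i)" by simp
  have dle: "ldesc i v \<longleftrightarrow> pinv v (int i) > pinv v (int (Suc i))" if "0 < i" using that by (simp add: ldesc_def add.commute)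
  have negC: "m \<in> set p \<Longrightarrow> - int m \<in> Cset p" for m
    using mem_Cset(2)[of m p] p by (cases "m = 0") (auto simp: parts_le_def strict_partition_def)
  have signC: "pinv v (int m) < 0" if "m \<in> set p" for m using memC[OF negC[OF that]] odd[of "int m"] by auto
  have posC: "0 < m \<Longrightarrow> m \<le> k \<Longrightarrow> m \<notin> set p \<Longrightarrow> 0 < pinv v (int m)" for m using memC[of "int m"] mem_Cset(1) by auto
  consider "i = 0" | "0 < i" "i < k" | "i = k" | "k < i" by linarith
  then show ?thesis
  proof cases
    case 1
    have "ldesc 0 v \<longleftrightarrow> 1 \<in> set p"
      using signC[of 1] posC[of 1] k by (cases "1 \<in> set p") (auto simp: ldesc_def)
    then show ?thesis using 1 k p by (auto simp: rem_def removable_def parts_le_def strict_partition_def)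
  next
    case 2
    have both: "pinv v (int i) < pinv v (int (Suc i))" if "i \<notin> set p" "Suc i \<notin> set p"
      using monoC[of "int i" "int (Suc i)"] 2 that by (simp add: mem_Cset del: of_nat_Suc)
    have neg: "pinv v (int i) < pinv v (int (Suc i))" if "i \<in> set p" "Suc i \<in> set p"
      using monoC[of "- int (Suc i)" "- int i"] negC[OF that(1)] negC[OF that(2)] odd[of "int i"] odd[of "int (Suc i)"] by simp
    have "pinv v (int i) < pinv v (int (Suc i))" if "i \<in> set p" "Suc i \<notin> set p"
      using signC[OF that(1)] posC[of "Suc i"] that 2 by auto
    moreover have "pinv v (int i) > pinv v (int (Suc i))" if "i \<notin> set p" "Suc i \<in> set p"
      using signC[OF that(2)] posC[of i] that 2 by auto
    ultimately show ?thesis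
      using both neg 2 unfolding dle[OF 2(1)] rem_def removable_def by (metis less_asym not_less_iff_gr_or_eq)
  next
    case 3
    have "pinv v (int k) \<le> int k" using memC[of "int k"] signC[of k] mem_Cset(1)[of k p] k by (cases "k \<in> set p") auto
    moreover have "int k < pinv v (int (Suc k))"
    proof (cases "int (Suc k) \<in> Aset q")
      case True
      then show ?thesis using memA by fastforce
    next
      case False
      then have "int (Suc k) \<in> Bset q" using 3 i by (auto simp: Bset_def)
      then show ?thesis using memB by blast
    qed
    ultimately show ?thesis using 3 k dle by (auto simp: rem_def)
  next
    case 4
    have "n + 1 - i = Suc (n - i)" "n + 1 - Suc i = n - i" using i by auto
    then have mA: "int i \<in> Aset q \<longleftrightarrow> Suc (n - i) \<in> set q" "int (Suc i) \<in> Aset q \<longleftrightarrow> n - i \<in> set q"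
      and mB: "int i \<in> Bset q \<longleftrightarrow> Suc (n - i) \<notin> set q" "int (Suc i) \<in> Bset q \<longleftrightarrow> n - i \<notin> set q"
      using 4 i by (simp_all only: mem_Aset mem_Bset) auto
    have "pinv v (int i) < pinv v (int (Suc i))" if "Suc (n - i) \<in> set q" "n - i \<in> set q"
      using monoA[of "int i" "int (Suc i)"] mA that by simp
    moreover have "pinv v (int i) < pinv v (int (Suc i))" if "Suc (n - i) \<notin> set q" "n - i \<notin> set q"
      using monoB[of "int i" "int (Suc i)"] mB that by simp
    moreover have "pinv v (int i) < pinv v (int (Suc i))" if "Suc (n - i) \<notin> set q" "n - i \<in> set q"
      using memA[of "int (Suc i)"] memB[of "int i"] mA mB that by simp
    moreover have "pinv v (int i) > pinv v (int (Suc i))" if "Suc (n - i) \<in> set q" "n - i \<notin> set q"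
      using memA[of "int i"] memB[of "int (Suc i)"] mA mB that by simp
    ultimately show ?thesis
      using 4 i dle unfolding rem_def removable_def by (metis less_asym gr_implies_not0 gr0I)
  qed
qed

text \<open>The second partition of the identity, whose last \<open>a\<close> positions carry the
  \<open>a\<close> largest values.\<close>

definition init :: "nat list" where "init = rev [1..<Suc a]"

lemma set_init: "set init = {1..a}"
  unfolding init_def by (simp add: atLeastLessThanSuc_atLeastAtMost del: upt_Suc)

lemma init_sorted: "sorted_wrt (>) init"
  unfolding init_def by (simp only: sorted_wrt_rev) (simp add: sorted_wrt_upt del: upt_Suc)

lemma Rep_id: "Rep [] init id"
proof -
  have "Cset [] = {0<..int k}" by (auto simp: Cset_def)
  moreover have "Aset init = {int (k + b)<..int n}" unfolding Aset_def set_init by auto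
  ultimately show ?thesis
    unfolding Rep_def Bset_def by (auto simp: id_signed_perms strict_mono_on_def)
qed

lemma Rep_id_unique:
  assumes "Rep p q id" "parts_le k p" "parts_le (a + b) q"
  shows "p = [] \<and> q = init"
proof -
  have "Cset p = {0<..int k}" "Aset q = {int (k + b)<..int n}" using assms(1) by (auto simp: Rep_def)
  have "set p = {}"
  proof (rule equals0I)
    fix m assume m: "m \<in> set p"
    then have "0 < m" using assms(2) by (auto simp: parts_le_def strict_partition_def intro: gr0I)
    then have "- int m \<in> Cset p" using m mem_Cset(2) by simp
    then show False using \<open>Cset p = {0<..int k}\<close> by simp
  qed
  moreover have "set q = {1..a}"
  proof (rule Set.set_eqI)
    fix m
    show "m \<in> set q \<longleftrightarrow> m \<in> {1..a}"
    proof (cases "0 < m \<and> m \<le> a + b")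
      case True
      then have "int (n + 1 - m) \<in> Aset q \<longleftrightarrow> m \<in> set q" by (subst mem_Aset) auto
      moreover have "int (n + 1 - m) \<in> {int (k + b)<..int n} \<longleftrightarrow> m \<le> a" using True by auto
      ultimately show ?thesis using \<open>Aset q = _\<close> True by simp
    next
      case False
      then show ?thesis using assms(3) by (auto simp: parts_le_def strict_partition_def)
    qed
  qed
  ultimately show ?thesis
    using strict_dec_eqI[OF _ init_sorted, of q] set_init assms(3) by (auto simp: parts_le_def strict_partition_def)
qed

lemma not_rem_init: "\<not> rem i [] init"
  by (auto simp: rem_def removable_def set_init)

lemma parts_low: "parts_le k p \<Longrightarrow> parts_le (a + b) q \<Longrightarrow> rem i p q \<Longrightarrow> parts_le k (lowp i p) \<and> parts_le (a + b) (lowq i q)"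
  by (auto simp: rem_def lowp_def lowq_def removable_def intro: parts_le_lower)

text \<open>The pair alone determines the left descents, so a common descent can be removed from
  both permutations until both are the identity.\<close>

lemma Rep_unique:
  assumes "Rep p q v" "Rep p q w" "parts_le k p" "parts_le (a + b) q"
  shows "v = w"
  using assms
proof (induction "cox_length n v" arbitrary: v w p q)
  case 0
  have v: "v \<in> signed_perms n" and w: "w \<in> signed_perms n" using 0 by (auto simp: Rep_def)
  have "v = id" by (rule no_ldesc_id[OF v]) (use cox_length_ldesc[OF v] 0 in fastforce)
  then have "p = [] \<and> q = init" using Rep_id_unique 0 by blast
  then have "w = id" using no_ldesc_id[OF w] Rep_ldesc_iff[OF 0(4,3)] not_rem_init by blast
  then show ?case using \<open>v = id\<close> by simp
next
  case (Suc m)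
  have v: "v \<in> signed_perms n" using Suc.prems by (auto simp: Rep_def)
  have "\<exists>i<n. ldesc i v"
  proof (rule ccontr)
    assume "\<not> ?thesis"
    then have "v = id" using no_ldesc_id[OF v] by blast
    then show False using Suc.hyps(2) cox_length_le[of "[]" n] by simp
  qed
  then obtain i where i: "i < n" "ldesc i v" by blast
  have r: "rem i p q" using Rep_ldesc_iff[OF Suc.prems(3,1) i(1)] i by simp
  have "m = cox_length n (cox_gen i \<circ> v)" using cox_length_ldesc[OF v i] Suc.hyps(2) by simp
  from Suc.hyps(1)[OF this Rep_low(1)[OF Suc.prems(3) r Suc.prems(1)] Rep_low(1)[OF Suc.prems(3) r Suc.prems(2)]]
  have "cox_gen i \<circ> v = cox_gen i \<circ> w" using parts_low[OF Suc.prems(3,4) r] by simp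
  then have "cox_gen i \<circ> (cox_gen i \<circ> v) = cox_gen i \<circ> (cox_gen i \<circ> w)" by simp
  then show ?case by (simp only: cox_gen_comp_self)
qed

end

context beta_real
begin

definition delta :: "nat \<Rightarrow> vec" where
  "delta a s = (if s = ([], rev [1..<Suc a]) then 1 else 0)"

text \<open>Along a reduced word the \<open>\<beta>\<close> term of each operator drops out: it is a
  value of the shorter element at the unchanged pair, which would force on that element the left
  descent just removed. Only the lowered pair contributes, with coefficient 1.\<close>

lemma wact_reduced:
  fixes a b k :: nat
  defines "n \<equiv> a + b + k"
  assumes k: "0 < k"
  shows "v \<in> signed_perms n \<Longrightarrow> reduced_word n v bs \<Longrightarrow> parts_le k p \<Longrightarrow> parts_le (a + b) q \<Longrightarrow>
    (wact k n bs (delta a) (p, q) \<noteq> 0 \<longrightarrow> rect_rep.Rep a b k p q v) \<and>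
    (rect_rep.Rep a b k p q v \<longrightarrow> wact k n bs (delta a) (p, q) = 1)"
proof -
  interpret rect_rep a b k by unfold_locales (rule k)
  have gop: "gop k n i \<Psi> (p, q) = (if rem i p q then \<beta> * \<Psi> (p, q) + \<Psi> (lowp i p, lowq i q) else 0)"
    if "i < n" for i p q \<Psi>
    using that unfolding n_def by (auto simp: gop_def opr_def rem_def lowp_def lowq_def)
  show "v \<in> signed_perms n \<Longrightarrow> reduced_word n v bs \<Longrightarrow> parts_le k p \<Longrightarrow> parts_le (a + b) q \<Longrightarrow>
    (wact k n bs (delta a) (p, q) \<noteq> 0 \<longrightarrow> Rep p q v) \<and> (Rep p q v \<longrightarrow> wact k n bs (delta a) (p, q) = 1)"
  proof (induction bs arbitrary: v p q)
    case Nil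
    then have v: "v = id" by (simp add: reduced_word_def)
    have d: "delta a (p, q) = (if p = [] \<and> q = init then 1 else 0)"
      by (simp add: delta_def init_def del: upt_Suc)
    show ?case
    proof (cases "p = [] \<and> q = init")
      case True
      then have "Rep p q id" using Rep_id by simp
      then show ?thesis unfolding v wact_simps d using True by (simp only: simp_thms if_True)
    next
      case False
      then have "\<not> Rep p q id" using Rep_id_unique[OF _ Nil.prems(3,4)] by blast
      then show ?thesis unfolding v wact_simps d using False by (simp only: simp_thms if_False)
    qed
  next
    case (Cons i bs)
    note v = Cons.prems(1) and p = Cons.prems(3) and q = Cons.prems(4)
    have i: "i < n" using Cons.prems(2) by (simp add: reduced_word_def)
    have red: "ldesc i v" "reduced_word n (cox_gen i \<circ> v) bs" using reduced_word_Cons(2)[OF v i Cons.prems(2)] by auto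
    let ?x = "cox_gen i \<circ> v" and ?\<Psi> = "wact k n bs (delta a)"
    have x: "?x \<in> signed_perms n" using v i by (intro signed_perms_comp cox_gen_signed_perms)
    have nd: "\<not> ldesc i ?x" using ldesc_cox_gen[OF v] red(1) by simp
    show ?case
    proof (cases "rem i p q")
      case False
      have "\<not> Rep p q v" using Rep_ldesc_iff[OF p _ i[unfolded n_def]] red(1) False by blast
      then show ?thesis using gop[OF i] False by simp
    next
      case True
      note pl = parts_low[OF p q True]
      have "\<not> Rep p q ?x" using Rep_ldesc_iff[OF p _ i[unfolded n_def]] nd True by blast
      then have "?\<Psi> (p, q) = 0" using Cons.IH[OF x red(2) p q] by blast
      then have val: "wact k n (i # bs) (delta a) (p, q) = ?\<Psi> (lowp i p, lowq i q)" using gop[OF i] True by simp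
      have "Rep (lowp i p) (lowq i q) ?x \<longleftrightarrow> Rep p q v"
      proof
        assume "Rep (lowp i p) (lowq i q) ?x"
        from Rep_low(2)[OF p True this] show "Rep p q v" by (simp only: cox_gen_comp_self)
      qed (rule Rep_low(1)[OF p True])
      then show ?thesis unfolding val using Cons.IH[OF x red(2)] pl by blast
    qed
  qed
qed

end

section \<open>The permutation of the theorem\<close>

lemma of_one_line_odd: "of_one_line xs (- i) = - of_one_line xs i"
  by (auto simp: of_one_line_def)

lemma of_one_line_signed_perms:
  assumes len: "length xs = n" and abs: "abs ` set xs = {1..int n}"
  shows "of_one_line xs \<in> signed_perms n"
proof -
  let ?S = "{- int n..int n} - {0}" and ?f = "of_one_line xs"
  have "set (map abs xs) = {1..int n}" using abs by simp
  then have "card (set (map abs xs)) = length (map abs xs)" using len by simp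
  then have dist: "distinct (map abs xs)" by (rule card_distinct)
  have absf: "\<bar>?f i\<bar> = map abs xs ! nat (\<bar>i\<bar> - 1)" if "i \<in> ?S" for i
    using that len by (auto simp: of_one_line_def)
  have idx: "nat (\<bar>i\<bar> - 1) < length (map abs xs)" if "i \<in> ?S" for i using that len by auto
  have inj: "inj_on ?f ?S"
  proof (rule inj_onI)
    fix i j assume ij: "i \<in> ?S" "j \<in> ?S" "?f i = ?f j"
    then have "map abs xs ! nat (\<bar>i\<bar> - 1) = map abs xs ! nat (\<bar>j\<bar> - 1)" using absf by metis
    then have "nat (\<bar>i\<bar> - 1) = nat (\<bar>j\<bar> - 1)" using nth_eq_iff_index_eq[OF dist] idx ij by blast
    then have "\<bar>i\<bar> = \<bar>j\<bar>" using ij by auto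
    then have "i = j \<or> i = - j" by linarith
    moreover have "?f i \<noteq> 0"
    proof -
      have "\<bar>?f i\<bar> \<in> set (map abs xs)" unfolding absf[OF ij(1)] using idx[OF ij(1)] by (rule nth_mem)
      then show ?thesis using abs by auto
    qed
    ultimately show "i = j" using ij(3) of_one_line_odd[of xs j] by auto
  qed
  have "?f ` ?S \<subseteq> ?S"
  proof
    fix z assume "z \<in> ?f ` ?S"
    then obtain i where i: "z = ?f i" "i \<in> ?S" by (rule imageE)
    have "\<bar>z\<bar> \<in> set (map abs xs)" unfolding i(1) absf[OF i(2)] using idx[OF i(2)] by (rule nth_mem)
    then have "\<bar>z\<bar> \<in> {1..int n}" using abs by auto
    then show "z \<in> ?S" by auto
  qed
  then have "?f ` ?S = ?S" using inj by (intro endo_inj_surj) auto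
  then have "?f permutes ?S"
    using inj len by (intro bij_imp_permutes) (auto simp: bij_betw_def of_one_line_def)
  then show ?thesis by (simp add: signed_perms_def of_one_line_odd)
qed

lemma signed_perms_mono: "k \<le> n \<Longrightarrow> signed_perms k \<subseteq> signed_perms n"
  by (auto simp: signed_perms_def intro: permutes_subset)

lemma block_perm_apply:
  "0 < i \<Longrightarrow> i \<le> int k \<Longrightarrow> block_perm a b k i = i"
  "int k < i \<Longrightarrow> i \<le> int (k + b) \<Longrightarrow> block_perm a b k i = i + int a"
  "int (k + b) < i \<Longrightarrow> i \<le> int (a + b + k) \<Longrightarrow> block_perm a b k i = i - int b"
  by (auto simp: block_perm_def Let_def of_one_line_def nth_append nat_less_iff)

lemma block_perm_signed_perms: "block_perm a b k \<in> signed_perms (a + b + k)"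
  unfolding block_perm_def Let_def
proof (rule of_one_line_signed_perms)
  let ?xs = "[1..int k] @ [int (a + k) + 1..int (a + b + k)] @ [int k + 1..int (a + k)]"
  show "length ?xs = a + b + k" by simp
  have "set ?xs = {1..int (a + b + k)}" by auto
  moreover have "abs ` {1..int (a + b + k)} = {1..int (a + b + k)}" by force
  ultimately show "abs ` set ?xs = {1..int (a + b + k)}" by simp
qed

context rect_rep
begin

text \<open>Exactly one of \<open>m\<close> and \<open>- m\<close> is the value at a positive
  position, so the negative values determine the positive ones.\<close>

lemma Cset_image:
  assumes w: "w \<in> signed_perms k" and neg: "w ` {0<..int k} \<inter> {..<0} = (\<lambda>p. - int p) ` set la"
    and la: "parts_le k la"
  shows "w ` {0<..int k} = Cset la"
proof (rule Set.set_eqI)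
  fix z
  have bij: "inj w" using signed_perms_bij[OF w] by (rule bij_is_inj)
  have pos_range: "\<bar>w i\<bar> \<le> int k \<and> w i \<noteq> 0" if "i \<noteq> 0" "\<bar>i\<bar> \<le> int k" for i
    using permutes_in_image[of w "{- int k..int k} - {0}" i] w that by (auto simp: signed_perms_def)
  have negm: "- int m \<in> w ` {0<..int k} \<longleftrightarrow> m \<in> set la" if "0 < m" for m
  proof -
    have "- int m \<in> w ` {0<..int k} \<longleftrightarrow> - int m \<in> w ` {0<..int k} \<inter> {..<0}" using that by simp
    also have "\<dots> \<longleftrightarrow> m \<in> set la" unfolding neg by (simp add: image_iff)
    finally show ?thesis .
  qed
  have posm: "int m \<in> w ` {0<..int k} \<longleftrightarrow> m \<le> k \<and> m \<notin> set la" if m: "0 < m" for m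
  proof (cases "m \<le> k")
    case True
    define i where "i = pinv w (int m)"
    have wi: "w i = int m" unfolding i_def by (rule signed_perms_f_inv[OF w])
    have i: "i \<noteq> 0" "\<bar>i\<bar> \<le> int k"
      using signed_perms_inv_zero[OF w, of "int m"] signed_perms_inv_range[OF w, of "int m"] m True by (auto simp: i_def)
    have wni: "w (- i) = - int m" using wi signed_perms_odd[OF w] by simp
    have "int m \<in> w ` {0<..int k} \<longleftrightarrow> 0 < i"
      unfolding wi[symmetric] using inj_image_mem_iff[OF bij, of i "{0<..int k}"] i by auto
    moreover have "- int m \<in> w ` {0<..int k} \<longleftrightarrow> i < 0"
      unfolding wni[symmetric] using inj_image_mem_iff[OF bij, of "- i" "{0<..int k}"] i by auto
    ultimately show ?thesis using negm[OF m] True i by auto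
  next
    case False
    have "int m \<notin> w ` {0<..int k}"
    proof
      assume "int m \<in> w ` {0<..int k}"
      then obtain i where "i \<in> {0<..int k}" "w i = int m" by force
      then show False using pos_range[of i] False by auto
    qed
    then show ?thesis using False by simp
  qed
  have "0 \<notin> w ` {0<..int k}" using pos_range by force
  then show "z \<in> w ` {0<..int k} \<longleftrightarrow> z \<in> Cset la"
    by (cases z rule: int_sign_cases) (auto simp: mem_Cset negm posm)
qed

text \<open>The last \<open>a\<close> positions carry the values \<open>k + 1, ..., k + a\<close>;
  read from the top these are the parts \<open>a + b, ..., b + 1\<close>.\<close>

lemma Rep_target:
  assumes g: "g \<in> signed_perms k" "strict_mono_on {0<..int k} g" "g ` {0<..int k} = Cset la"
  shows "Rep la (rev [Suc b..<Suc (a + b)]) (g \<circ> block_perm a b k)"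
proof -
  let ?w = "g \<circ> block_perm a b k" and ?q = "rev [Suc b..<Suc (a + b)]"
  have gfix: "g z = z" if "int k < z" for z
    using permutes_not_in[of g "{- int k..int k} - {0}" z] g(1) that by (auto simp: signed_perms_def)
  have w1: "?w z = g z" if "z \<in> {0<..int k}" for z using that block_perm_apply(1) by auto
  have w2: "?w z = z + int a" if "z \<in> {int k<..int (k + b)}" for z using that block_perm_apply(2)[of k z b a] gfix[of "z + int a"] by auto
  have w3: "?w z = z - int b" if "z \<in> {int (k + b)<..int n}" for z using that block_perm_apply(3)[of k b z a] gfix[of "z - int b"] by auto
  have A: "Aset ?q = {int k<..int (k + a)}" unfolding Aset_def set_rev set_upt by auto
  have B: "Bset ?q = {int (k + a)<..int n}" unfolding Bset_def A by auto
  have i1: "?w ` {0<..int k} = Cset la" unfolding g(3)[symmetric] by (rule image_cong[OF refl w1])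
  have i2: "?w ` {int k<..int (k + b)} = Bset ?q"
  proof -
    have "?w ` {int k<..int (k + b)} = (\<lambda>z. z + int a) ` {int k<..int (k + b)}" by (rule image_cong[OF refl w2])
    also have "\<dots> = {int (k + a)<..int n}"
    proof (rule Set.set_eqI)
      fix z show "z \<in> (\<lambda>z. z + int a) ` {int k<..int (k + b)} \<longleftrightarrow> z \<in> {int (k + a)<..int n}"
        by (auto intro!: image_eqI[of _ _ "z - int a"])
    qed
    finally show ?thesis unfolding B .
  qed
  have i3: "?w ` {int (k + b)<..int n} = Aset ?q"
  proof -
    have "?w ` {int (k + b)<..int n} = (\<lambda>z. z - int b) ` {int (k + b)<..int n}" by (rule image_cong[OF refl w3])
    also have "\<dots> = {int k<..int (k + a)}"
    proof (rule Set.set_eqI)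
      fix z show "z \<in> (\<lambda>z. z - int b) ` {int (k + b)<..int n} \<longleftrightarrow> z \<in> {int k<..int (k + a)}"
        by (auto intro!: image_eqI[of _ _ "z + int b"])
    qed
    finally show ?thesis unfolding A .
  qed
  have "?w \<in> signed_perms n"
    using g(1) signed_perms_mono[of k n] block_perm_signed_perms by (intro signed_perms_comp) auto
  moreover have "strict_mono_on {0<..int k} ?w"
    using strict_mono_onD[OF g(2)] w1 by (intro strict_mono_onI) auto
  moreover have "strict_mono_on {int k<..int (k + b)} ?w" "strict_mono_on {int (k + b)<..int n} ?w"
  proof -
    show "strict_mono_on {int k<..int (k + b)} ?w"
    proof (rule strict_mono_onI)
      fix r s assume "r \<in> {int k<..int (k + b)}" "s \<in> {int k<..int (k + b)}" "r < s"
      then show "?w r < ?w s" using w2[of r] w2[of s] by (simp del: comp_apply)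
    qed
    show "strict_mono_on {int (k + b)<..int n} ?w"
    proof (rule strict_mono_onI)
      fix r s assume "r \<in> {int (k + b)<..int n}" "s \<in> {int (k + b)<..int n}" "r < s"
      then show "?w r < ?w s" using w3[of r] w3[of s] by (simp del: comp_apply)
    qed
  qed
  ultimately show ?thesis unfolding Rep_def using i1 i2 i3 by blast
qed

end

text \<open>Listing the prescribed value set in increasing order gives existence; uniqueness is
  \<open>Rep_unique\<close> for \<open>a = b = 0\<close>. Together they resolve the definite
  description.\<close>

lemma grassmannian_spec:
  assumes k: "0 < k" and la: "parts_le k la"
  shows "grassmannian la k \<in> signed_perms k" "strict_mono_on {0<..int k} (grassmannian la k)"
    "grassmannian la k ` {0<..int k} = rect_rep.Cset k la"
proof -
  interpret rect_rep 0 0 k by unfold_locales (rule k)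
  have iv: "{1..int k} = {0<..int k}" by auto
  let ?P = "\<lambda>w. w \<in> signed_perms k \<and> strict_mono_on {1..int k} w \<and> w ` {1..int k} \<inter> {..<0} = (\<lambda>p. - int p) ` set la"
  have "\<exists>w. ?P w"
  proof -
    define xs where "xs = sorted_list_of_set (Cset la)"
    have sub: "Cset la \<subseteq> {- int k..int k}" using la by (auto simp: Cset_def parts_le_def)
    then have fin: "finite (Cset la)" by (rule finite_subset) simp
    have abs: "abs ` Cset la = {1..int k}"
    proof (rule Set.set_eqI)
      fix z
      show "z \<in> abs ` Cset la \<longleftrightarrow> z \<in> {1..int k}"
      proof
        assume "z \<in> abs ` Cset la"
        then obtain y where y: "z = \<bar>y\<bar>" "y \<in> Cset la" by (rule imageE)
        then have "y \<noteq> 0" "y \<in> {- int k..int k}" using sub mem_Cset(3)[of la] by auto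
        then show "z \<in> {1..int k}" using y(1) by auto
      next
        assume z: "z \<in> {1..int k}"
        then have nz: "0 < nat z" "z = \<bar>int (nat z)\<bar>" "z = \<bar>- int (nat z)\<bar>" "nat z \<le> k" by auto
        show "z \<in> abs ` Cset la"
        proof (cases "nat z \<in> set la")
          case True
          then have "- int (nat z) \<in> Cset la" using mem_Cset(2)[OF nz(1)] by blast
          then show ?thesis by (rule image_eqI[where f = abs, OF nz(3)])
        next
          case False
          then have "int (nat z) \<in> Cset la" using mem_Cset(1)[OF nz(1)] nz(4) by blast
          then show ?thesis by (rule image_eqI[where f = abs, OF nz(2)])
        qed
      qed
    qed
    have inj: "inj_on abs (Cset la)"
    proof (rule inj_onI)
      fix x y assume xy: "x \<in> Cset la" "y \<in> Cset la" "\<bar>x\<bar> = \<bar>y\<bar>"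
      then have "x = y \<or> x = - y" by linarith
      moreover have "\<not> (z \<in> Cset la \<and> - z \<in> Cset la)" for z
        by (cases z rule: int_sign_cases) (auto simp: mem_Cset)
      ultimately show "x = y" using xy by auto
    qed
    have len: "length xs = k" unfolding xs_def using card_image[OF inj] abs by simp
    have sx: "set xs = Cset la" unfolding xs_def using fin by simp
    let ?w = "of_one_line xs"
    have w: "?w \<in> signed_perms k" by (rule of_one_line_signed_perms[OF len]) (simp add: sx abs)
    have nth: "?w i = xs ! nat (i - 1)" if "i \<in> {1..int k}" for i using that len by (auto simp: of_one_line_def)
    have srt: "sorted_wrt (<) xs" unfolding xs_def by simp
    have "strict_mono_on {1..int k} ?w"
    proof (rule strict_mono_onI)
      fix r s assume rs: "r \<in> {1..int k}" "s \<in> {1..int k}" "r < s"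
      then have "nat (r - 1) < nat (s - 1)" "nat (s - 1) < length xs" using len by auto
      then show "?w r < ?w s" unfolding nth[OF rs(1)] nth[OF rs(2)] by (rule sorted_wrt_nth_less[OF srt])
    qed
    moreover have "?w ` {1..int k} = Cset la"
    proof -
      have "?w ` {1..int k} = (\<lambda>i. xs ! i) ` {..<k}"
      proof -
        have "?w ` {1..int k} = (\<lambda>i. xs ! nat (i - 1)) ` {1..int k}" by (rule image_cong[OF refl nth])
        also have "\<dots> = (\<lambda>i. xs ! i) ` (\<lambda>i. nat (i - 1)) ` {1..int k}" by (simp add: image_image)
        also have "(\<lambda>i. nat (i - 1)) ` {1..int k} = {..<k}"
        proof (rule Set.set_eqI)
          fix m show "m \<in> (\<lambda>i. nat (i - 1)) ` {1..int k} \<longleftrightarrow> m \<in> {..<k}"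
            by (auto intro!: image_eqI[of _ _ "int m + 1"])
        qed
        finally show ?thesis .
      qed
      also have "\<dots> = set xs" using len by (auto simp: set_conv_nth)
      finally show ?thesis using sx by simp
    qed
    moreover have "Cset la \<inter> {..<0} = (\<lambda>p. - int p) ` set la"
    proof (rule Set.set_eqI)
      fix z
      have pos: "0 < m" if "m \<in> set la" for m using that la by (auto simp: parts_le_def strict_partition_def intro: gr0I)
      show "z \<in> Cset la \<inter> {..<0} \<longleftrightarrow> z \<in> (\<lambda>p. - int p) ` set la"
        using pos by (cases z rule: int_sign_cases) (auto simp: mem_Cset image_iff)
    qed
    ultimately show ?thesis using w by blast
  qed
  moreover have "w = w'" if P: "?P w" "?P w'" for w w'
  proof -
    have "Rep la [] w" if "?P w" for w
    proof -
      have "w ` {0<..int k} = Cset la" by (rule Cset_image) (use that la iv in auto)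
      then show ?thesis using that unfolding Rep_def iv by (auto simp: Bset_def Aset_def)
    qed
    from this[OF P(1)] this[OF P(2)] show ?thesis by (rule Rep_unique[OF _ _ la parts_le_Nil])
  qed
  ultimately have "\<exists>!w. ?P w" by (rule ex_ex1I)
  from theI'[OF this] have P: "?P (grassmannian la k)" unfolding grassmannian_def .
  then show "grassmannian la k \<in> signed_perms k" by blast
  from P show "strict_mono_on {0<..int k} (grassmannian la k)" unfolding iv by blast
  show "grassmannian la k ` {0<..int k} = Cset la" by (rule Cset_image[OF _ _ la]) (use P in \<open>unfold iv, blast+\<close>)
qed

theorem u_coeff_matrix:
  fixes a b k :: nat
  defines "n \<equiv> a + b + k"
  assumes k: "0 < k" and la: "parts_le k la" and f: "f \<in> free_alg_on n" and \<beta>: "\<beta> > 0"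
  shows "ev \<beta> (u_coeff n (grassmannian la k \<circ> block_perm a b k) f)
    = beta_real.alg_act \<beta> k n f (beta_real.delta a) (la, rev [Suc b..<Suc (a + b)])"
proof -
  let ?w = "grassmannian la k \<circ> block_perm a b k" and ?q = "rev [Suc b..<Suc (a + b)]"
  interpret rect_rep a b k by unfold_locales (rule k)
  have R: "Rep la ?q ?w" by (rule Rep_target) (rule grassmannian_spec[OF k la])+
  have q: "parts_le (a + b) ?q"
    unfolding parts_le_def strict_partition_def by (auto simp: sorted_wrt_rev sorted_wrt_upt simp del: upt_Suc)
  \<comment> \<open>The value 0 for \<open>c \<le> 0\<close> extends the functional to all reals,
    keeping it additive and compatible with scalars where \<open>beta_real\<close> does not
    apply.\<close>
  define \<phi> where "\<phi> c f = (if c > 0 then beta_real.alg_act c k n f (beta_real.delta a) (la, ?q) else 0)" for c f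
  have "ev \<beta> (u_coeff n ?w f) = \<phi> \<beta> f"
  proof (rule u_coeff_eval[of \<phi> n ?w f \<beta>])
    fix c :: real and g h
    show "\<phi> c (g + h) = \<phi> c g + \<phi> c h" by (simp add: \<phi>_def beta_real.alg_act_add beta_real.intro)
  next
    fix c :: real and d g
    show "\<phi> c (scalar d * g) = ev c d * \<phi> c g" by (simp add: \<phi>_def beta_real.alg_act_scalar beta_real.intro)
  next
    fix c :: real and g assume "c > 0" "g \<in> rel_ideal n"
    then show "\<phi> c g = 0" using beta_real.alg_act_ideal[OF beta_real.intro k] by (simp add: \<phi>_def)
  next
    fix c :: real and v assume c: "c > 0" and v: "v \<in> signed_perms n"
    interpret br: beta_real c by (rule beta_real.intro[OF c])
    obtain bs where bs: "reduced_word n v bs" "u_perm n v = u_word bs"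
      using reduced_word_exists[OF v] unfolding u_perm_def by (metis someI_ex)
    have val: "\<phi> c (u_perm n v) = br.wact k n bs (br.delta a) (la, ?q)"
      using c by (simp add: \<phi>_def bs(2) br.alg_act_u_word)
    note red = br.wact_reduced[OF k, of v a b bs la ?q, folded n_def, OF v bs(1) la q]
    show "\<phi> c (u_perm n v) = (if v = ?w then 1 else 0)"
    proof (cases "v = ?w")
      case True
      then show ?thesis using red R val by simp
    next
      case False
      then have "\<not> Rep la ?q v" using Rep_unique[OF _ R la q] by blast
      then show ?thesis using red val False by auto
    qed
  next
    show "?w \<in> signed_perms n" using R unfolding Rep_def n_def by blast
  qed (use f \<beta> in auto)
  then show ?thesis using \<beta> by (simp add: \<phi>_def)
qed

section \<open>Specialisation of power series\<close>

definition mpow :: "(nat \<Rightarrow> real) \<Rightarrow> monomial \<Rightarrow> real" where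
  "mpow x m = (\<Prod>i\<in>Poly_Mapping.keys m. x i ^ Poly_Mapping.lookup m i)"

lemma mpow_superset:
  assumes "finite K" "Poly_Mapping.keys m \<subseteq> K"
  shows "mpow x m = (\<Prod>i\<in>K. x i ^ Poly_Mapping.lookup m i)"
  unfolding mpow_def by (rule prod.mono_neutral_left) (use assms in \<open>auto simp: in_keys_iff\<close>)

lemma mpow_zero [simp]: "mpow x 0 = 1"
  by (simp add: mpow_def)

lemma mpow_single [simp]: "mpow x (Poly_Mapping.single i (Suc 0)) = x i"
  by (simp add: mpow_superset[of "{i}"])

lemma mpow_add: "mpow x (p + q) = mpow x p * mpow x q"
proof -
  let ?K = "Poly_Mapping.keys p \<union> Poly_Mapping.keys q"
  have "Poly_Mapping.keys (p + q) \<subseteq> ?K" by (rule Poly_Mapping.keys_add)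
  then show ?thesis by (simp add: mpow_superset[of ?K] lookup_add power_add prod.distrib)
qed

lemma mpow_sum: "mpow x (sum f A) = (\<Prod>a\<in>A. mpow x (f a))"
  by (induction A rule: infinite_finite_induct) (auto simp: mpow_add)

definition mps_supp :: "'a :: zero mps \<Rightarrow> monomial set" where
  "mps_supp Q = {m. mps_coeff Q m \<noteq> 0}"

text \<open>Intended for finite support. Applying \<open>\<phi>\<close> to the coefficients lets a
  series over the free algebra be read through a matrix coefficient, which is additive but not
  multiplicative.\<close>

definition mps_eval :: "(nat \<Rightarrow> real) \<Rightarrow> ('a :: zero \<Rightarrow> real) \<Rightarrow> 'a mps \<Rightarrow> real" where
  "mps_eval x \<phi> Q = (\<Sum>m\<in>mps_supp Q. mpow x m * \<phi> (mps_coeff Q m))"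

lemma mps_eval_superset:
  assumes "finite A" "mps_supp Q \<subseteq> A" "\<phi> 0 = 0"
  shows "mps_eval x \<phi> Q = (\<Sum>m\<in>A. mpow x m * \<phi> (mps_coeff Q m))"
  unfolding mps_eval_def by (rule sum.mono_neutral_left) (use assms in \<open>auto simp: mps_supp_def\<close>)

lemma mps_coeff_mult_superset:
  fixes P Q :: "'a :: semiring_1 mps"
  assumes "finite A" "mps_supp P \<subseteq> A" "finite B" "mps_supp Q \<subseteq> B"
  shows "mps_coeff (P * Q) m = (\<Sum>(p, q) | (p, q) \<in> A \<times> B \<and> p + q = m. mps_coeff P p * mps_coeff Q q)"
proof -
  have "(\<Sum>(p, q) | p + q = m. mps_coeff P p * mps_coeff Q q)
    = (\<Sum>(p, q) | (p, q) \<in> A \<times> B \<and> p + q = m. mps_coeff P p * mps_coeff Q q)"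
  proof (rule sum.mono_neutral_right)
    show "finite {(p, q). p + q = m}" by (rule finite_monomial_splits)
    show "\<forall>z\<in>{(p, q). p + q = m} - {(p, q). (p, q) \<in> A \<times> B \<and> p + q = m}.
      (case z of (p, q) \<Rightarrow> mps_coeff P p * mps_coeff Q q) = 0"
    proof
      fix z assume z: "z \<in> {(p, q). p + q = m} - {(p, q). (p, q) \<in> A \<times> B \<and> p + q = m}"
      then have "fst z \<notin> mps_supp P \<or> snd z \<notin> mps_supp Q" using assms by auto
      then show "(case z of (p, q) \<Rightarrow> mps_coeff P p * mps_coeff Q q) = 0" by (auto simp: mps_supp_def case_prod_unfold)
    qed
  qed auto
  then show ?thesis by (simp only: times_mps.rep_eq)
qed

lemma mps_supp_mult:
  fixes P Q :: "'a :: semiring_1 mps"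
  shows "mps_supp (P * Q) \<subseteq> (\<lambda>(p, q). p + q) ` (mps_supp P \<times> mps_supp Q)"
proof
  fix m assume "m \<in> mps_supp (P * Q)"
  then have "(\<Sum>(p, q) | p + q = m. mps_coeff P p * mps_coeff Q q) \<noteq> 0"
    by (simp add: mps_supp_def times_mps.rep_eq)
  then obtain z where "z \<in> {(p, q). p + q = m}" "(case z of (p, q) \<Rightarrow> mps_coeff P p * mps_coeff Q q) \<noteq> 0"
    by (rule sum.not_neutral_contains_not_neutral)
  then obtain p q where z: "p + q = m" "mps_coeff P p * mps_coeff Q q \<noteq> 0" by (cases z) auto
  then have "mps_coeff P p \<noteq> 0" "mps_coeff Q q \<noteq> 0" by auto
  then show "m \<in> (\<lambda>(p, q). p + q) ` (mps_supp P \<times> mps_supp Q)"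
    using z(1) by (intro image_eqI[where x = "(p, q)"]) (auto simp: mps_supp_def)
qed

lemma finite_mps_supp_mult:
  fixes P Q :: "'a :: semiring_1 mps"
  shows "finite (mps_supp P) \<Longrightarrow> finite (mps_supp Q) \<Longrightarrow> finite (mps_supp (P * Q))"
  by (rule finite_subset[OF mps_supp_mult]) simp

lemma mps_eval_mult:
  fixes P Q :: "'a :: semiring_1 mps"
  assumes A: "finite A" "mps_supp P \<subseteq> A" and B: "finite B" "mps_supp Q \<subseteq> B"
    and zero: "\<phi> 0 = 0" and add: "\<And>c d. \<phi> (c + d) = \<phi> c + \<phi> d"
  shows "mps_eval x \<phi> (P * Q) = (\<Sum>p\<in>A. \<Sum>q\<in>B. mpow x p * mpow x q * \<phi> (mps_coeff P p * mps_coeff Q q))"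
proof -
  have hom: "\<phi> (sum f S) = (\<Sum>s\<in>S. \<phi> (f s))" for S and f :: "monomial \<times> monomial \<Rightarrow> 'a"
    by (induction S rule: infinite_finite_induct) (auto simp: zero add)
  let ?I = "(\<lambda>(p, q). p + q) ` (A \<times> B)"
  have "(\<lambda>(p, q). p + q) ` (mps_supp P \<times> mps_supp Q) \<subseteq> ?I" using A(2) B(2) by blast
  then have sub: "mps_supp (P * Q) \<subseteq> ?I" by (rule subset_trans[OF mps_supp_mult])
  have "mps_eval x \<phi> (P * Q) = (\<Sum>m\<in>?I. mpow x m * \<phi> (mps_coeff (P * Q) m))"
    by (rule mps_eval_superset[OF _ sub]) (use A B zero in auto)
  also have "\<dots> = (\<Sum>m\<in>?I. \<Sum>z | z \<in> A \<times> B \<and> (case z of (p, q) \<Rightarrow> p + q) = m.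
      (case z of (p, q) \<Rightarrow> mpow x p * mpow x q * \<phi> (mps_coeff P p * mps_coeff Q q)))"
  proof (rule sum.cong[OF refl])
    fix m
    have "mpow x m * \<phi> (mps_coeff (P * Q) m)
      = (\<Sum>z | (case z of (p, q) \<Rightarrow> (p, q) \<in> A \<times> B \<and> p + q = m).
          mpow x m * \<phi> (case z of (p, q) \<Rightarrow> mps_coeff P p * mps_coeff Q q))"
      unfolding mps_coeff_mult_superset[OF A B] hom sum_distrib_left by (rule refl)
    also have "\<dots> = (\<Sum>z | z \<in> A \<times> B \<and> (case z of (p, q) \<Rightarrow> p + q) = m.
      (case z of (p, q) \<Rightarrow> mpow x p * mpow x q * \<phi> (mps_coeff P p * mps_coeff Q q)))"
      by (rule sum.cong) (auto simp: mpow_add)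
    finally show "mpow x m * \<phi> (mps_coeff (P * Q) m)
      = (\<Sum>z | z \<in> A \<times> B \<and> (case z of (p, q) \<Rightarrow> p + q) = m.
      (case z of (p, q) \<Rightarrow> mpow x p * mpow x q * \<phi> (mps_coeff P p * mps_coeff Q q)))" .
  qed
  also have "\<dots> = (\<Sum>z\<in>A \<times> B. case z of (p, q) \<Rightarrow> mpow x p * mpow x q * \<phi> (mps_coeff P p * mps_coeff Q q))"
    by (rule sum.group) (use A B in auto)
  also have "\<dots> = (\<Sum>p\<in>A. \<Sum>q\<in>B. mpow x p * mpow x q * \<phi> (mps_coeff P p * mps_coeff Q q))"
    by (rule sum.cartesian_product[symmetric])
  finally show ?thesis .
qed

lemma mps_coeff_var_const:
  fixes c :: "'a :: semiring_1"
  shows "mps_coeff (mps_var i * mps_const c) m = (if m = Poly_Mapping.single i 1 then c else 0)"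
proof -
  have "mps_supp (mps_var i :: 'a mps) \<subseteq> {Poly_Mapping.single i 1}" "mps_supp (mps_const c) \<subseteq> {0}"
    by (auto simp: mps_supp_def mps_var.rep_eq mps_const.rep_eq)
  from mps_coeff_mult_superset[OF _ this(1) _ this(2), of m]
  have "mps_coeff (mps_var i * mps_const c) m
    = (\<Sum>(p, q) | (p, q) \<in> {Poly_Mapping.single i 1} \<times> {0} \<and> p + q = m. mps_coeff (mps_var i) p * mps_coeff (mps_const c) q)"
    by simp
  also have "{(p, q). (p, q) \<in> {Poly_Mapping.single i 1} \<times> {0} \<and> p + q = m}
    = (if m = Poly_Mapping.single i 1 then {(Poly_Mapping.single i 1, 0)} else {})"
    by auto
  finally show ?thesis by (simp add: mps_var.rep_eq mps_const.rep_eq)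
qed

lemma mps_coeff_factor:
  fixes c :: "'a :: semiring_1"
  shows "mps_coeff (1 + mps_var i * mps_const c) m
    = (if m = 0 then 1 else if m = Poly_Mapping.single i 1 then c else 0)"
proof -
  have "Poly_Mapping.single i (1::nat) \<noteq> 0" by (metis lookup_single_eq lookup_zero zero_neq_one)
  then show ?thesis by (auto simp: plus_mps.rep_eq one_mps.rep_eq mps_coeff_var_const)
qed

lemma mps_supp_factor: "mps_supp (1 + mps_var i * mps_const c) \<subseteq> {0, Poly_Mapping.single i 1}"
  by (auto simp: mps_supp_def mps_coeff_factor)

lemma mps_eval_factor:
  fixes Q :: "'a :: semiring_1 mps"
  assumes Q: "finite (mps_supp Q)" and zero: "\<phi> 0 = 0" and add: "\<And>c d. \<phi> (c + d) = \<phi> c + \<phi> d"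
  shows "mps_eval x \<phi> ((1 + mps_var i * mps_const c) * Q)
    = mps_eval x \<phi> Q + x i * (\<Sum>q\<in>mps_supp Q. mpow x q * \<phi> (c * mps_coeff Q q))"
proof -
  have ne: "0 \<noteq> Poly_Mapping.single i (1::nat)" by (metis lookup_single_eq lookup_zero zero_neq_one)
  have "mps_eval x \<phi> ((1 + mps_var i * mps_const c) * Q) = (\<Sum>p\<in>{0, Poly_Mapping.single i 1}. \<Sum>q\<in>mps_supp Q.
      mpow x p * mpow x q * \<phi> (mps_coeff (1 + mps_var i * mps_const c) p * mps_coeff Q q))"
    by (rule mps_eval_mult[OF _ mps_supp_factor Q subset_refl zero add]) simp
  then show ?thesis using ne
    by (simp add: mps_coeff_factor mps_eval_def sum_distrib_left mult.assoc)
qed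

text \<open>The series \<open>R\<close> becomes \<open>1\<close> after setting the variable \<open>x\<^sub>i\<close> to zero.\<close>

definition unit_off :: "nat \<Rightarrow> 'a :: semiring_1 mps \<Rightarrow> bool" where
  "unit_off i R \<longleftrightarrow> (\<forall>m. Poly_Mapping.lookup m i = 0 \<longrightarrow> mps_coeff R m = (if m = 0 then 1 else 0))"

lemma mps_coeff_mult_unit_off:
  fixes Q R :: "'a :: semiring_1 mps"
  assumes R: "unit_off i R" and m: "Poly_Mapping.lookup m i = 0"
  shows "mps_coeff (Q * R) m = mps_coeff Q m"
proof -
  have "(\<Sum>(p, q) | p + q = m. mps_coeff Q p * mps_coeff R q) = (\<Sum>(p, q)\<in>{(m, 0)}. mps_coeff Q p * mps_coeff R q)"
  proof (rule sum.mono_neutral_right)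
    show "\<forall>z\<in>{(p, q). p + q = m} - {(m, 0)}. (case z of (p, q) \<Rightarrow> mps_coeff Q p * mps_coeff R q) = 0"
    proof
      fix z assume "z \<in> {(p, q). p + q = m} - {(m, 0)}"
      then have "Poly_Mapping.lookup (snd z) i = 0" "snd z \<noteq> 0" using m by (auto simp: lookup_add)
      then show "(case z of (p, q) \<Rightarrow> mps_coeff Q p * mps_coeff R q) = 0" using R by (simp add: unit_off_def case_prod_unfold)
    qed
  qed (auto simp: finite_monomial_splits)
  then show ?thesis using R by (simp add: times_mps.rep_eq unit_off_def)
qed

lemma unit_off_GC_factor: "unit_off i (GC_factor n i)"
proof -
  have "unit_off i (prod_list (map (\<lambda>j. 1 + mps_var i * mps_const (u_gen j)) js))" for js
  proof (induction js)
    case Nil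
    then show ?case by (simp add: unit_off_def one_mps.rep_eq)
  next
    case (Cons j js)
    show ?case unfolding unit_off_def
    proof (intro allI impI)
      fix m :: monomial assume m: "Poly_Mapping.lookup m i = 0"
      then have "m \<noteq> Poly_Mapping.single i 1" by auto
      then show "mps_coeff (prod_list (map (\<lambda>j. 1 + mps_var i * mps_const (u_gen j)) (j # js))) m = (if m = 0 then 1 else 0)"
        using mps_coeff_mult_unit_off[OF Cons m] by (simp add: mps_coeff_factor)
    qed
  qed
  then show ?thesis by (simp add: GC_factor_def del: map_append)
qed

text \<open>A factor beyond \<open>N\<close> is 1 on monomials free of its variable, so the
  coefficient at \<open>m\<close> is constant from the partial product \<open>N\<close> on.\<close>

lemma mps_coeff_infprod:
  fixes F :: "nat \<Rightarrow> 'a :: semiring_1 mps"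
  assumes F: "\<And>i. unit_off i (F i)" and m: "Poly_Mapping.keys m \<subseteq> {..N}"
  shows "mps_coeff (mps_infprod F) m = mps_coeff (prod_list (map F [1..<Suc N])) m"
proof -
  let ?P = "\<lambda>M. mps_coeff (prod_list (map F [1..<Suc M])) m"
  have stable: "?P (N + d) = ?P N" for d
  proof (induction d)
    case (Suc d)
    have "Suc (N + d) \<notin> Poly_Mapping.keys m" using m by auto
    then have "Poly_Mapping.lookup m (Suc (N + d)) = 0" by (simp add: in_keys_iff)
    from mps_coeff_mult_unit_off[OF F this] have "?P (Suc (N + d)) = ?P (N + d)" by simp
    then show ?case using Suc by simp
  qed simp
  have ev: "\<forall>\<^sub>F M in sequentially. ?P M = ?P N"
    unfolding eventually_sequentially using stable by (metis le_add_diff_inverse)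
  show ?thesis unfolding mps_infprod.rep_eq
  proof (rule the_equality)
    show "\<forall>\<^sub>F M in sequentially. ?P M = ?P N" by (rule ev)
    fix c assume "\<forall>\<^sub>F M in sequentially. ?P M = c"
    then have "\<forall>\<^sub>F M in sequentially. ?P N = c" using ev by eventually_elim simp
    then show "c = ?P N" by simp
  qed
qed

lemma free_alg_on_GC_product:
  "mps_coeff (prod_list (map (GC_factor n) is)) m \<in> free_alg_on n"
proof -
  define ok where "ok Q \<longleftrightarrow> (\<forall>m. mps_coeff Q m \<in> free_alg_on n)" for Q :: "free_alg mps"
  have one: "ok 1" by (simp add: ok_def one_mps.rep_eq free_alg_on_one free_alg_on_zero)
  have mult: "ok (P * Q)" if "ok P" "ok Q" for P Q
    using that unfolding ok_def times_mps.rep_eq by (auto intro!: free_alg_on_sum free_alg_on_mult)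
  have list: "(\<And>Q. Q \<in> set Qs \<Longrightarrow> ok Q) \<Longrightarrow> ok (prod_list Qs)" for Qs
    by (induction Qs) (auto intro: one mult)
  have "u_gen j \<in> free_alg_on n" if "j < n" for j
    unfolding u_gen_def by (rule free_alg_on_single) (use that in simp)
  then have fac: "ok (1 + mps_var i * mps_const (u_gen j))" if "j < n" for i j
    using that by (auto simp: ok_def mps_coeff_factor free_alg_on_one free_alg_on_zero)
  have "ok (GC_factor n i)" for i
    unfolding GC_factor_def by (rule list) (auto intro: fac)
  then have "ok (prod_list (map (GC_factor n) is))" by (intro list) auto
  then show ?thesis by (simp add: ok_def)
qed

text \<open>Induction on the variables: with the others fixed, the sum is a polynomial in
  \<open>k\<close> with roots at all positive reals off a finite set, so each of its coefficients
  vanishes. Distinct positive points suffice, and those are where the formulas with denominators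
  \<open>z - y\<close> hold.\<close>

lemma monomial_coeffs_zero:
  fixes c :: "'a \<Rightarrow> real" and e :: "'a \<Rightarrow> 'b \<Rightarrow> nat"
  assumes "finite K" "finite S" "\<And>m m'. m \<in> S \<Longrightarrow> m' \<in> S \<Longrightarrow> (\<And>i. i \<in> K \<Longrightarrow> e m i = e m' i) \<Longrightarrow> m = m'"
    and "\<And>x. (\<And>i. i \<in> K \<Longrightarrow> x i > 0) \<Longrightarrow> inj_on x K \<Longrightarrow> (\<Sum>m\<in>S. c m * (\<Prod>i\<in>K. x i ^ e m i)) = 0"
    and "m0 \<in> S"
  shows "c m0 = 0"
  using assms
proof (induction K arbitrary: S rule: finite_induct)
  case empty
  then have "S = {m0}" by blast
  then show ?case using empty.prems(3)[of "\<lambda>_. 1"] by simp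
next
  case (insert k K)
  let ?S = "{m \<in> S. e m k = e m0 k}"
  show ?case
  proof (rule insert.IH[of ?S])
    show "finite ?S" "m0 \<in> ?S" using insert.prems by auto
    show "m = m'" if "m \<in> ?S" "m' \<in> ?S" "\<And>i. i \<in> K \<Longrightarrow> e m i = e m' i" for m m'
      by (rule insert.prems(2)) (use that in auto)
    fix x :: "'b \<Rightarrow> real" assume x: "\<And>i. i \<in> K \<Longrightarrow> x i > 0" "inj_on x K"
    define p where "p = (\<Sum>m\<in>S. monom (c m * (\<Prod>i\<in>K. x i ^ e m i)) (e m k))"
    have root: "poly p t = 0" if t: "t > 0" "t \<notin> x ` K" for t
    proof -
      let ?y = "x(k := t)"
      have y: "?y i = x i" if "i \<in> K" for i using that insert.hyps by auto
      have yK: "?y ` K = x ` K" by (rule image_cong[OF refl y])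
      have "inj_on ?y K \<longleftrightarrow> inj_on x K" by (rule inj_on_cong[OF y])
      then have "inj_on ?y (insert k K)" using x(2) t(2) yK insert.hyps by simp
      moreover have "?y i > 0" if "i \<in> insert k K" for i using that t x(1) by auto
      ultimately have "(\<Sum>m\<in>S. c m * (\<Prod>i\<in>insert k K. ?y i ^ e m i)) = 0" by (rule insert.prems(3)[rotated])
      moreover have "(\<Prod>i\<in>insert k K. ?y i ^ e m i) = t ^ e m k * (\<Prod>i\<in>K. x i ^ e m i)" for m
      proof -
        have "(\<Prod>i\<in>K. ?y i ^ e m i) = (\<Prod>i\<in>K. x i ^ e m i)" by (rule prod.cong[OF refl]) (simp only: y)
        then show ?thesis using insert.hyps by simp
      qed
      ultimately show ?thesis by (simp add: p_def poly_sum poly_monom mult_ac)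
    qed
    have "infinite ({0<..} - x ` K)" using insert.hyps by (simp add: infinite_Ioi)
    moreover have "{0<..} - x ` K \<subseteq> {t. poly p t = 0}" using root by auto
    ultimately have "p = 0" using poly_roots_finite finite_subset by blast
    then have "coeff p (e m0 k) = 0" by simp
    then have "(\<Sum>m\<in>S. if e m k = e m0 k then c m * (\<Prod>i\<in>K. x i ^ e m i) else 0) = 0"
      by (simp add: p_def coeff_sum)
    then show "(\<Sum>m\<in>?S. c m * (\<Prod>i\<in>K. x i ^ e m i)) = 0"
      using insert.prems(1) by (simp add: sum.inter_filter)
  qed
qed

section \<open>Factorisation\<close>

context beta_real
begin

definition ghop :: "nat \<Rightarrow> nat \<Rightarrow> real \<Rightarrow> nat \<Rightarrow> vec \<Rightarrow> vec" where
  "ghop k n t j \<Psi> s = \<Psi> s + t * gop k n j \<Psi> s"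

text \<open>Each generator acts on one of the two partitions only, so a product of functions stays a
  product, and each factor follows the subword of its own sites.\<close>

lemma foldr_ghop_split:
  assumes "set js \<subseteq> {..<n}"
  shows "foldr (ghop k n t) js (\<lambda>s. f (fst s) * g (snd s)) = (\<lambda>s. foldr (hop t) (filter (\<lambda>j. j < k) js) f (fst s)
    * foldr (hop t) (map (\<lambda>j. n - j) (filter (\<lambda>j. k < j) js)) g (snd s))"
  using assms
proof (induction js)
  case (Cons j js)
  have scale: "opr i (\<lambda>p. h p * c) ps = opr i h ps * c" "opr i (\<lambda>p. c * h p) ps = c * opr i h ps" for i h c ps
    by (simp_all add: opr_def algebra_simps)
  consider "j < k" | "j = k" | "k < j" by linarith
  then show ?case using Cons
    by cases (auto simp: ghop_def hop_def gop_def scale fun_eq_iff algebra_simps)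
qed simp

lemma foldr_ghop_cong:
  assumes eq: "\<And>p q. parts_le k p \<Longrightarrow> parts_le N q \<Longrightarrow> length q = a \<Longrightarrow> \<Psi> (p, q) = \<Phi> (p, q)"
    and "parts_le k p" "parts_le N q" "length q = a"
  shows "foldr (ghop k n t) js \<Psi> (p, q) = foldr (ghop k n t) js \<Phi> (p, q)"
  using assms(2-4)
proof (induction js arbitrary: p q)
  case Nil
  then show ?case by (simp add: eq)
next
  case (Cons j js)
  have "length (lower (n - j) q) = a" if "j < n" using that Cons.prems by (simp add: lower_def)
  then show ?case using Cons parts_le_lower[of k p j] parts_le_lower[of N q "n - j"]
    by (auto simp: ghop_def gop_def opr_def removable_def)
qed

text \<open>Dropping the index \<open>k\<close> cuts the word in two. The reversal
  \<open>n - j\<close> makes the type A word climb first and descend afterwards, as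
  \<open>EA_insert\<close> expects.\<close>

lemma filter_hop_sites:
  fixes k c :: nat
  defines "n \<equiv> c + k"
  shows "filter (\<lambda>j. j < k) (rev [0..<n] @ [0..<n]) = rev [0..<k] @ [0..<k]"
    and "map (\<lambda>j. n - j) (filter (\<lambda>j. k < j) (rev [0..<n] @ [0..<n])) = [1..<c] @ rev [1..<c]"
proof -
  have up: "filter (\<lambda>j. j < k) [0..<n] = [0..<k]" unfolding n_def by (induction c) auto
  then show "filter (\<lambda>j. j < k) (rev [0..<n] @ [0..<n]) = rev [0..<k] @ [0..<k]"
    by (simp add: rev_filter[symmetric])
  have "filter (\<lambda>j. k < j) [0..<n] = [Suc k..<n]" unfolding n_def
  proof (induction c)
    case 0
    then show ?case by (auto simp: filter_empty_conv)
  qed auto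
  moreover have "map (\<lambda>j. n - j) [Suc k..<n] = rev [1..<c]"
    by (rule nth_equalityI) (auto simp: n_def rev_nth)
  ultimately show "map (\<lambda>j. n - j) (filter (\<lambda>j. k < j) (rev [0..<n] @ [0..<n])) = [1..<c] @ rev [1..<c]"
    by (simp add: rev_filter[symmetric] rev_map[symmetric])
qed

text \<open>For the empty alphabet both factors are indicators, and their product is
  \<open>delta\<close>. The variables are then adjoined from the right end of the list by
  \<open>FC_insert\<close> and \<open>EA_insert\<close>.\<close>

lemma foldr_ghop_evolution:
  fixes x :: "nat \<Rightarrow> real" and a b k :: nat
  defines "n \<equiv> a + b + k"
  assumes k: "0 < k" and a: "0 < a"
    and "\<And>i. i \<in> set is \<Longrightarrow> x i > 0" "inj_on x (set is)" "distinct is"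
    and "parts_le k p" "parts_le (a + b) q" "length q = a"
  shows "foldr (\<lambda>i. foldr (ghop k n (x i)) (rev [0..<n] @ [0..<n])) is (delta a) (p, q)
    = FC (\<lambda>_. 0) p (x ` set is) * EA (node_poly (x ` set is)) (x ` set is) (\<lambda>_. 0) q"
  using assms(4-)
proof (induction "is" arbitrary: p q)
  case Nil
  have "FC (\<lambda>_. 0) p {} = (if p = [] then 1 else 0)" by (cases p) auto
  then show ?case using EA_empty[OF a Nil(5,6)] by (simp add: delta_def del: upt_Suc)
next
  case (Cons i "is")
  let ?X = "x ` set is" and ?js = "rev [0..<n] @ [0..<n]"
  have X: "pos_alphabet ?X" using Cons.prems(1) by (auto simp: pos_alphabet_def)
  have t: "x i > 0" "x i \<notin> ?X" using Cons.prems(1-3) by auto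
  have eq: "foldr (\<lambda>i. foldr (ghop k n (x i)) ?js) is (delta a) (p, q)
      = FC (\<lambda>_. 0) (fst (p, q)) ?X * EA (node_poly ?X) ?X (\<lambda>_. 0) (snd (p, q))"
    if "parts_le k p" "parts_le (a + b) q" "length q = a" for p q
    using Cons.IH[OF _ _ _ that] Cons.prems(1-3) by (simp del: foldr_append)
  have js: "set ?js \<subseteq> {..<n}" by auto
  have nn: "n = (a + b) + k" by (simp add: n_def)
  have "foldr (\<lambda>i. foldr (ghop k n (x i)) ?js) (i # is) (delta a) (p, q)
    = foldr (ghop k n (x i)) ?js (foldr (\<lambda>i. foldr (ghop k n (x i)) ?js) is (delta a)) (p, q)"
    by (simp del: foldr_append)
  also have "\<dots> = foldr (ghop k n (x i)) ?js (\<lambda>s. FC (\<lambda>_. 0) (fst s) ?X * EA (node_poly ?X) ?X (\<lambda>_. 0) (snd s)) (p, q)"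
    by (rule foldr_ghop_cong[OF _ Cons.prems(4-6)]) (rule eq)
  also have "\<dots> = foldr (hop (x i)) (rev [0..<k] @ [0..<k]) (\<lambda>p. FC (\<lambda>_. 0) p ?X) p
    * foldr (hop (x i)) ([1..<a + b] @ rev [1..<a + b]) (EA (node_poly ?X) ?X (\<lambda>_. 0)) q"
    using fun_cong[OF foldr_ghop_split[OF js, of k "x i" "\<lambda>p. FC (\<lambda>_. 0) p ?X" "EA (node_poly ?X) ?X (\<lambda>_. 0)"], of "(p, q)"]
    unfolding filter_hop_sites[where k = k and c = "a + b", folded nn] by (simp only: fst_conv snd_conv)
  also have "\<dots> = FC (\<lambda>_. 0) p (insert (x i) ?X) * EA (node_poly (insert (x i) ?X)) (insert (x i) ?X) (\<lambda>_. 0) q"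
    using FC_insert[OF X t k Cons.prems(4)] EA_insert[OF X t _ Cons.prems(5)] a by simp
  finally show ?case by (simp del: foldr_append)
qed

lemma mps_eval_alg_act_factor:
  assumes "finite (mps_supp Q)"
  shows "mps_eval x (\<lambda>f. alg_act k n f \<Psi> s) ((1 + mps_var i * mps_const (u_gen j)) * Q)
    = ghop k n (x i) j (\<lambda>s. mps_eval x (\<lambda>f. alg_act k n f \<Psi> s) Q) s"
proof -
  have "gop k n j (\<lambda>s. mps_eval x (\<lambda>f. alg_act k n f \<Psi> s) Q) s
    = (\<Sum>m\<in>mps_supp Q. mpow x m * gop k n j (alg_act k n (mps_coeff Q m) \<Psi>) s)"
    unfolding mps_eval_def gop_sum by (rule refl)
  then show ?thesis
    using mps_eval_factor[OF assms, of "\<lambda>f. alg_act k n f \<Psi> s" x i "u_gen j"]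
    by (simp add: ghop_def alg_act_add alg_act_mult alg_act_u_gen)
qed

lemma mps_eval_alg_act_GC_factor:
  assumes Q: "finite (mps_supp Q)"
  shows "finite (mps_supp (GC_factor n i * Q))"
    and "(\<lambda>s. mps_eval x (\<lambda>f. alg_act k n f \<Psi> s) (GC_factor n i * Q))
      = foldr (ghop k n (x i)) (rev [0..<n] @ [0..<n]) (\<lambda>s. mps_eval x (\<lambda>f. alg_act k n f \<Psi> s) Q)"
proof -
  let ?P = "\<lambda>js. prod_list (map (\<lambda>j. 1 + mps_var i * mps_const (u_gen j)) js)"
  have "finite (mps_supp (?P js * Q)) \<and> (\<lambda>s. mps_eval x (\<lambda>f. alg_act k n f \<Psi> s) (?P js * Q))
      = foldr (ghop k n (x i)) js (\<lambda>s. mps_eval x (\<lambda>f. alg_act k n f \<Psi> s) Q)" for js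
  proof (induction js)
    case Nil
    then show ?case using Q by simp
  next
    case (Cons j js)
    then have fin: "finite (mps_supp (?P js * Q))" by blast
    have "finite (mps_supp (1 + mps_var i * mps_const (u_gen j)))" by (rule finite_subset[OF mps_supp_factor]) simp
    from finite_mps_supp_mult[OF this fin] show ?case
      using mps_eval_alg_act_factor[OF fin, of x k n \<Psi>] Cons by (simp add: mult.assoc)
  qed
  then show "finite (mps_supp (GC_factor n i * Q))"
    "(\<lambda>s. mps_eval x (\<lambda>f. alg_act k n f \<Psi> s) (GC_factor n i * Q))
      = foldr (ghop k n (x i)) (rev [0..<n] @ [0..<n]) (\<lambda>s. mps_eval x (\<lambda>f. alg_act k n f \<Psi> s) Q)"
    unfolding GC_factor_def by blast+
qed

lemma mps_eval_GC_product:
  shows "finite (mps_supp (prod_list (map (GC_factor n) is)))"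
    and "(\<lambda>s. mps_eval x (\<lambda>f. alg_act k n f \<Psi> s) (prod_list (map (GC_factor n) is)))
      = foldr (\<lambda>i. foldr (ghop k n (x i)) (rev [0..<n] @ [0..<n])) is \<Psi>"
proof -
  have "finite (mps_supp (prod_list (map (GC_factor n) is))) \<and>
    (\<lambda>s. mps_eval x (\<lambda>f. alg_act k n f \<Psi> s) (prod_list (map (GC_factor n) is)))
      = foldr (\<lambda>i. foldr (ghop k n (x i)) (rev [0..<n] @ [0..<n])) is \<Psi>"
  proof (induction "is")
    case Nil
    have supp: "mps_supp (1 :: free_alg mps) \<subseteq> {0}" by (auto simp: mps_supp_def one_mps.rep_eq)
    have "alg_act k n 1 \<Psi> s = \<Psi> s" for s using alg_act_u_word[of k n "[]" \<Psi>] by simp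
    then have "mps_eval x (\<lambda>f. alg_act k n f \<Psi> s) 1 = \<Psi> s" for s
      by (subst mps_eval_superset[OF _ supp]) (auto simp: one_mps.rep_eq)
    then show ?case using finite_subset[OF supp] by simp
  next
    case (Cons i "is")
    then have fin: "finite (mps_supp (prod_list (map (GC_factor n) is)))" by blast
    show ?case using mps_eval_alg_act_GC_factor[OF fin, where n = n and i = i] Cons by (simp del: foldr_append)
  qed
  then show "finite (mps_supp (prod_list (map (GC_factor n) is)))"
    "(\<lambda>s. mps_eval x (\<lambda>f. alg_act k n f \<Psi> s) (prod_list (map (GC_factor n) is)))
      = foldr (\<lambda>i. foldr (ghop k n (x i)) (rev [0..<n] @ [0..<n])) is \<Psi>"
    by blast+
qed

end

text \<open>\<open>GQ la\<close> with \<open>x\<^sub>i = 0\<close> for all \<open>i > N\<close>, provided that all contents of \<open>la\<close> are below \<open>n\<close>.\<close>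

definition GQ_trunc :: "nat \<Rightarrow> nat \<Rightarrow> nat list \<Rightarrow> int poly mps" where
  "GQ_trunc n N la = Abs_mps (\<lambda>m. \<Sum>T | T \<in> bounded_svt la (\<lambda>c. if c < n then 2 * N else 0) \<and> svt_weight la T = m.
     beta ^ (svt_size la T - sum_list la))"

lemma mps_coeff_GQ_trunc:
  "mps_coeff (GQ_trunc n N la) m = (\<Sum>T | T \<in> bounded_svt la (\<lambda>c. if c < n then 2 * N else 0) \<and> svt_weight la T = m.
     beta ^ (svt_size la T - sum_list la))"
  by (simp add: GQ_trunc_def Abs_mps_inverse)

lemma nat_abs_mem_keys_svt_weight:
  assumes T: "T \<in> shifted_svt la" and c: "c \<in> shifted_diagram la" "s \<in> T c"
  shows "nat \<bar>s\<bar> \<in> Poly_Mapping.keys (svt_weight la T)"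
proof -
  let ?f = "\<lambda>c. \<Sum>s'\<in>T c. Poly_Mapping.lookup (Poly_Mapping.single (nat \<bar>s'\<bar>) (1::nat)) (nat \<bar>s\<bar>)"
  have "1 \<le> ?f c"
    using member_le_sum[of s "T c" "\<lambda>s'. Poly_Mapping.lookup (Poly_Mapping.single (nat \<bar>s'\<bar>) (1::nat)) (nat \<bar>s\<bar>)"]
      c shifted_svtD(2)[OF T c(1)] by simp
  also have "\<dots> \<le> (\<Sum>c\<in>shifted_diagram la. ?f c)"
    by (rule member_le_sum[OF c(1)]) auto
  finally have "Poly_Mapping.lookup (svt_weight la T) (nat \<bar>s\<bar>) \<noteq> 0"
    unfolding svt_weight_def lookup_sum by linarith
  then show ?thesis by (simp add: in_keys_iff)
qed

text \<open>Every entry leaves its variable in the weight, so a monomial in variables up to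
  \<open>N\<close> forces ranks up to \<open>2 N\<close>; parts up to \<open>n\<close> have contents
  below \<open>n\<close>.\<close>

lemma GQ_trunc_coeff:
  assumes la: "parts_le n la" and m: "Poly_Mapping.keys m \<subseteq> {..N}"
  shows "mps_coeff (GQ_trunc n N la) m = mps_coeff (GQ la) m"
proof -
  have "T \<in> bounded_svt la (\<lambda>c. if c < n then 2 * N else 0)" if T: "T \<in> shifted_svt la" "svt_weight la T = m" for T
    unfolding bounded_svt_def mem_Collect_eq
  proof (intro conjI allI impI ballI)
    fix i j s assume d: "(i, j) \<in> shifted_diagram la" "s \<in> T (i, j)"
    have "nat \<bar>s\<bar> \<in> {..N}" using nat_abs_mem_keys_svt_weight[OF T(1) d] T(2) m by blast
    then have "prec_rank s \<le> 2 * int N" by (auto simp: prec_rank_def)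
    moreover have "1 \<le> i" "i - 1 < length la" "i \<le> j" "j < la ! (i - 1) + i" using d(1) by (auto simp: mem_shifted_diagram)
    moreover have "la ! (i - 1) \<le> n" using la nth_mem[OF calculation(3)] unfolding parts_le_def by blast
    ultimately show "prec_rank s \<le> int (if j - i < n then 2 * N else 0)" by auto
  qed (rule T(1))
  then have "{T. T \<in> bounded_svt la (\<lambda>c. if c < n then 2 * N else 0) \<and> svt_weight la T = m}
    = {T. T \<in> shifted_svt la \<and> svt_weight la T = m}"
    unfolding bounded_svt_def[of la "\<lambda>c. if c < n then 2 * N else 0"] mem_Collect_eq by blast
  then show ?thesis by (simp only: mps_coeff_GQ_trunc GQ.rep_eq)
qed

lemma mps_supp_GQ_trunc:
  "mps_supp (GQ_trunc n N la) \<subseteq> svt_weight la ` bounded_svt la (\<lambda>c. if c < n then 2 * N else 0)"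
proof
  fix m assume "m \<in> mps_supp (GQ_trunc n N la)"
  then have "{T. T \<in> bounded_svt la (\<lambda>c. if c < n then 2 * N else 0) \<and> svt_weight la T = m} \<noteq> {}"
    by (auto simp: mps_supp_def mps_coeff_GQ_trunc simp del: Collect_empty_eq)
  then show "m \<in> svt_weight la ` bounded_svt la (\<lambda>c. if c < n then 2 * N else 0)" by blast
qed

lemma ev_sum: "ev b (sum f A) = (\<Sum>a\<in>A. ev b (f a))"
  by (induction A rule: infinite_finite_induct) (auto simp: ev_add)

lemma ev_power: "ev b (c ^ r) = ev b c ^ r"
  by (induction r) (auto simp: ev_mult)

lemma (in beta_real) mps_eval_GQ_trunc:
  "mps_eval x (ev \<beta>) (GQ_trunc n N la) = tab_sum x (\<lambda>c. if c < n then 2 * N else 0) la"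
proof -
  let ?B = "bounded_svt la (\<lambda>c. if c < n then 2 * N else 0)" and ?D = "shifted_diagram la"
  have "mps_eval x (ev \<beta>) (GQ_trunc n N la)
    = (\<Sum>m\<in>svt_weight la ` ?B. mpow x m * ev \<beta> (mps_coeff (GQ_trunc n N la) m))"
    by (rule mps_eval_superset[OF _ mps_supp_GQ_trunc]) auto
  also have "\<dots> = (\<Sum>m\<in>svt_weight la ` ?B. \<Sum>T | T \<in> ?B \<and> svt_weight la T = m.
      mpow x (svt_weight la T) * \<beta> ^ (svt_size la T - sum_list la))"
    by (rule sum.cong[OF refl])
      (simp add: mps_coeff_GQ_trunc ev_sum ev_power sum_distrib_left)
  also have "\<dots> = (\<Sum>T\<in>?B. mpow x (svt_weight la T) * \<beta> ^ (svt_size la T - sum_list la))"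
    by (rule sum.group) auto
  also have "\<dots> = tab_sum x (\<lambda>c. if c < n then 2 * N else 0) la"
    unfolding tab_sum_def
  proof (rule sum.cong[OF refl])
    fix T assume "T \<in> ?B"
    then have T: "T \<in> shifted_svt la" by (simp add: bounded_svt_def)
    have "1 \<le> card (T c)" if "c \<in> ?D" for c
      using shifted_svtD(2,3)[OF T that] by (simp add: Suc_le_eq card_gt_0_iff)
    then have "(\<Sum>c\<in>?D. card (T c) - 1) = svt_size la T - sum_list la"
      by (simp add: sum_subtractf_nat svt_size_def card_shifted_diagram)
    then have "\<beta> ^ (svt_size la T - sum_list la) = (\<Prod>c\<in>?D. \<beta> ^ (card (T c) - 1))"
      by (simp add: power_sum[symmetric])
    then show "mpow x (svt_weight la T) * \<beta> ^ (svt_size la T - sum_list la) = (\<Prod>c\<in>?D. cell_weight x (T c))"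
      by (simp add: svt_weight_def mpow_sum cell_weight_def prod.distrib)
  qed
  finally show ?thesis .
qed

section \<open>The product formula\<close>

lemma parts_le_trapezoid:
  assumes "a \<le> b"
  shows "parts_le (a + b) (trapezoid a b)"
proof -
  have "sorted_wrt (>) (trapezoid a b)"
    unfolding sorted_wrt_iff_nth_less using assms by (auto simp: trapezoid_def intro!: diff_less_mono2)
  then show ?thesis using assms by (auto simp: parts_le_def strict_partition_def trapezoid_def)
qed

theorem corollary3p7:
  fixes k a b :: nat and la :: "nat list"
  assumes "k > 0"
    and "strict_partition la"
    and "la \<noteq> [] \<longrightarrow> hd la < k"
    and "0 < a" and "a \<le> b"
  shows "GC (a + b + k) (grassmannian la k \<circ> block_perm a b k) = GQ la * GQ (trapezoid a b)"
proof (rule mps_eqI)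
  fix m :: monomial
  define n where "n = a + b + k"
  \<comment> \<open>No variable of \<open>m\<close> has an index above \<open>N\<close>, so
    truncation to \<open>N\<close> variables does not change the coefficient at \<open>m\<close>;
    the inserted 0 serves the constant monomial.\<close>
  define N where "N = Max (insert 0 (Poly_Mapping.keys m))"
  have m: "Poly_Mapping.keys m \<subseteq> {..N}" by (auto simp: N_def)
  have la: "parts_le k la"
    using assms(2,3) by (cases la) (auto simp: parts_le_def strict_partition_def)
  let ?w = "grassmannian la k \<circ> block_perm a b k" and ?tau = "trapezoid a b"
  define q where "q = rev [Suc b..<Suc (a + b)]"
  define P where "P = prod_list (map (GC_factor n) [1..<Suc N])"
  define R where "R = GQ_trunc k N la * GQ_trunc (a + b) N ?tau"
  have tau: "parts_le (a + b) ?tau" by (rule parts_le_trapezoid[OF assms(5)])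
  have q: "parts_le (a + b) q" "length q = a"
    by (auto simp: q_def parts_le_def strict_partition_def sorted_wrt_rev simp del: upt_Suc)
  have finG: "finite (mps_supp (GQ_trunc c N mu))" for c mu
    by (rule finite_subset[OF mps_supp_GQ_trunc]) simp
  have finR: "finite (mps_supp R)" unfolding R_def by (rule finite_mps_supp_mult[OF finG finG])
  have "ev \<beta> (mps_coeff (GC n ?w) m) = ev \<beta> (mps_coeff (GQ la * GQ ?tau) m)" if \<beta>: "\<beta> > 0" for \<beta>
  proof -
    interpret beta_real \<beta> by unfold_locales (rule \<beta>)
    have finP: "finite (mps_supp P)" unfolding P_def by (rule mps_eval_GC_product)
    let ?\<phi> = "\<lambda>f. alg_act k n f (delta a) (la, q)"
    \<comment> \<open>The theorem at distinct positive points: the determinant for the rectangle and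
      the type C sum for the trapezoid agree through \<open>rect_sum\<close>, and the type C sums
      are tableau sums.\<close>
    have eval: "mps_eval x ?\<phi> P = mps_eval x (ev \<beta>) R"
      if x: "\<And>i. i \<in> {1..N} \<Longrightarrow> x i > 0" "inj_on x {1..N}" for x
    proof -
      let ?X = "x ` {1..N}"
      have X: "pos_alphabet ?X" using x(1) by (auto simp: pos_alphabet_def)
      have set: "set [1..<Suc N] = {1..N}" by (simp add: atLeastLessThanSuc_atLeastAtMost del: upt_Suc)
      have "mps_eval x ?\<phi> P = foldr (\<lambda>i. foldr (ghop k n (x i)) (rev [0..<n] @ [0..<n])) [1..<Suc N] (delta a) (la, q)"
        unfolding P_def using fun_cong[OF mps_eval_GC_product(2)] .
      also have "\<dots> = FC (\<lambda>_. 0) la ?X * EA (node_poly ?X) ?X (\<lambda>_. 0) q"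
        unfolding n_def set[symmetric]
        by (rule foldr_ghop_evolution[OF assms(1,4) _ _ distinct_upt la q]) (use x set in \<open>simp_all del: upt_Suc\<close>)
      also have "\<dots> = FC (\<lambda>_. 0) la ?X * FC (\<lambda>_. 0) ?tau ?X"
        by (simp only: q_def EA_rectangle[OF X assms(4,5)] FC_trapezoid[OF X assms(5)])
      also have "\<dots> = mps_eval x (ev \<beta>) (GQ_trunc k N la) * mps_eval x (ev \<beta>) (GQ_trunc (a + b) N ?tau)"
        using tab_sum_eq_FC[OF x assms(1) la] tab_sum_eq_FC[OF x _ tau] assms(4) by (simp add: mps_eval_GQ_trunc)
      also have "\<dots> = mps_eval x (ev \<beta>) R"
        unfolding R_def
        by (subst mps_eval_mult[OF finG subset_refl finG subset_refl])
          (auto simp: ev_add ev_mult mps_eval_def sum_product mult_ac)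
      finally show ?thesis .
    qed
    define S where "S = insert m (mps_supp P \<union> mps_supp R)"
    \<comment> \<open>\<open>K\<close> has to contain all variables of both series, so that the
      exponents on \<open>K\<close> distinguish the monomials of \<open>S\<close>.\<close>
    define K where "K = {..N} \<union> (\<Union>m\<in>S. Poly_Mapping.keys m)"
    have finS: "finite S" unfolding S_def using finP finR by simp
    have finK: "finite K" unfolding K_def using finS by simp
    have keys: "Poly_Mapping.keys m' \<subseteq> K" if "m' \<in> S" for m' using that by (auto simp: K_def)
    have "?\<phi> (mps_coeff P m) - ev \<beta> (mps_coeff R m) = 0"
    proof (rule monomial_coeffs_zero[OF finK finS, where e = Poly_Mapping.lookup])
      show "m1 = m2" if "m1 \<in> S" "m2 \<in> S" "\<And>i. i \<in> K \<Longrightarrow> Poly_Mapping.lookup m1 i = Poly_Mapping.lookup m2 i" for m1 m2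
      proof (rule poly_mapping_eqI)
        fix i show "Poly_Mapping.lookup m1 i = Poly_Mapping.lookup m2 i"
        proof (cases "i \<in> K")
          case False
          then have "i \<notin> Poly_Mapping.keys m1" "i \<notin> Poly_Mapping.keys m2" using keys that(1,2) by blast+
          then show ?thesis by (simp add: in_keys_iff)
        qed (rule that(3))
      qed
      show "m \<in> S" by (simp add: S_def)
      fix x :: "nat \<Rightarrow> real" assume x: "\<And>i. i \<in> K \<Longrightarrow> x i > 0" "inj_on x K"
      have "{1..N} \<subseteq> K" by (auto simp: K_def)
      then have "mps_eval x ?\<phi> P = mps_eval x (ev \<beta>) R"
        by (intro eval) (use x in \<open>auto intro: inj_on_subset\<close>)
      moreover have "mps_eval x ?\<phi> P = (\<Sum>m\<in>S. mpow x m * ?\<phi> (mps_coeff P m))"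
        by (rule mps_eval_superset[OF finS]) (auto simp: S_def)
      moreover have "mps_eval x (ev \<beta>) R = (\<Sum>m\<in>S. mpow x m * ev \<beta> (mps_coeff R m))"
        by (rule mps_eval_superset[OF finS]) (auto simp: S_def)
      ultimately have "(\<Sum>m\<in>S. (?\<phi> (mps_coeff P m) - ev \<beta> (mps_coeff R m)) * mpow x m) = 0"
        by (simp add: right_diff_distrib sum_subtractf mult.commute[of _ "mpow x _"])
      then show "(\<Sum>m\<in>S. (?\<phi> (mps_coeff P m) - ev \<beta> (mps_coeff R m)) * (\<Prod>i\<in>K. x i ^ Poly_Mapping.lookup m i)) = 0"
        using mpow_superset[OF finK keys] by simp
    qed
    moreover have "mps_coeff (GC n ?w) m = u_coeff n ?w (mps_coeff P m)"
      unfolding P_def GC.rep_eq by (simp only: mps_coeff_infprod[OF unit_off_GC_factor m])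
    moreover have "ev \<beta> (u_coeff n ?w (mps_coeff P m)) = ?\<phi> (mps_coeff P m)"
      unfolding n_def q_def
      by (rule u_coeff_matrix[OF assms(1) la _ \<beta>]) (simp only: P_def n_def free_alg_on_GC_product)
    moreover have "mps_coeff R m = mps_coeff (GQ la * GQ ?tau) m"
      unfolding R_def times_mps.rep_eq
    proof (rule sum.cong[OF refl])
      fix z assume "z \<in> {(p, q). p + q = m}"
      then have z: "fst z + snd z = m" by auto
      have "Poly_Mapping.keys (fst z) \<subseteq> Poly_Mapping.keys m" "Poly_Mapping.keys (snd z) \<subseteq> Poly_Mapping.keys m"
        unfolding z[symmetric] by (auto simp: in_keys_iff lookup_add)
      then have "Poly_Mapping.keys (fst z) \<subseteq> {..N}" "Poly_Mapping.keys (snd z) \<subseteq> {..N}" using m by blast+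
      then show "(case z of (p, q) \<Rightarrow> mps_coeff (GQ_trunc k N la) p * mps_coeff (GQ_trunc (a + b) N ?tau) q)
        = (case z of (p, q) \<Rightarrow> mps_coeff (GQ la) p * mps_coeff (GQ ?tau) q)"
        by (simp add: case_prod_unfold GQ_trunc_coeff la tau)
    qed
    ultimately show ?thesis by simp
  qed
  then show "mps_coeff (GC (a + b + k) ?w) m = mps_coeff (GQ la * GQ ?tau) m"
    unfolding n_def by (rule ev_eqI)
qed

end
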